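(* Let $\{\mathbf{x}_k\}$ be generated by the zeroth-order scheme VRG-ZO described in the context, under the assumptions stated there. (a) [Constant stepsize] Let $\gamma_k := \gamma$ with $0<\gamma < \frac{\eta}{\sqrt{n}L_0}$ and $N_k := \lceil (k+1)^{1+\delta}\rceil$ for $k\ge 0$, where $\delta>0$. Then: (a-i) $\|G_{\eta,1/\gamma}(\mathbf{x}_k)\| \to 0$ almost surely as $k\to\infty$. (a-ii) Almost surely, every limit point of $\{\mathbf{x}_k\}$ lies in the set of $\eta$-Clarke stationary points of the problem $\min_{\mathbf{x}\in\mathcal{X}} f(\mathbf{x})$. (b) [Diminishing stepsize] Let $\{\gamma_k\}$ be a diminishing sequence that is square summable but non-summable, with $\gamma_0 \in \left(0,\frac{\eta}{2\sqrt{n}L_0}\right)$, and suppose $\sum_{k} \frac{\gamma_k}{N_k} < \infty$. Then: (b-i) $\|G_{\eta,1/\gamma_0}(\mathbf{x}_k)\| \to 0$ almost surely as $k\to\infty$. (b-ii) Almost surely, every limit point of $\{\mathbf{x}_k\}$ lies in the set of $\eta$-Clarke stationary points of $\min_{\mathbf{x}\in\mathcal{X}} f(\mathbf{x})$.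
   Context: Problem and assumptions. $\boldsymbol{\xi}:\Omega\to\mathbb{R}^d$ is a random variable on a probability space $(\Omega,\mathcal{F},\mathbb{P})$, $\tilde f:\mathbb{R}^n\times\mathbb{R}^d\to\mathbb{R}$, and $f(\mathbf{x})=\mathbb{E}[\tilde f(\mathbf{x},\boldsymbol{\xi})]$ is to be minimized over $\mathcal{X}\subseteq\mathbb{R}^n$. $\mathbb{B}=\{u\in\mathbb{R}^n:\|u\|\le 1\}$ and $\mathbb{S}=\{v\in\mathbb{R}^n:\|v\|=1\}$. It is assumed that: (i) for some $\eta_0>0$, almost surely $\tilde f(\cdot,\boldsymbol{\xi})$ is $\tilde L_0(\boldsymbol{\xi})$-Lipschitz on $\mathcal{X}+\eta_0\mathbb{B}$, where $L_0:=\sqrt{\mathbb{E}[\tilde L_0(\boldsymbol{\xi})^2]}<\infty$; (ii) $\mathcal{X}$ is nonempty, closed and convex; (iii) $\mathbb{E}[\tilde f(\mathbf{x},\boldsymbol{\xi})\mid\mathbf{x}]=f(\mathbf{x})$ for all $\mathbf{x}\in\mathcal{X}+\eta_0\mathbb{B}$. The smoothing parameter satisfies $0<\eta\le\eta_0$, and $f^*:=\inf_{\mathbf{x}\in\mathcal{X}}f(\mathbf{x})$ is finite. Smoothing. $f_\eta(\mathbf{x}):=\mathbb{E}_{\mathbf{u}}[f(\mathbf{x}+\eta\mathbf{u})]$ with $\mathbf{u}$ uniformly distributed on $\mathbb{B}$; it is $C^1$ on $\mathcal{X}$. Algorithm VRG-ZO. Given $\mathbf{x}_0\in\mathcal{X}$,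 stepsizes $\gamma_k>0$ and batch sizes $N_k\ge 1$ (integers), for $k=0,1,2,\dots$: draw samples $\xi_{j,k}$ distributed as $\boldsymbol{\xi}$ and $v_{j,k}$ uniformly distributed on $\eta\mathbb{S}$, $j=1,\dots,N_k$, all random samples being generated independently of each other over all $k\ge 0$ and $1\le j\le N_k$; set $$g_\eta(\mathbf{x}_k,v_{j,k},\xi_{j,k})=\frac{n}{2\eta}\left(\tilde f(\mathbf{x}_k+v_{j,k},\xi_{j,k})-\tilde f(\mathbf{x}_k-v_{j,k},\xi_{j,k})\right)\frac{v_{j,k}}{\|v_{j,k}\|},\qquad g_{\eta,N_k}(\mathbf{x}_k)=\frac1{N_k}\sum_{j=1}^{N_k}g_\eta(\mathbf{x}_k,v_{j,k},\xi_{j,k}),$$ and $\mathbf{x}_{k+1}=\Pi_{\mathcal{X}}[\mathbf{x}_k-\gamma_k g_{\eta,N_k}(\mathbf{x}_k)]$, where $\Pi_{\mathcal{X}}$ is the Euclidean projection onto $\mathcal{X}$. Residual. For $\beta>0$, $G_{\eta,\beta}(\mathbf{x}):=\beta\left(\mathbf{x}-\Pi_{\mathcal{X}}\left[\mathbf{x}-\frac1\beta\nabla f_\eta(\mathbf{x})\right]\right)$. Clarke stationarity. The Clarke directional derivative of a function $h$ at $\mathbf{x}$ in direction $v$ is $h^\circ(\mathbf{x},v)=\limsup_{\mathbf{y}\to\mathbf{x},\,t\downarrow0}\frac{h(\mathbf{y}+tv)-h(\mathbf{y})}{t}$; the Clarke generalized gradient is $\partial h(\mathbf{x})=\{\zeta\in\mathbb{R}^n: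 h^\circ(\mathbf{x},v)\ge\zeta^\top v\ \forall v\in\mathbb{R}^n\}$; the $\eta$-Clarke generalized gradient is $\partial_\eta h(\mathbf{x})=\mathrm{conv}\{\zeta:\zeta\in\partial h(\mathbf{y}),\ \|\mathbf{x}-\mathbf{y}\|\le\eta\}$. A point $\mathbf{x}\in\mathcal{X}$ is $\eta$-Clarke stationary for $\min_{\mathcal{X}}f$ if $0\in\partial_\eta f(\mathbf{x})+\mathcal{N}_{\mathcal{X}}(\mathbf{x})$, where $\mathcal{N}_{\mathcal{X}}(\mathbf{x})$ is the normal cone of $\mathcal{X}$ at $\mathbf{x}$. *)

theory Defs
  imports "HOL-Probability.Probability"
begin

text \<open>Minkowski enlargement \<open>X + r B\<close>, with \<open>B\<close> the closed Euclidean unit ball.\<close>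

definition enlarge :: "'a::real_normed_vector set \<Rightarrow> real \<Rightarrow> 'a set" where
  "enlarge X r = {x + r *\<^sub>R u |x u. x \<in> X \<and> norm u \<le> 1}"

text \<open>
  The uniform law on the sphere of radius \<open>r\<close> (normalised surface measure), realised as the law of
  \<open>r u / norm u\<close> for \<open>u\<close> uniform on the unit ball; \<open>u = 0\<close> has probability zero.
\<close>

definition uniform_sphere :: "real \<Rightarrow> 'a::euclidean_space measure" where
  "uniform_sphere r = distr (uniform_measure lborel (cball 0 1)) borel (\<lambda>u. r *\<^sub>R sgn u)"

text \<open>
  \<open>E[h (x + \<eta> u)]\<close> for \<open>u\<close> uniform on the unit ball. The expectation is written as a set integral
  because \<open>h\<close> need not be measurable away from the ball of radius \<open>\<eta>\<close> around \<open>x\<close>; integrating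
  with respect to \<^const>\<open>uniform_measure\<close> would require global measurability.
\<close>

definition smoothing :: "real \<Rightarrow> ('a::euclidean_space \<Rightarrow> real) \<Rightarrow> 'a \<Rightarrow> real" where
  "smoothing \<eta> h x =
     (LINT u:cball 0 1|lborel. h (x + \<eta> *\<^sub>R u)) / measure lborel (cball (0::'a) 1)"

definition grad :: "('a::euclidean_space \<Rightarrow> real) \<Rightarrow> 'a \<Rightarrow> 'a" where
  "grad h x = (THE D. GDERIV h x :> D)"

definition residual :: "'a::euclidean_space set \<Rightarrow> ('a \<Rightarrow> real) \<Rightarrow> real \<Rightarrow> 'a \<Rightarrow> 'a" where
  "residual X h \<beta> x = \<beta> *\<^sub>R (x - closest_point X (x - (1 / \<beta>) *\<^sub>R grad h x))"

definition zo_grad ::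
  "(real^'n::finite \<Rightarrow> real^'d::finite \<Rightarrow> real) \<Rightarrow> real \<Rightarrow> real^'n \<Rightarrow> real^'n \<Rightarrow> real^'d \<Rightarrow> real^'n" where
  "zo_grad ft \<eta> x v z =
     (real CARD('n) / (2 * \<eta>) * (ft (x + v) z - ft (x - v) z)) *\<^sub>R (v /\<^sub>R norm v)"

definition zo_grad_batch ::
  "(real^'n::finite \<Rightarrow> real^'d::finite \<Rightarrow> real) \<Rightarrow> real \<Rightarrow> nat \<Rightarrow> real^'n
     \<Rightarrow> (nat \<Rightarrow> real^'n) \<Rightarrow> (nat \<Rightarrow> real^'d) \<Rightarrow> real^'n" where
  "zo_grad_batch ft \<eta> m x v z = (1 / real m) *\<^sub>R (\<Sum>j=1..m. zo_grad ft \<eta> x (v j) (z j))"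

text \<open>
  Mutual independence of the two families \<open>Z\<close> and \<open>V\<close> taken together. Since they have different
  value types, \<open>indep_vars\<close> does not apply directly; this is the same condition on the
  generated \<open>\<sigma>\<close>-algebras, indexed by a disjoint sum.
\<close>

definition (in prob_space) indep_samples ::
  "('i \<Rightarrow> 'a \<Rightarrow> 'b::topological_space) \<Rightarrow> ('i \<Rightarrow> 'a \<Rightarrow> 'c::topological_space) \<Rightarrow> 'i set \<Rightarrow> bool" where
  "indep_samples Z V I \<longleftrightarrow>
     (\<forall>i\<in>I. Z i \<in> borel_measurable M \<and> V i \<in> borel_measurable M) \<and>
     indep_sets (case_sum (\<lambda>i. {Z i -` A \<inter> space M |A. A \<in> sets borel})
                          (\<lambda>i. {V i -` A \<inter> space M |A. A \<in> sets borel})) (I <+> I)"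

definition clarke_dd :: "('a::euclidean_space \<Rightarrow> real) \<Rightarrow> 'a \<Rightarrow> 'a \<Rightarrow> ereal" where
  "clarke_dd h x v =
     Limsup (nhds x \<times>\<^sub>F at_right (0::real)) (\<lambda>(y, t). ereal ((h (y + t *\<^sub>R v) - h y) / t))"

definition clarke_grad :: "('a::euclidean_space \<Rightarrow> real) \<Rightarrow> 'a \<Rightarrow> 'a set" where
  "clarke_grad h x = {\<zeta>. \<forall>v. clarke_dd h x v \<ge> ereal (\<zeta> \<bullet> v)}"

definition eta_clarke_grad :: "real \<Rightarrow> ('a::euclidean_space \<Rightarrow> real) \<Rightarrow> 'a \<Rightarrow> 'a set" where
  "eta_clarke_grad \<eta> h x = convex hull {\<zeta>. \<exists>y. \<zeta> \<in> clarke_grad h y \<and> norm (x - y) \<le> \<eta>}"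

definition normal_cone :: "'a::euclidean_space set \<Rightarrow> 'a \<Rightarrow> 'a set" where
  "normal_cone X x = {w. x \<in> X \<and> (\<forall>y\<in>X. w \<bullet> (y - x) \<le> 0)}"

definition eta_clarke_stationary ::
  "real \<Rightarrow> 'a::euclidean_space set \<Rightarrow> ('a \<Rightarrow> real) \<Rightarrow> 'a set" where
  "eta_clarke_stationary \<eta> X h =
     {x \<in> X. \<exists>\<zeta> \<in> eta_clarke_grad \<eta> h x. \<exists>w \<in> normal_cone X x. 0 = \<zeta> + w}"

definition seq_limit_points :: "(nat \<Rightarrow> 'a::topological_space) \<Rightarrow> 'a set" where
  "seq_limit_points s = {l. \<exists>r. strict_mono r \<and> (s \<circ> r) \<longlonglongrightarrow> l}"

end

theory Submission
  imports Defs
begin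

text \<open>
  The integrand is replaced by a globally Lipschitz one that agrees with it on the enlarged
  feasible set, outside a null set of samples. Averaging over the ball then gives a smoothing with a Lipschitz
  gradient, and this gradient is \<open>n / \<eta>\<close> times the mean of \<open>f (x + v) v / norm v\<close> over the sphere, the mean
  of the estimator. Taking total expectations in the descent inequality of the projected step, the first-order noise
  term vanishes by independence, so \<open>(norm (x (k+1) - x k))\<^sup>2 / \<gamma> k\<close> and \<open>\<gamma> k * (norm (noise k))\<^sup>2\<close>
  are almost surely summable; no martingale convergence is needed, and the rest is an argument along a single path.
  At a limit point the negative sphere mean lies in the normal cone, and the sphere mean itself lies in
  the convex hull of the Clarke gradients over the open ball, by separation in finite dimension.
\<close>

section \<open>Second moments of the uniform law on the sphere\<close>

text \<open>The integrand is controlled only on the enlarged set and only outside a null set;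
  replacing it defers every exceptional set to the end. The constant in the quadratic expansion has
  to be \<open>sqrt n * L0 / \<eta>\<close> to admit all allowed constant stepsizes. Lipschitz
  continuity of the spherical mean alone gives \<open>n * L0 / \<eta>\<close>; the gain is that the
  mean of \<open>\<bar>sgn u \<bullet> a\<bar>\<close> is at most \<open>norm a / sqrt n\<close>.
  Noise is correlated with the step that it causes, so the descent inequality pairs it with the step
  of the exact gradient, at the cost of \<open>\<gamma> k\<close> times the squared noise. The error
  of one sample has an envelope that does not depend on the iterate, so this cost has expectation of
  order \<open>\<gamma> k / N k\<close>. For diminishing stepsizes, summability of
  \<open>\<gamma> k\<close> times the squared residual controls only a lower limit; slow variation
  of the iterates turns it into a limit. The hull uses the open ball because, for
  \<open>\<eta> = \<eta>0\<close>, every neighbourhood of a boundary point may contain points where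
  \<open>f\<close> is arbitrary.\<close>

abbreviation unif_ball :: "'a::euclidean_space measure" where
  "unif_ball \<equiv> uniform_measure lborel (cball 0 1)"

lemma prob_space_unif_ball: "prob_space (unif_ball :: 'a::euclidean_space measure)"
proof (rule prob_space_uniform_measure)
  have "unit_ball_vol (real DIM('a)) \<noteq> 0"
    by (metis less_irrefl of_nat_0_le_iff unit_ball_vol_pos)
  then show "emeasure lborel (cball (0::'a) 1) \<noteq> 0"
    by (simp add: emeasure_cball)
qed (simp add: emeasure_cball)

interpretation unif_ball: prob_space "unif_ball :: 'a::euclidean_space measure"
  by (rule prob_space_unif_ball)

lemma AE_unif_ball_norm: "AE u in (unif_ball :: 'a::euclidean_space measure). u \<noteq> 0 \<and> norm u \<le> 1"
proof (rule AE_uniform_measureI)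
  have "AE u in lborel. u \<noteq> (0::'a)"
    by (rule AE_lborel_singleton)
  then show "AE u in lborel. u \<in> cball (0::'a) 1 \<longrightarrow> u \<noteq> 0 \<and> norm u \<le> 1"
    by eventually_elim auto
qed simp

lemma ball_vol_pos: "0 < measure lborel (cball (0::'a::euclidean_space) 1)"
  by (simp add: content_cball)

lemma borel_measurable_indicator_cball [measurable]:
  "indicator (cball x r) \<in> borel_measurable (borel :: 'a::euclidean_space measure)"
  by (intro borel_measurable_indicator borel_closed closed_cball)

text \<open>A real-valued density is the form in which \<open>integral_density\<close> converts
  means over the ball to Lebesgue integrals, also for vector-valued integrands.\<close>

lemma unif_ball_eq_density:
  "(unif_ball :: 'a::euclidean_space measure) =
    density lborel (\<lambda>u. ennreal (indicator (cball 0 1) u / measure lborel (cball (0::'a) 1)))"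
proof -
  have "emeasure lborel (cball (0::'a) 1) = ennreal (measure lborel (cball (0::'a) 1))"
    by (simp add: emeasure_eq_ennreal_measure emeasure_cball)
  then show ?thesis
    unfolding uniform_measure_def
    by (intro density_cong, measurable)
       (auto simp: divide_ennreal ball_vol_pos split: split_indicator simp flip: ennreal_1)
qed

lemma integral_unif_ball:
  fixes \<phi> :: "'a::euclidean_space \<Rightarrow> 'b::{banach, second_countable_topology}"
  assumes [measurable]: "\<phi> \<in> borel_measurable borel"
  shows "(\<integral>u. \<phi> u \<partial>unif_ball) =
    (\<integral>u. indicator (cball 0 1) u *\<^sub>R \<phi> u \<partial>lborel) /\<^sub>R measure lborel (cball (0::'a) 1)"
proof -
  define c where "c = inverse (measure lborel (cball (0::'a) 1))"
  have c: "c > 0"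
    unfolding c_def using ball_vol_pos by auto
  have eq: "(unif_ball :: 'a measure) = density lborel (\<lambda>u. ennreal (c * indicator (cball 0 1) u))"
    unfolding unif_ball_eq_density c_def by (simp add: divide_inverse mult.commute)
  have "(\<integral>u. \<phi> u \<partial>unif_ball) = (\<integral>u. c *\<^sub>R (indicator (cball 0 1) u *\<^sub>R \<phi> u) \<partial>lborel)"
    unfolding eq using c by (subst integral_density) auto
  then show ?thesis
    by (simp only: integral_scaleR_right c_def)
qed

lemma smoothing_eq_unif_ball:
  fixes f :: "'a::euclidean_space \<Rightarrow> real"
  assumes [measurable]: "f \<in> borel_measurable borel"
  shows "smoothing r f x = (\<integral>u. f (x + r *\<^sub>R u) \<partial>unif_ball)"
  by (subst integral_unif_ball) (auto simp: smoothing_def set_lebesgue_integral_def field_simps)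

lemma unif_ball_integrable_bounded:
  fixes \<phi> :: "'a::euclidean_space \<Rightarrow> 'b::{banach, second_countable_topology}"
  assumes [measurable]: "\<phi> \<in> borel_measurable borel"
    and "\<And>u. norm u \<le> 1 \<Longrightarrow> norm (\<phi> u) \<le> C"
  shows "integrable unif_ball \<phi>"
  using AE_unif_ball_norm by (intro unif_ball.integrable_const_bound[where B=C]) (auto simp: assms(2))

lemma norm_sgn_le: "norm (sgn (u::'a::real_normed_vector)) \<le> 1"
  by (simp add: norm_sgn)

lemma abs_inner_sgn_le:
  fixes a :: "'a::real_inner"
  shows "\<bar>sgn u \<bullet> a\<bar> \<le> norm a"
  using Cauchy_Schwarz_ineq2[of "sgn u" a] mult_right_mono[OF norm_sgn_le[of u] norm_ge_zero[of a]] by simp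

lemma borel_measurable_sgn_vec [measurable]:
  "(sgn :: 'a::euclidean_space \<Rightarrow> 'a) \<in> borel_measurable borel"
  unfolding sgn_div_norm[abs_def] by measurable

lemma lborel_scale_ball:
  fixes \<phi> :: "'a::euclidean_space \<Rightarrow> 'b::{banach, second_countable_topology}"
  assumes [measurable]: "\<phi> \<in> borel_measurable borel" and r: "r > 0"
  shows "(\<integral>z. indicator (cball x r) z *\<^sub>R \<phi> z \<partial>lborel) =
    r ^ DIM('a) *\<^sub>R (\<integral>u. indicator (cball 0 1) u *\<^sub>R \<phi> (x + r *\<^sub>R u) \<partial>lborel)"
proof -
  let ?g = "\<lambda>z. indicator (cball x r) z *\<^sub>R \<phi> z"
  have "(\<integral>z. ?g z \<partial>lborel) =
    (\<integral>z. ?g z \<partial>density (distr lborel borel (\<lambda>u. x + r *\<^sub>R u)) (\<lambda>_. ennreal (r ^ DIM('a))))"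
    using r lborel_affine[of r x] by simp
  also have "\<dots> = (\<integral>z. r ^ DIM('a) *\<^sub>R ?g z \<partial>distr lborel borel (\<lambda>u. x + r *\<^sub>R u))"
    using r by (subst integral_density) auto
  also have "\<dots> = r ^ DIM('a) *\<^sub>R (\<integral>u. ?g (x + r *\<^sub>R u) \<partial>lborel)"
    by (subst integral_distr) (auto simp del: scaleR_scaleR)
  also have "(\<lambda>u. indicator (cball x r) (x + r *\<^sub>R u) :: real) = indicator (cball 0 1)"
    using r by (auto simp: fun_eq_iff indicator_def dist_norm)
  finally show ?thesis .
qed

text \<open>Coordinate permutations and reflections are the only isometries needed to compute the second moments.\<close>

lemma distr_lborel_permute:
  fixes \<sigma> :: "'a::euclidean_space \<Rightarrow> 'a"
  assumes \<sigma>: "bij_betw \<sigma> Basis Basis"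
  shows "distr lborel borel (\<lambda>x. \<Sum>b\<in>Basis. (x \<bullet> \<sigma> b) *\<^sub>R b) = lborel"
proof (rule lborel_eqI[symmetric])
  define T :: "'a \<Rightarrow> 'a" where "T x = (\<Sum>b\<in>Basis. (x \<bullet> \<sigma> b) *\<^sub>R b)" for x
  have [measurable]: "T \<in> borel_measurable borel"
    unfolding T_def by measurable
  fix l u :: 'a assume le: "\<And>b. b \<in> Basis \<Longrightarrow> l \<bullet> b \<le> u \<bullet> b"
  define \<tau> where "\<tau> = the_inv_into Basis \<sigma>"
  have \<tau>: "bij_betw \<tau> Basis Basis" "\<And>b. b \<in> Basis \<Longrightarrow> \<tau> (\<sigma> b) = b" "\<And>b. b \<in> Basis \<Longrightarrow> \<sigma> (\<tau> b) = b"
    unfolding \<tau>_def using \<sigma>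
    using bij_betw_the_inv_into[OF \<sigma>]
    by (auto simp: the_inv_into_f_f f_the_inv_into_f bij_betw_def)
  define l' u' where "l' = (\<Sum>b\<in>Basis. (l \<bullet> \<tau> b) *\<^sub>R b)" and "u' = (\<Sum>b\<in>Basis. (u \<bullet> \<tau> b) *\<^sub>R b)"
  have lu: "l' \<bullet> b = l \<bullet> \<tau> b" "u' \<bullet> b = u \<bullet> \<tau> b" if "b \<in> Basis" for b
    using that unfolding l'_def u'_def by simp_all
  have mem: "\<sigma> b \<in> Basis" "\<tau> b \<in> Basis" if "b \<in> Basis" for b
    using \<sigma> \<tau> that by (auto simp: bij_betw_def)
  have "x \<in> T -` box l u \<longleftrightarrow> x \<in> box l' u'" for x
  proof -
    have "T x \<bullet> b = x \<bullet> \<sigma> b" if "b \<in> Basis" for b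
      unfolding T_def using that by simp
    then have "x \<in> T -` box l u \<longleftrightarrow> (\<forall>b\<in>Basis. l \<bullet> b < x \<bullet> \<sigma> b \<and> x \<bullet> \<sigma> b < u \<bullet> b)"
      by (auto simp: mem_box)
    also have "\<dots> \<longleftrightarrow> (\<forall>b\<in>Basis. l' \<bullet> b < x \<bullet> b \<and> x \<bullet> b < u' \<bullet> b)"
    proof safe
      fix b :: 'a assume b: "b \<in> Basis" and *: "\<forall>b\<in>Basis. l \<bullet> b < x \<bullet> \<sigma> b \<and> x \<bullet> \<sigma> b < u \<bullet> b"
      show "l' \<bullet> b < x \<bullet> b" "x \<bullet> b < u' \<bullet> b"
        using *[rule_format, OF mem(2)[OF b]] b by (auto simp: lu \<tau>)
    next
      fix b :: 'a assume b: "b \<in> Basis" and *: "\<forall>b\<in>Basis. l' \<bullet> b < x \<bullet> b \<and> x \<bullet> b < u' \<bullet> b"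
      show "l \<bullet> b < x \<bullet> \<sigma> b" "x \<bullet> \<sigma> b < u \<bullet> b"
        using *[rule_format, OF mem(1)[OF b]] b by (auto simp: lu \<tau> mem)
    qed
    finally show ?thesis by (simp add: mem_box)
  qed
  then have eq: "T -` box l u = box l' u'" by blast
  have "emeasure (distr lborel borel T) (box l u) = emeasure lborel (box l' u')"
    by (simp add: emeasure_distr eq)
  also have "\<dots> = (\<Prod>b\<in>Basis. (u' - l') \<bullet> b)"
    using le mem by (simp add: emeasure_lborel_box_eq lu)
  also have "(\<Prod>b\<in>Basis. (u' - l') \<bullet> b) = (\<Prod>b\<in>Basis. (u - l) \<bullet> \<tau> b)"
    by (intro prod.cong) (auto simp: lu inner_diff_left)
  also have "\<dots> = (\<Prod>b\<in>Basis. (u - l) \<bullet> b)"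
    by (rule prod.reindex_bij_betw[OF \<tau>(1), of "\<lambda>b. (u - l) \<bullet> b"])
  finally show "emeasure (distr lborel borel (\<lambda>x. \<Sum>b\<in>Basis. (x \<bullet> \<sigma> b) *\<^sub>R b)) (box l u) = (\<Prod>b\<in>Basis. (u - l) \<bullet> b)"
    unfolding T_def[abs_def] .
qed simp

lemma distr_lborel_reflect:
  fixes c :: "'a::euclidean_space \<Rightarrow> real"
  assumes c: "\<And>b. b \<in> Basis \<Longrightarrow> \<bar>c b\<bar> = 1"
  shows "distr lborel borel (\<lambda>x. \<Sum>b\<in>Basis. (c b * (x \<bullet> b)) *\<^sub>R b) = lborel"
proof -
  have "c b \<noteq> 0" if "b \<in> Basis" for b using c[OF that] by auto
  then show ?thesis
    by (subst (2) lborel_affine_euclidean[of c 0]) (auto simp: c density_1)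
qed

lemma integral_unif_ball_isometry:
  fixes \<phi> :: "'a::euclidean_space \<Rightarrow> 'b::{banach, second_countable_topology}" and T :: "'a \<Rightarrow> 'a"
  assumes [measurable]: "\<phi> \<in> borel_measurable borel" "T \<in> borel_measurable borel"
    and d: "distr lborel borel T = lborel" and n: "\<And>u. norm (T u) = norm u"
  shows "(\<integral>u. \<phi> (T u) \<partial>unif_ball) = (\<integral>u. \<phi> u \<partial>unif_ball)"
proof -
  have "(\<integral>u. indicator (cball 0 1) u *\<^sub>R \<phi> u \<partial>lborel) = (\<integral>u. indicator (cball 0 1) (T u) *\<^sub>R \<phi> (T u) \<partial>lborel)"
    by (subst d[symmetric], subst integral_distr) auto
  also have "(\<lambda>u. indicator (cball 0 1) (T u) :: real) = indicator (cball 0 1)"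
    by (auto simp: indicator_def n)
  finally have "(\<integral>u. indicator (cball 0 1) u *\<^sub>R \<phi> u \<partial>lborel) = (\<integral>u. indicator (cball 0 1) u *\<^sub>R \<phi> (T u) \<partial>lborel)" .
  then show ?thesis
    by (simp add: integral_unif_ball)
qed

lemma sgn_linear_isometry:
  assumes "linear T" "\<And>u. norm (T u) = norm u"
  shows "sgn (T u) = T (sgn u)"
  by (simp add: sgn_div_norm assms linear_scale)

lemma norm_sum_Basis:
  fixes g :: "'a::euclidean_space \<Rightarrow> real"
  shows "norm (\<Sum>b\<in>Basis. g b *\<^sub>R b) = sqrt (\<Sum>b\<in>Basis. (g b)\<^sup>2)"
  unfolding norm_eq_sqrt_inner euclidean_inner[of "\<Sum>b\<in>Basis. g b *\<^sub>R b" "\<Sum>b\<in>Basis. g b *\<^sub>R b"]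
  by (simp add: power2_eq_square)

text \<open>Reflecting the coordinate \<open>i\<close> preserves the law and changes the sign of the
  integrand.\<close>

lemma unif_ball_sgn_second_moment_off:
  fixes i j :: "'a::euclidean_space"
  assumes ij: "i \<in> Basis" "j \<in> Basis" "i \<noteq> j"
  shows "(\<integral>u. (sgn u \<bullet> i) * (sgn u \<bullet> j) \<partial>unif_ball) = 0"
proof -
  define c where "c b = (if b = i then -1 else 1 :: real)" for b :: 'a
  define T where "T x = (\<Sum>b\<in>Basis. (c b * (x \<bullet> b)) *\<^sub>R b)" for x :: 'a
  have lin: "linear T"
    unfolding T_def by (intro linear_compose_sum linearI ballI) (auto simp: inner_simps algebra_simps)
  have [measurable]: "T \<in> borel_measurable borel" unfolding T_def by measurable
  have n: "norm (T u) = norm u" for u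
    unfolding T_def norm_sum_Basis norm_eq_sqrt_inner[of u] euclidean_inner[of u u]
    by (auto simp: c_def power2_eq_square intro!: sum.cong arg_cong[where f=sqrt])
  have comp: "T u \<bullet> i = - (u \<bullet> i)" "T u \<bullet> j = u \<bullet> j" for u
    unfolding T_def using ij by (auto simp: c_def)
  have "(\<integral>u. (sgn u \<bullet> i) * (sgn u \<bullet> j) \<partial>unif_ball) = (\<integral>u. (sgn (T u) \<bullet> i) * (sgn (T u) \<bullet> j) \<partial>unif_ball)"
    using n by (intro integral_unif_ball_isometry[symmetric, where T=T])
       (auto simp: T_def[abs_def] c_def intro!: distr_lborel_reflect)
  also have "\<dots> = - (\<integral>u. (sgn u \<bullet> i) * (sgn u \<bullet> j) \<partial>unif_ball)"
    by (simp add: sgn_linear_isometry[OF lin n] comp)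
  finally show ?thesis by simp
qed

text \<open>Exchanging two coordinates preserves the law, so all these moments coincide; they add up
  to the mean of \<open>(norm (sgn u))^2\<close>, which is 1 since \<open>u \<noteq> 0\<close>
  almost everywhere.\<close>

lemma unif_ball_sgn_second_moment_diag:
  fixes i :: "'a::euclidean_space"
  assumes i: "i \<in> Basis"
  shows "(\<integral>u. (sgn u \<bullet> i)\<^sup>2 \<partial>(unif_ball :: 'a measure)) = 1 / DIM('a)"
proof -
  have int: "integrable unif_ball (\<lambda>u::'a. (sgn u \<bullet> b)\<^sup>2)" if b: "b \<in> Basis" for b
  proof (rule unif_ball_integrable_bounded[where C=1])
    fix u :: 'a
    have "\<bar>sgn u \<bullet> b\<bar> \<le> norm (sgn u)" using b by (rule Basis_le_norm)
    then have "\<bar>sgn u \<bullet> b\<bar> \<le> 1" using norm_sgn_le[of u] by linarith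
    then show "norm ((sgn u \<bullet> b)\<^sup>2) \<le> 1" by (simp add: abs_square_le_1)
  qed measurable
  have same: "(\<integral>u. (sgn u \<bullet> j)\<^sup>2 \<partial>(unif_ball :: 'a measure)) = (\<integral>u. (sgn u \<bullet> i)\<^sup>2 \<partial>(unif_ball :: 'a measure))" if j: "j \<in> Basis" for j :: 'a
  proof -
    define \<sigma> where "\<sigma> = Transposition.transpose i j"
    have \<sigma>: "bij_betw \<sigma> Basis Basis"
      unfolding \<sigma>_def using i j by (auto simp: Transposition.transpose_def bij_betw_def inj_on_def split: if_splits)
    define T where "T x = (\<Sum>b\<in>Basis. (x \<bullet> \<sigma> b) *\<^sub>R b)" for x :: 'a
    have lin: "linear T"
      unfolding T_def by (intro linear_compose_sum linearI ballI) (auto simp: inner_simps algebra_simps)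
    have [measurable]: "T \<in> borel_measurable borel" unfolding T_def by measurable
    have n: "norm (T u) = norm u" for u
    proof -
      have "(\<Sum>b\<in>Basis. (u \<bullet> \<sigma> b)\<^sup>2) = (\<Sum>b\<in>Basis. (u \<bullet> b)\<^sup>2)"
        by (rule sum.reindex_bij_betw[OF \<sigma>])
      then show ?thesis
        unfolding T_def norm_sum_Basis norm_eq_sqrt_inner[of u] euclidean_inner[of u u]
        by (simp add: power2_eq_square)
    qed
    have comp: "T u \<bullet> i = u \<bullet> j" for u
      unfolding T_def using i by (simp add: \<sigma>_def)
    have "(\<integral>u. (sgn u \<bullet> i)\<^sup>2 \<partial>unif_ball) = (\<integral>u. (sgn (T u) \<bullet> i)\<^sup>2 \<partial>unif_ball)"
      using n distr_lborel_permute[OF \<sigma>]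
      by (intro integral_unif_ball_isometry[symmetric, where T=T]) (auto simp: T_def[abs_def])
    also have "\<dots> = (\<integral>u. (sgn u \<bullet> j)\<^sup>2 \<partial>unif_ball)"
      by (simp add: sgn_linear_isometry[OF lin n] comp)
    finally show ?thesis by simp
  qed
  have "DIM('a) * (\<integral>u. (sgn u \<bullet> i)\<^sup>2 \<partial>unif_ball) = (\<Sum>j\<in>Basis. \<integral>u. (sgn u \<bullet> j)\<^sup>2 \<partial>(unif_ball :: 'a measure))"
    by (simp add: same)
  also have "\<dots> = (\<integral>u. (\<Sum>j\<in>Basis. (sgn u \<bullet> j)\<^sup>2) \<partial>(unif_ball :: 'a measure))"
    by (subst Bochner_Integration.integral_sum) (auto intro: int)
  also have "\<dots> = (\<integral>u. 1 \<partial>(unif_ball :: 'a measure))"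
  proof (rule integral_cong_AE)
    show "AE u in (unif_ball :: 'a measure). (\<Sum>j\<in>Basis. (sgn u \<bullet> j)\<^sup>2) = 1"
      using AE_unif_ball_norm
    proof eventually_elim
      case (elim u)
      have "(\<Sum>j\<in>Basis. (sgn u \<bullet> j)\<^sup>2) = (norm (sgn u))\<^sup>2"
        unfolding power2_norm_eq_inner euclidean_inner[of "sgn u" "sgn u"] by (simp add: power2_eq_square)
      then show ?case using elim by (simp add: norm_sgn)
    qed
  qed measurable
  also have "\<dots> = 1" using unif_ball.prob_space[where 'a='a] by simp
  finally show ?thesis by (simp add: field_simps)
qed

lemma unif_ball_sgn_second_moment:
  fixes a :: "'a::euclidean_space"
  shows "(\<integral>u. (sgn u \<bullet> a)\<^sup>2 \<partial>unif_ball) = (norm a)\<^sup>2 / DIM('a)"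
proof -
  have int: "integrable unif_ball (\<lambda>u::'a. (a \<bullet> i) * (a \<bullet> j) * ((sgn u \<bullet> i) * (sgn u \<bullet> j)))" for i j
  proof (rule unif_ball_integrable_bounded[where C="\<bar>(a \<bullet> i) * (a \<bullet> j)\<bar> * (norm i * norm j)"])
    fix u :: 'a
    show "norm ((a \<bullet> i) * (a \<bullet> j) * ((sgn u \<bullet> i) * (sgn u \<bullet> j))) \<le> \<bar>(a \<bullet> i) * (a \<bullet> j)\<bar> * (norm i * norm j)"
      unfolding real_norm_def abs_mult[of "(a \<bullet> i) * (a \<bullet> j)"] abs_mult[of "sgn u \<bullet> i"]
      by (intro mult_left_mono mult_mono abs_inner_sgn_le) auto
  qed measurable
  have sq: "(sgn u \<bullet> a)\<^sup>2 = (\<Sum>i\<in>Basis. \<Sum>j\<in>Basis. (a \<bullet> i) * (a \<bullet> j) * ((sgn u \<bullet> i) * (sgn u \<bullet> j)))" for u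
    unfolding power2_eq_square
    unfolding euclidean_inner[of "sgn u" a] sum_product
    by (auto intro!: sum.cong)
  have "(\<integral>u. (sgn u \<bullet> a)\<^sup>2 \<partial>unif_ball) = (\<Sum>i\<in>Basis. \<Sum>j\<in>Basis. (a \<bullet> i) * (a \<bullet> j) * (\<integral>u. (sgn u \<bullet> i) * (sgn u \<bullet> j) \<partial>unif_ball))"
    unfolding sq
    apply (subst Bochner_Integration.integral_sum)
     apply (intro Bochner_Integration.integrable_sum int)
    apply (subst Bochner_Integration.integral_sum)
     apply (rule int)
    apply simp
    done
  also have "\<dots> = (\<Sum>i\<in>Basis. \<Sum>j\<in>Basis. if j = i then (a \<bullet> i) * (a \<bullet> i) / DIM('a) else 0)"
    by (intro sum.cong refl)
       (auto simp: unif_ball_sgn_second_moment_off unif_ball_sgn_second_moment_diag[unfolded power2_eq_square])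
  also have "\<dots> = (norm a)\<^sup>2 / DIM('a)"
    unfolding power2_norm_eq_inner euclidean_inner[of a a] by (simp add: sum_divide_distrib)
  finally show ?thesis .
qed

text \<open>The variance of \<open>\<bar>sgn u \<bullet> a\<bar>\<close> is nonnegative, so the
  first moment is at most the root of the second.\<close>

lemma unif_ball_abs_inner_sgn_le:
  fixes a :: "'a::euclidean_space"
  shows "(\<integral>u. \<bar>sgn u \<bullet> a\<bar> \<partial>unif_ball) \<le> norm a / sqrt DIM('a)"
proof -
  have i1: "integrable unif_ball (\<lambda>u. \<bar>sgn u \<bullet> a\<bar>)"
    by (rule unif_ball_integrable_bounded[where C="norm a"]) (auto simp: abs_inner_sgn_le)
  have i2: "integrable unif_ball (\<lambda>u. \<bar>sgn u \<bullet> a\<bar>\<^sup>2)"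
    by (rule unif_ball_integrable_bounded[where C="(norm a)\<^sup>2"])
       (use power_mono[OF abs_inner_sgn_le[of _ a] abs_ge_zero, where n=2] in auto)
  have "0 \<le> (\<integral>u. \<bar>sgn u \<bullet> a\<bar>\<^sup>2 \<partial>unif_ball) - (\<integral>u. \<bar>sgn u \<bullet> a\<bar> \<partial>unif_ball)\<^sup>2"
    using unif_ball.variance_eq[OF i1 i2] unif_ball.variance_positive by metis
  then have "(\<integral>u. \<bar>sgn u \<bullet> a\<bar> \<partial>unif_ball)\<^sup>2 \<le> (norm a / sqrt DIM('a))\<^sup>2"
    by (simp add: unif_ball_sgn_second_moment power_divide)
  then show ?thesis
    by (rule power2_le_imp_le) simp
qed

section \<open>Smoothing over balls\<close>

lemma integrable_indicator_cball_bounded: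
  fixes \<phi> :: "'a::euclidean_space \<Rightarrow> real"
  assumes [measurable]: "\<phi> \<in> borel_measurable borel"
    and "\<And>u. norm (u - x) \<le> r \<Longrightarrow> \<bar>\<phi> u\<bar> \<le> C"
  shows "integrable lborel (\<lambda>u. indicator (cball x r) u * \<phi> u)"
proof (rule Bochner_Integration.integrable_bound)
  show "integrable lborel (\<lambda>u. C * indicator (cball x r) u :: real)"
    by (cases "r \<ge> 0") (auto simp: emeasure_cball not_le intro!: integrable_mult_right integrable_real_indicator)
  show "AE u in lborel. norm (indicator (cball x r) u * \<phi> u) \<le> norm (C * indicator (cball x r) u :: real)"
    using assms(2) by (intro AE_I2) (fastforce simp: indicator_def dist_norm norm_minus_commute)
qed measurable

lemma lborel_integral_shift:
  fixes \<phi> :: "'a::euclidean_space \<Rightarrow> 'b::{banach, second_countable_topology}"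
  assumes [measurable]: "\<phi> \<in> borel_measurable borel"
  shows "(\<integral>y. \<phi> (c + y) \<partial>lborel) = (\<integral>y. \<phi> y \<partial>lborel)"
  using integral_distr[of "(+) c" lborel borel \<phi>] by (simp add: lborel_distr_plus)

text \<open>Since \<open>sgn\<close> is invariant under positive scaling, only the volume factor
  changes. This takes the place of polar coordinates.\<close>

lemma lborel_sgn_scale_ball:
  fixes \<psi> :: "'a::euclidean_space \<Rightarrow> real"
  assumes [measurable]: "\<psi> \<in> borel_measurable borel" and "r > 0"
  shows "(\<integral>u. indicator (cball 0 r) u * \<psi> (sgn u) \<partial>lborel) =
    r ^ DIM('a) * (\<integral>u. indicator (cball 0 1) u * \<psi> (sgn u) \<partial>lborel)"
proof -
  have "sgn (r *\<^sub>R u) = sgn u" for u :: 'a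
    using assms by (simp add: sgn_scaleR)
  then show ?thesis
    using lborel_scale_ball[of "\<lambda>u. \<psi> (sgn u)" r 0] assms by simp
qed

text \<open>
  The smoothing kernel of the unit ball is approximated from below by the Lipschitz cutoff
  \<open>ball_cutoff e\<close>, whose gradient is \<open>- sgn u / e\<close> on the shell \<open>1 - e < norm u < 1\<close>.
\<close>

definition ball_cutoff :: "real \<Rightarrow> 'a::real_normed_vector \<Rightarrow> real" where
  "ball_cutoff e u = max 0 (min 1 ((1 - norm u) / e))"

definition shell :: "real \<Rightarrow> 'a::real_normed_vector \<Rightarrow> real" where
  "shell e u = indicator (cball 0 1) u - indicator (cball 0 (1 - e)) u"

lemma ball_cutoff_measurable [measurable]:
  "ball_cutoff e \<in> borel_measurable (borel :: 'a::euclidean_space measure)"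
  unfolding ball_cutoff_def[abs_def] by measurable

lemma shell_measurable [measurable]:
  "shell e \<in> borel_measurable (borel :: 'a::euclidean_space measure)"
  unfolding shell_def[abs_def] by measurable

lemma ball_cutoff_bounds: "0 \<le> ball_cutoff e u" "ball_cutoff e u \<le> 1"
  unfolding ball_cutoff_def by auto

lemma ball_cutoff_eq_0: "e > 0 \<Longrightarrow> norm u \<ge> 1 \<Longrightarrow> ball_cutoff e u = 0"
  unfolding ball_cutoff_def using divide_nonpos_pos[of "1 - norm u" e] by (auto simp: max_def min_def)

lemma ball_cutoff_lipschitz:
  assumes "e > 0"
  shows "\<bar>ball_cutoff e u - ball_cutoff e v\<bar> \<le> norm (u - v) / e"
proof -
  have "\<bar>ball_cutoff e u - ball_cutoff e v\<bar> \<le> \<bar>(1 - norm u) / e - (1 - norm v) / e\<bar>"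
    unfolding ball_cutoff_def by linarith
  also have "\<dots> = \<bar>norm v - norm u\<bar> / e"
    using assms by (simp add: diff_divide_distrib[symmetric])
  also have "\<dots> \<le> norm (u - v) / e"
    using assms norm_triangle_ineq3[of u v] by (intro divide_right_mono) auto
  finally show ?thesis .
qed

lemma has_derivative_transfer_nhds:
  fixes g :: "'a::real_normed_vector \<Rightarrow> real"
  assumes "open S" "w \<in> S" "\<And>u. u \<in> S \<Longrightarrow> g u = h u" "(h has_derivative D) (at w)"
  shows "(g has_derivative D) (at w)"
  using has_derivative_transform_within_open[OF assms(4) assms(1,2)] assms(3) by simp

lemma ball_cutoff_has_derivative:
  fixes w :: "'a::euclidean_space"
  assumes e: "0 < e" "e < 1" and w: "norm w \<noteq> 1" "norm w \<noteq> 1 - e"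
  shows "(ball_cutoff e has_derivative (\<lambda>v. - (shell e w * (sgn w \<bullet> v) / e))) (at w)"
proof -
  consider "norm w < 1 - e" | "1 - e < norm w" "norm w < 1" | "norm w > 1"
    using w by linarith
  then show ?thesis
  proof cases
    case 1
    show ?thesis
    proof (rule has_derivative_transfer_nhds[where S="ball 0 (1 - e)" and h="\<lambda>_. 1"])
      show "ball_cutoff e u = 1" if "u \<in> ball 0 (1 - e)" for u :: 'a
        using that e by (simp add: ball_cutoff_def min_def max_def pos_divide_less_eq le_divide_eq not_le)
    qed (use 1 e in \<open>auto simp: shell_def\<close>)
  next
    case 2
    have [simp]: "w \<noteq> 0" using 2(1) e by (metis diff_gt_0_iff_gt less_trans norm_zero not_less_iff_gr_or_eq)
    show ?thesis
    proof (rule has_derivative_transfer_nhds[where S="{u. 1 - e < norm u \<and> norm u < 1}" and h="\<lambda>u. (1 - norm u) / e"])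
      show "open {u::'a. 1 - e < norm u \<and> norm u < 1}"
        by (intro open_Collect_conj open_Collect_less continuous_intros)
      show "((\<lambda>u. (1 - norm u) / e) has_derivative (\<lambda>v. - (shell e w * (sgn w \<bullet> v) / e))) (at w)"
        using 2 e has_derivative_norm[of w]
        by (auto intro!: derivative_eq_intros simp: shell_def inner_commute)
      show "ball_cutoff e u = (1 - norm u) / e" if "u \<in> {u. 1 - e < norm u \<and> norm u < 1}" for u :: 'a
        using that e by (simp add: ball_cutoff_def min_def max_def pos_divide_less_eq le_divide_eq not_le)
    qed (use 2 in simp)
  next
    case 3
    show ?thesis
    proof (rule has_derivative_transfer_nhds[where S="{u. 1 < norm u}" and h="\<lambda>_. 0"])
      show "open {u::'a. 1 < norm u}"
        by (intro open_Collect_less continuous_intros)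
    qed (use 3 e in \<open>auto simp: shell_def ball_cutoff_eq_0\<close>)
  qed
qed

lemma AE_norm_neq: "AE y in lborel. norm (y - c :: 'a::euclidean_space) \<noteq> r"
proof (rule AE_I')
  show "sphere c r \<in> null_sets lborel"
    using negligible_sphere[of c r] by (auto simp: null_sets_completion_iff negligible_iff_null_sets)
qed (auto simp: dist_norm norm_minus_commute)

text \<open>Here \<open>f\<close> is only continuous, so the translation is moved onto the kernel
  and the derivative falls on the Lipschitz cutoff. The quotients converge off the two spheres where
  the cutoff has kinks, and dominated convergence applies.\<close>

lemma cutoff_integral_has_derivative:
  fixes f :: "'a::euclidean_space \<Rightarrow> real"
  assumes f: "continuous_on UNIV f" and e: "0 < e" "e < 1"
  shows "((\<lambda>t. \<integral>y. f y * ball_cutoff e (y - t *\<^sub>R a) \<partial>lborel) has_field_derivative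
    (\<integral>u. f (u + t *\<^sub>R a) * (shell e u * (sgn u \<bullet> a) / e) \<partial>lborel)) (at t)"
proof -
  have [measurable]: "f \<in> borel_measurable borel"
    using f by (rule borel_measurable_continuous_onI)
  define \<Phi> where "\<Phi> t = (\<integral>y. f y * ball_cutoff e (y - t *\<^sub>R a) \<partial>lborel)" for t
  have fb: "\<exists>C. \<forall>u. norm u \<le> R \<longrightarrow> \<bar>f u\<bar> \<le> C" for R
  proof -
    have "compact (f ` cball 0 R)"
      by (intro compact_continuous_image continuous_on_subset[OF f]) auto
    then obtain C where "\<forall>z \<in> f ` cball 0 R. norm z \<le> C"
      by (meson bounded_iff compact_imp_bounded)
    then show ?thesis by (intro exI[of _ C]) auto
  qed
  define D where "D y = f y * (shell e (y - t *\<^sub>R a) * (sgn (y - t *\<^sub>R a) \<bullet> a) / e)" for y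
  have Deq: "(\<integral>y. D y \<partial>lborel) = (\<integral>u. f (u + t *\<^sub>R a) * (shell e u * (sgn u \<bullet> a) / e) \<partial>lborel)"
    using lborel_integral_shift[of D "t *\<^sub>R a", symmetric] e by (simp add: D_def[abs_def] add.commute)
  have "((\<lambda>h. (\<Phi> (t + h) - \<Phi> t) / h) \<longlongrightarrow> (\<integral>y. D y \<partial>lborel)) (at 0)"
    unfolding tendsto_at_iff_sequentially
  proof (intro allI impI, unfold o_def)
    fix X :: "nat \<Rightarrow> real" assume X: "\<forall>i. X i \<in> UNIV - {0}" "X \<longlonglongrightarrow> 0"
    from X(2) have "Bseq X" by (intro convergent_imp_Bseq convergentI)
    then obtain B where B: "B > 0" "\<And>i. \<bar>X i\<bar> \<le> B" by (auto elim: BseqE)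
    \<comment> \<open>One ball that contains the supports of all translated cutoffs along the
      sequence, so that a single dominating function works.\<close>
    define R where "R = 1 + (\<bar>t\<bar> + B) * norm a"
    obtain C where C: "\<And>u. norm u \<le> R \<Longrightarrow> \<bar>f u\<bar> \<le> C" using fb by blast
    have R: "norm (s *\<^sub>R a) \<le> R - 1" if "\<bar>s\<bar> \<le> \<bar>t\<bar> + B" for s
      using that by (auto simp: R_def intro: mult_right_mono)
    have supp: "ball_cutoff e (y - s *\<^sub>R a) = 0" if "norm y > R" "\<bar>s\<bar> \<le> \<bar>t\<bar> + B" for y s
      using R[OF that(2)] norm_triangle_ineq2[of y "s *\<^sub>R a"] that(1) e by (intro ball_cutoff_eq_0) auto
    have int: "integrable lborel (\<lambda>y. f y * ball_cutoff e (y - s *\<^sub>R a))" if s: "\<bar>s\<bar> \<le> \<bar>t\<bar> + B" for s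
    proof -
      have "integrable lborel (\<lambda>y. indicator (cball 0 R) y * (f y * ball_cutoff e (y - s *\<^sub>R a)))"
      proof (rule integrable_indicator_cball_bounded[where C=C])
        fix y :: 'a assume "norm (y - 0) \<le> R"
        then show "\<bar>f y * ball_cutoff e (y - s *\<^sub>R a)\<bar> \<le> C"
          using C[of y] ball_cutoff_bounds[of e "y - s *\<^sub>R a"] mult_mono[of "\<bar>f y\<bar>" C "ball_cutoff e (y - s *\<^sub>R a)" 1]
          by (simp add: abs_mult)
      qed measurable
      also have "(\<lambda>y. indicator (cball 0 R) y * (f y * ball_cutoff e (y - s *\<^sub>R a))) = (\<lambda>y. f y * ball_cutoff e (y - s *\<^sub>R a))"
        using supp[OF _ s] by (fastforce simp: indicator_def fun_eq_iff)
      finally show ?thesis .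
    qed
    have tX: "\<bar>t + X i\<bar> \<le> \<bar>t\<bar> + B" "\<bar>t\<bar> \<le> \<bar>t\<bar> + B" for i
      using B(2)[of i] B(1) by linarith+
    let ?q = "\<lambda>i y. f y * ((ball_cutoff e (y - (t + X i) *\<^sub>R a) - ball_cutoff e (y - t *\<^sub>R a)) / X i)"
    have eq: "(\<Phi> (t + X i) - \<Phi> t) / X i = (\<integral>y. ?q i y \<partial>lborel)" for i
    proof -
      have "\<Phi> (t + X i) - \<Phi> t =
          (\<integral>y. f y * ball_cutoff e (y - (t + X i) *\<^sub>R a) - f y * ball_cutoff e (y - t *\<^sub>R a) \<partial>lborel)"
        unfolding \<Phi>_def by (rule Bochner_Integration.integral_diff[OF int[OF tX(1)] int[OF tX(2)], symmetric])
      then have "(\<Phi> (t + X i) - \<Phi> t) / X i =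
          (\<integral>y. (f y * ball_cutoff e (y - (t + X i) *\<^sub>R a) - f y * ball_cutoff e (y - t *\<^sub>R a)) / X i \<partial>lborel)"
        by simp
      then show ?thesis
        by (simp only: right_diff_distrib[symmetric] times_divide_eq_right)
    qed
    have "(\<lambda>i. \<integral>y. ?q i y \<partial>lborel) \<longlonglongrightarrow> (\<integral>y. D y \<partial>lborel)"
    proof (rule integral_dominated_convergence)
      show "integrable lborel (\<lambda>y. indicator (cball 0 R) y * (\<bar>f y\<bar> * (norm a / e)))"
      proof (rule integrable_indicator_cball_bounded[where C="C * (norm a / e)"])
        fix y :: 'a assume "norm (y - 0) \<le> R"
        then show "\<bar>\<bar>f y\<bar> * (norm a / e)\<bar> \<le> C * (norm a / e)"
          using mult_right_mono[OF C[of y], of "norm a / e"] e by (simp only: abs_mult abs_divide abs_abs abs_norm_cancel) simp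
      qed measurable
      show "AE y in lborel. norm (?q i y) \<le> indicator (cball 0 R) y * (\<bar>f y\<bar> * (norm a / e))" for i
      proof (rule AE_I2)
        fix y :: 'a
        have Xi: "X i \<noteq> 0" using X(1) by auto
        show "norm (?q i y) \<le> indicator (cball 0 R) y * (\<bar>f y\<bar> * (norm a / e))"
        proof (cases "norm y \<le> R")
          case True
          have "\<bar>ball_cutoff e (y - (t + X i) *\<^sub>R a) - ball_cutoff e (y - t *\<^sub>R a)\<bar> \<le> norm (X i *\<^sub>R a) / e"
            using ball_cutoff_lipschitz[OF e(1), of "y - (t + X i) *\<^sub>R a" "y - t *\<^sub>R a"]
            by (simp add: algebra_simps)
          then have "\<bar>ball_cutoff e (y - (t + X i) *\<^sub>R a) - ball_cutoff e (y - t *\<^sub>R a)\<bar> / \<bar>X i\<bar> \<le> norm a / e"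
            using Xi by (simp add: pos_divide_le_eq mult.commute)
          then have "\<bar>f y\<bar> * (\<bar>ball_cutoff e (y - (t + X i) *\<^sub>R a) - ball_cutoff e (y - t *\<^sub>R a)\<bar> / \<bar>X i\<bar>) \<le> \<bar>f y\<bar> * (norm a / e)"
            by (intro mult_left_mono) auto
          then show ?thesis
            using True by (simp only: real_norm_def abs_mult abs_divide) simp
        next
          case False
          then show ?thesis using supp tX by (auto simp: not_le)
        qed
      qed
      show "AE y in lborel. (\<lambda>i. ?q i y) \<longlonglongrightarrow> D y"
        using AE_norm_neq[of "t *\<^sub>R a" 1] AE_norm_neq[of "t *\<^sub>R a" "1 - e"]
      proof eventually_elim
        case (elim y)
        let ?w = "y - t *\<^sub>R a"
        have d: "(ball_cutoff e has_derivative (\<lambda>v. - (shell e ?w * (sgn ?w \<bullet> v) / e))) (at ?w)"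
          using ball_cutoff_has_derivative[OF e elim] .
        have "((\<lambda>s. y - s *\<^sub>R a) has_derivative (\<lambda>h. - (h *\<^sub>R a))) (at t)"
          by (auto intro!: derivative_eq_intros)
        from has_derivative_compose[OF this d]
        have "((\<lambda>s. ball_cutoff e (y - s *\<^sub>R a)) has_derivative (\<lambda>h. - (shell e ?w * (sgn ?w \<bullet> - (h *\<^sub>R a)) / e))) (at t)" .
        then have "((\<lambda>s. ball_cutoff e (y - s *\<^sub>R a)) has_field_derivative (shell e ?w * (sgn ?w \<bullet> a) / e)) (at t)"
          unfolding has_field_derivative_def by (rule has_derivative_eq_rhs) (auto simp: fun_eq_iff)
        then have "((\<lambda>h. (ball_cutoff e (y - (t + h) *\<^sub>R a) - ball_cutoff e (y - t *\<^sub>R a)) / h) \<longlongrightarrow> (shell e ?w * (sgn ?w \<bullet> a) / e)) (at 0)"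
          by (simp add: DERIV_def)
        then have "(\<lambda>i. (ball_cutoff e (y - (t + X i) *\<^sub>R a) - ball_cutoff e (y - t *\<^sub>R a)) / X i) \<longlonglongrightarrow> (shell e ?w * (sgn ?w \<bullet> a) / e)"
          using X unfolding tendsto_at_iff_sequentially by (auto simp: o_def)
        then show ?case unfolding D_def by (intro tendsto_mult tendsto_const)
      qed
    qed (auto simp: D_def)
    then show "(\<lambda>i. (\<Phi> (t + X i) - \<Phi> t) / X i) \<longlonglongrightarrow> (\<integral>y. D y \<partial>lborel)"
      by (simp add: eq)
  qed
  then show ?thesis
    unfolding DERIV_def Deq[symmetric] \<Phi>_def .
qed

text \<open>A function of the direction sees the shell only through its share of the volume of the
  unit ball.\<close>

lemma integral_shell_sgn:
  fixes \<psi> :: "'a::euclidean_space \<Rightarrow> real"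
  assumes [measurable]: "\<psi> \<in> borel_measurable borel" and e: "0 < e" "e < 1"
    and b: "\<And>u. norm u \<le> 1 \<Longrightarrow> \<bar>\<psi> u\<bar> \<le> C"
  shows "(\<integral>u. shell e u * \<psi> (sgn u) \<partial>lborel) =
    (1 - (1 - e) ^ DIM('a)) * (\<integral>u. indicator (cball 0 1) u * \<psi> (sgn u) \<partial>lborel)"
proof -
  have int: "integrable lborel (\<lambda>u::'a. indicator (cball 0 r) u * \<psi> (sgn u))" for r
    by (rule integrable_indicator_cball_bounded[where C=C]) (auto intro: b norm_sgn_le)
  have "(\<integral>u. shell e u * \<psi> (sgn u) \<partial>lborel) =
      (\<integral>u. indicator (cball 0 1) u * \<psi> (sgn u) - indicator (cball 0 (1 - e)) u * \<psi> (sgn u) \<partial>lborel)"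
    unfolding shell_def by (simp add: left_diff_distrib)
  also have "\<dots> = (\<integral>u. indicator (cball 0 1) u * \<psi> (sgn u) \<partial>lborel) - (\<integral>u. indicator (cball 0 (1 - e)) u * \<psi> (sgn u) \<partial>lborel)"
    by (intro Bochner_Integration.integral_diff int)
  also have "(\<integral>u. indicator (cball 0 (1 - e)) u * \<psi> (sgn u) \<partial>lborel) = (1 - e) ^ DIM('a) * (\<integral>u. indicator (cball 0 1) u * \<psi> (sgn u) \<partial>lborel)"
    using e by (intro lborel_sgn_scale_ball) auto
  finally show ?thesis by (simp add: algebra_simps)
qed

lemma integrable_shell_bounded:
  fixes \<phi> :: "'a::euclidean_space \<Rightarrow> real"
  assumes [measurable]: "\<phi> \<in> borel_measurable borel" and e: "0 < e"
    and b: "\<And>u. norm u \<le> 1 \<Longrightarrow> \<bar>\<phi> u\<bar> \<le> C"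
  shows "integrable lborel (\<lambda>u. shell e u * \<phi> u)"
proof -
  have "integrable lborel (\<lambda>u. indicator (cball 0 1) u * (shell e u * \<phi> u))"
  proof (rule integrable_indicator_cball_bounded[where C=C])
    fix u :: 'a assume "norm (u - 0) \<le> 1"
    then show "\<bar>shell e u * \<phi> u\<bar> \<le> C"
      using b[of u] b[of 0] by (auto simp: shell_def indicator_def)
  qed measurable
  also have "(\<lambda>u. indicator (cball 0 1) u * (shell e u * \<phi> u)) = (\<lambda>u. shell e u * \<phi> u)"
    using e by (auto simp: fun_eq_iff shell_def indicator_def)
  finally show ?thesis .
qed

lemma lipschitz_UNIV_bound:
  fixes f :: "'a::real_normed_vector \<Rightarrow> real"
  shows "L-lipschitz_on UNIV f \<Longrightarrow> \<bar>f x - f y\<bar> \<le> L * norm (x - y)"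
  using lipschitz_onD[of L UNIV f x y] by (simp add: dist_norm)

text \<open>Translating the kernel along \<open>t *\<^sub>R a\<close>, the mean value theorem yields
  the derivative at some \<open>s\<close> in (0, 1). Replacing it by the derivative at 0 changes
  \<open>f\<close> by at most \<open>L * norm a\<close> on the shell. The shell has at most the
  share \<open>n * e\<close> of the volume, by Bernoulli, which cancels the factor
  \<open>1 / e\<close>, so the bound is uniform in \<open>e\<close>; together with the first moment
  \<open>norm a / sqrt n\<close> it leaves \<open>sqrt n\<close>.\<close>

lemma unif_ball_cutoff_expansion:
  fixes f :: "'a::euclidean_space \<Rightarrow> real"
  assumes L: "L-lipschitz_on UNIV f" and e: "0 < e" "e < 1"
  shows "\<bar>(\<integral>u. f (u + a) * ball_cutoff e u \<partial>lborel) - (\<integral>u. f u * ball_cutoff e u \<partial>lborel) -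
      (\<integral>u. f u * (shell e u * (sgn u \<bullet> a) / e) \<partial>lborel)\<bar>
    \<le> sqrt DIM('a) * L * (norm a)\<^sup>2 * measure lborel (cball (0::'a) 1)" (is "?lhs \<le> _")
proof -
  let ?V = "measure lborel (cball (0::'a) 1)"
  let ?k = "\<lambda>u. shell e u * (sgn u \<bullet> a) / e"
  define n where "n = DIM('a)"
  have n: "n \<ge> 1" unfolding n_def by (simp add: Suc_leI)
  have L0: "L \<ge> 0" using L by (rule lipschitz_on_nonneg)
  have cont: "continuous_on UNIV f" using L by (rule lipschitz_on_continuous_on)
  then have [measurable]: "f \<in> borel_measurable borel" by (rule borel_measurable_continuous_onI)
  have fb: "\<bar>f u\<bar> \<le> \<bar>f 0\<bar> + L * R" if "norm u \<le> R" for u R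
    using lipschitz_UNIV_bound[OF L, of u 0] mult_left_mono[OF that L0] by simp
  define \<Phi> where "\<Phi> t = (\<integral>y. f y * ball_cutoff e (y - t *\<^sub>R a) \<partial>lborel)" for t
  define D where "D t = (\<integral>u. f (u + t *\<^sub>R a) * ?k u \<partial>lborel)" for t
  have der: "(\<Phi> has_field_derivative D t) (at t)" for t
    unfolding \<Phi>_def D_def by (rule cutoff_integral_has_derivative[OF cont e])
  obtain s where s: "0 < s" "s < 1" and mvt: "\<Phi> 1 - \<Phi> 0 = (1 - 0) * D s"
    using MVT2[of 0 1 \<Phi> D] der by auto
  have iD: "integrable lborel (\<lambda>u. f (u + t *\<^sub>R a) * ?k u)" for t
  proof -
    have "integrable lborel (\<lambda>u. shell e u * (f (u + t *\<^sub>R a) * (sgn u \<bullet> a) / e))"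
    proof (rule integrable_shell_bounded[where C="(\<bar>f 0\<bar> + L * (1 + norm (t *\<^sub>R a))) * norm a / e"])
      fix u :: 'a assume u: "norm u \<le> 1"
      have "\<bar>sgn u \<bullet> a\<bar> \<le> norm a"
        by (rule abs_inner_sgn_le)
      moreover have "\<bar>f (u + t *\<^sub>R a)\<bar> \<le> \<bar>f 0\<bar> + L * (1 + norm (t *\<^sub>R a))"
        using u norm_triangle_ineq[of u "t *\<^sub>R a"] by (intro fb) linarith
      ultimately have "\<bar>f (u + t *\<^sub>R a)\<bar> * \<bar>sgn u \<bullet> a\<bar> \<le> (\<bar>f 0\<bar> + L * (1 + norm (t *\<^sub>R a))) * norm a"
        using L0 by (intro mult_mono) auto
      then show "\<bar>f (u + t *\<^sub>R a) * (sgn u \<bullet> a) / e\<bar> \<le> (\<bar>f 0\<bar> + L * (1 + norm (t *\<^sub>R a))) * norm a / e"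
        using e by (simp only: abs_mult abs_divide) (simp add: divide_right_mono)
    qed (use e in measurable)
    then show ?thesis by (simp add: mult_ac)
  qed
  have ish: "integrable lborel (\<lambda>u. shell e u * \<bar>sgn u \<bullet> a\<bar>)"
  proof (rule integrable_shell_bounded[where C="norm a"])
    fix u :: 'a
    show "\<bar>\<bar>sgn u \<bullet> a\<bar>\<bar> \<le> norm a"
      by (simp add: abs_inner_sgn_le)
  qed (use e in auto)
  have "\<bar>D s - D 0\<bar> = \<bar>\<integral>u. f (u + s *\<^sub>R a) * ?k u - f (u + 0 *\<^sub>R a) * ?k u \<partial>lborel\<bar>"
    unfolding D_def by (subst Bochner_Integration.integral_diff[OF iD iD]) simp
  also have "\<dots> \<le> (\<integral>u. L * norm a / e * (shell e u * \<bar>sgn u \<bullet> a\<bar>) \<partial>lborel)"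
  proof (rule integral_abs_bound[THEN order_trans], rule integral_mono)
    show "integrable lborel (\<lambda>u. \<bar>f (u + s *\<^sub>R a) * ?k u - f (u + 0 *\<^sub>R a) * ?k u\<bar>)"
      by (intro integrable_abs Bochner_Integration.integrable_diff iD)
    show "integrable lborel (\<lambda>u. L * norm a / e * (shell e u * \<bar>sgn u \<bullet> a\<bar>))"
      using ish by (rule integrable_mult_right)
    fix u :: 'a
    have sh: "shell e u \<ge> 0" using e by (auto simp: shell_def indicator_def)
    have "\<bar>f (u + s *\<^sub>R a) - f (u + 0 *\<^sub>R a)\<bar> \<le> L * (s * norm a)"
      using lipschitz_UNIV_bound[OF L, of "u + s *\<^sub>R a" "u + 0 *\<^sub>R a"] s by simp
    also have "\<dots> \<le> L * norm a"
      using L0 s by (intro mult_left_mono) (auto simp: mult_left_le_one_le)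
    finally have *: "\<bar>f (u + s *\<^sub>R a) - f (u + 0 *\<^sub>R a)\<bar> \<le> L * norm a" .
    have "\<bar>f (u + s *\<^sub>R a) * ?k u - f (u + 0 *\<^sub>R a) * ?k u\<bar> =
       \<bar>f (u + s *\<^sub>R a) - f (u + 0 *\<^sub>R a)\<bar> * (shell e u * \<bar>sgn u \<bullet> a\<bar> / e)"
      using sh e unfolding left_diff_distrib[symmetric] by (simp add: abs_mult)
    also have "\<dots> \<le> (L * norm a) * (shell e u * \<bar>sgn u \<bullet> a\<bar> / e)"
      using sh e by (intro mult_right_mono *) auto
    finally show "\<bar>f (u + s *\<^sub>R a) * ?k u - f (u + 0 *\<^sub>R a) * ?k u\<bar>
       \<le> L * norm a / e * (shell e u * \<bar>sgn u \<bullet> a\<bar>)" by (simp add: mult_ac)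
  qed
  also have "\<dots> = L * norm a / e * (\<integral>u. shell e u * \<bar>sgn u \<bullet> a\<bar> \<partial>lborel)"
    by simp
  also have "(\<integral>u. shell e u * \<bar>sgn u \<bullet> a\<bar> \<partial>lborel) =
      (1 - (1 - e) ^ n) * (\<integral>u. indicator (cball 0 1) u * \<bar>sgn u \<bullet> a\<bar> \<partial>lborel)"
    unfolding n_def
  proof (rule integral_shell_sgn[of "\<lambda>u. \<bar>u \<bullet> a\<bar>" e "norm a"])
    show "\<bar>\<bar>u \<bullet> a\<bar>\<bar> \<le> norm a" if "norm u \<le> 1" for u :: 'a
      using Cauchy_Schwarz_ineq2[of u a] that mult_right_mono[of "norm u" 1 "norm a"] by auto
  qed (use e in auto)
  also have "(\<integral>u. indicator (cball 0 1) u * \<bar>sgn u \<bullet> a\<bar> \<partial>lborel) = ?V * (\<integral>u. \<bar>sgn u \<bullet> a\<bar> \<partial>unif_ball)"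
    using ball_vol_pos[where 'a='a] by (subst integral_unif_ball) auto
  also have "L * norm a / e * ((1 - (1 - e) ^ n) * (?V * (\<integral>u. \<bar>sgn u \<bullet> a\<bar> \<partial>unif_ball))) \<le>
     L * norm a / e * ((n * e) * (?V * (norm a / sqrt n)))"
  proof (intro mult_left_mono mult_mono)
    show "1 - (1 - e) ^ n \<le> n * e"
      using Bernoulli_inequality[of "-e" n] e by simp
    show "(\<integral>u. \<bar>sgn u \<bullet> a\<bar> \<partial>unif_ball) \<le> norm a / sqrt n"
      unfolding n_def by (rule unif_ball_abs_inner_sgn_le)
  qed (use L0 e in \<open>auto intro!: divide_nonneg_pos mult_nonneg_nonneg Bochner_Integration.integral_nonneg\<close>)
  also have "\<dots> = sqrt n * L * (norm a)\<^sup>2 * ?V"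
  proof -
    have "L * norm a / e * ((n * e) * (?V * (norm a / sqrt n))) = L * norm a * norm a * ?V * (real n / sqrt n)"
      using e by simp
    also have "real n / sqrt n = sqrt n" using n by (simp add: real_div_sqrt)
    finally show ?thesis by (simp add: power2_eq_square mult_ac)
  qed
  finally have main: "\<bar>D s - D 0\<bar> \<le> sqrt n * L * (norm a)\<^sup>2 * ?V" .
  have "\<Phi> 1 = (\<integral>u. f (u + a) * ball_cutoff e u \<partial>lborel)"
    using lborel_integral_shift[of "\<lambda>y. f y * ball_cutoff e (y - a)" a, symmetric]
    by (simp add: \<Phi>_def add.commute)
  then show ?thesis
    using main mvt by (simp add: \<Phi>_def D_def n_def)
qed

lemma AE_norm_neq_1: "AE y in lborel. norm (y :: 'a::euclidean_space) \<noteq> 1"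
  using AE_norm_neq[of 0 1] by simp

lemma cutoff_integral_tendsto:
  fixes f :: "'a::euclidean_space \<Rightarrow> real"
  assumes f: "continuous_on UNIV f" and e: "\<And>m. 0 < e m" "e \<longlonglongrightarrow> 0"
  shows "(\<lambda>m. \<integral>u. f u * ball_cutoff (e m) u \<partial>lborel) \<longlonglongrightarrow> (\<integral>u. indicator (cball 0 1) u * f u \<partial>lborel)"
proof (rule integral_dominated_convergence)
  have [measurable]: "f \<in> borel_measurable borel"
    using f by (rule borel_measurable_continuous_onI)
  have "compact (f ` cball 0 1)"
    by (intro compact_continuous_image continuous_on_subset[OF f]) auto
  then obtain C where C: "\<forall>z \<in> f ` cball 0 1. norm z \<le> C"
    by (meson bounded_iff compact_imp_bounded)
  show "integrable lborel (\<lambda>u. indicator (cball 0 1) u * \<bar>f u\<bar>)"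
    using C by (intro integrable_indicator_cball_bounded[where C=C]) auto
  show "AE u in lborel. norm (f u * ball_cutoff (e m) u) \<le> indicator (cball 0 1) u * \<bar>f u\<bar>" for m
  proof (rule AE_I2)
    fix u
    show "norm (f u * ball_cutoff (e m) u) \<le> indicator (cball 0 1) u * \<bar>f u\<bar>"
      using ball_cutoff_bounds[of "e m" u] ball_cutoff_eq_0[OF e(1), of u m]
        mult_left_mono[of "ball_cutoff (e m) u" 1 "\<bar>f u\<bar>"]
      by (cases "norm u \<le> 1") (auto simp: abs_mult)
  qed
  show "AE u in lborel. (\<lambda>m. f u * ball_cutoff (e m) u) \<longlonglongrightarrow> indicator (cball 0 1) u * f u"
    using AE_norm_neq_1
  proof eventually_elim
    case (elim u)
    show ?case
    proof (cases "norm u < 1")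
      case True
      have "eventually (\<lambda>m. e m < 1 - norm u) sequentially"
        using e(2) True by (intro order_tendstoD(2)) auto
      then have "eventually (\<lambda>m. f u * ball_cutoff (e m) u = indicator (cball 0 1) u * f u) sequentially"
      proof eventually_elim
        case (elim m)
        have "1 \<le> (1 - norm u) / e m"
          using elim e(1)[of m] by (simp add: pos_le_divide_eq)
        then show ?case using True by (simp add: ball_cutoff_def)
      qed
      then show ?thesis by (rule tendsto_eventually)
    next
      case False
      then have "norm u > 1" using elim by auto
      then have "ball_cutoff (e m) u = 0" for m using ball_cutoff_eq_0[OF e(1)[of m], of u] by simp
      then show ?thesis using \<open>norm u > 1\<close> by simp
    qed
  qed
qed (use borel_measurable_continuous_onI[OF f] in measurable)

lemma one_minus_power_quotient_tendsto:
  assumes "\<And>m. (e m :: real) \<noteq> 0" "e \<longlonglongrightarrow> 0"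
  shows "(\<lambda>m. (1 - (1 - e m) ^ n) / e m) \<longlonglongrightarrow> real n"
proof -
  have "((\<lambda>x. 1 - (1 - x) ^ n :: real) has_field_derivative real n) (at 0)"
    by (auto intro!: derivative_eq_intros)
  then have "((\<lambda>h. (1 - (1 - h) ^ n) / h) \<longlongrightarrow> real n) (at 0)"
    by (simp add: DERIV_def)
  then show ?thesis
    using assms unfolding tendsto_at_iff_sequentially by (auto simp: o_def)
qed

text \<open>On the shell \<open>u\<close> is within \<open>e m\<close> of \<open>sgn u\<close>, so
  replacing \<open>f u\<close> by \<open>f (sgn u)\<close> costs at most \<open>L * e m\<close>.
  This cancels \<open>1 / e m\<close>, and the remaining volume of the shell tends to 0. After the
  replacement the integrand depends on the direction only, and the radial factor
  \<open>(1 - (1 - e m) ^ n) / e m\<close> tends to \<open>n\<close>.\<close>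

lemma shell_integral_tendsto:
  fixes f :: "'a::euclidean_space \<Rightarrow> real"
  assumes L: "L-lipschitz_on UNIV f" and e: "\<And>m. 0 < e m" "\<And>m. e m < 1" "e \<longlonglongrightarrow> 0"
  shows "(\<lambda>m. \<integral>u. f u * (shell (e m) u * (sgn u \<bullet> a) / e m) \<partial>lborel) \<longlonglongrightarrow>
    DIM('a) * (\<integral>u. indicator (cball 0 1) u * (f (sgn u) * (sgn u \<bullet> a)) \<partial>lborel)"
proof -
  let ?J = "\<integral>u. indicator (cball 0 1) u * (f (sgn u) * (sgn u \<bullet> a)) \<partial>lborel"
  let ?V = "measure lborel (cball (0::'a) 1)"
  have L0: "L \<ge> 0" using L by (rule lipschitz_on_nonneg)
  have cont: "continuous_on UNIV f" using L by (rule lipschitz_on_continuous_on)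
  then have [measurable]: "f \<in> borel_measurable borel" by (rule borel_measurable_continuous_onI)
  have fb: "\<bar>f u\<bar> \<le> \<bar>f 0\<bar> + L" if "norm u \<le> 1" for u
    using lipschitz_UNIV_bound[OF L, of u 0] mult_left_mono[OF that L0] by simp
  define r where "r m = (1 - (1 - e m) ^ DIM('a))" for m
  define E where "E m = (\<integral>u. f u * (shell (e m) u * (sgn u \<bullet> a) / e m) \<partial>lborel)" for m
  have sh: "shell (e m) u \<ge> 0" for m and u :: 'a using e(1)[of m] by (auto simp: shell_def indicator_def)
  have i1: "integrable lborel (\<lambda>u. shell (e m) u * (\<phi> u * (sgn u \<bullet> a) / e m))"
    if [measurable]: "\<phi> \<in> borel_measurable borel" and "\<And>u. norm u \<le> 1 \<Longrightarrow> \<bar>\<phi> u\<bar> \<le> \<bar>f 0\<bar> + L" for \<phi> m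
  proof (rule integrable_shell_bounded[where C="(\<bar>f 0\<bar> + L) * norm a / e m"])
    fix u :: 'a assume "norm u \<le> 1"
    then have "\<bar>\<phi> u\<bar> * \<bar>sgn u \<bullet> a\<bar> \<le> (\<bar>f 0\<bar> + L) * norm a"
      using L0 by (intro mult_mono that abs_inner_sgn_le) auto
    then show "\<bar>\<phi> u * (sgn u \<bullet> a) / e m\<bar> \<le> (\<bar>f 0\<bar> + L) * norm a / e m"
      using e(1)[of m] by (simp add: abs_mult divide_right_mono)
  qed (use e in auto)
  have bound: "\<bar>E m - r m / e m * ?J\<bar> \<le> L * norm a * (r m * ?V)" for m
  proof -
    let ?d = "\<lambda>u. shell (e m) u * (f u * (sgn u \<bullet> a) / e m) - shell (e m) u * (f (sgn u) * (sgn u \<bullet> a) / e m)"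
    have "r m * ?J = (\<integral>u. shell (e m) u * (f (sgn u) * (sgn u \<bullet> a)) \<partial>lborel)"
      unfolding r_def
    proof (rule integral_shell_sgn[symmetric, of "\<lambda>u. f u * (u \<bullet> a)" "e m" "(\<bar>f 0\<bar> + L) * norm a"])
      fix u :: 'a assume u: "norm u \<le> 1"
      have "\<bar>u \<bullet> a\<bar> \<le> norm a"
        using Cauchy_Schwarz_ineq2[of u a] u mult_right_mono[of "norm u" 1 "norm a"] by auto
      then show "\<bar>f u * (u \<bullet> a)\<bar> \<le> (\<bar>f 0\<bar> + L) * norm a"
        using fb[OF u] L0 unfolding abs_mult by (intro mult_mono) auto
    qed (use e in auto)
    then have "r m / e m * ?J = (\<integral>u. shell (e m) u * (f (sgn u) * (sgn u \<bullet> a)) / e m \<partial>lborel)"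
      by simp
    then have "\<bar>E m - r m / e m * ?J\<bar> =
        \<bar>\<integral>u. ?d u \<partial>lborel\<bar>"
      unfolding E_def
      by (subst Bochner_Integration.integral_diff[OF i1 i1]) (auto intro: fb norm_sgn_le simp: mult_ac)
    also have "\<dots> \<le> (\<integral>u. L * norm a * (shell (e m) (u::'a) * 1) \<partial>lborel)"
    proof (rule integral_abs_bound[THEN order_trans], rule integral_mono)
      show "integrable lborel (\<lambda>u. \<bar>?d u\<bar>)"
        by (intro integrable_abs Bochner_Integration.integrable_diff i1) (auto intro: fb norm_sgn_le)
      show "integrable lborel (\<lambda>u::'a. L * norm a * (shell (e m) u * 1))"
        using e by (intro integrable_mult_right integrable_shell_bounded[where C=1]) auto
      fix u :: 'a
      show "\<bar>?d u\<bar> \<le> L * norm a * (shell (e m) u * 1)"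
      proof (cases "shell (e m) u = 0")
        case False
        then have u: "1 - e m < norm u" "norm u \<le> 1"
          using False e(1)[of m] by (cases "norm u \<le> 1"; cases "norm u \<le> 1 - e m"; simp add: shell_def)+
        then have u0: "u \<noteq> 0" using e(2)[of m] by auto
        have "u - sgn u = (norm u - 1) *\<^sub>R sgn u"
          unfolding scaleR_diff_left using u0 by (simp add: sgn_div_norm)
        then have "norm (u - sgn u) \<le> e m"
          using u u0 by (simp add: norm_sgn)
        then have "L * norm (u - sgn u) \<le> L * e m" using L0 by (rule mult_left_mono)
        then have "\<bar>f u - f (sgn u)\<bar> \<le> L * e m"
          using lipschitz_UNIV_bound[OF L, of u "sgn u"] by linarith
        then have "\<bar>f u - f (sgn u)\<bar> * \<bar>sgn u \<bullet> a\<bar> \<le> (L * e m) * norm a"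
          using L0 e(1)[of m] by (intro mult_mono abs_inner_sgn_le) auto
        then have "shell (e m) u * (\<bar>f u - f (sgn u)\<bar> * \<bar>sgn u \<bullet> a\<bar> / e m) \<le> shell (e m) u * (L * norm a)"
          using e(1)[of m] by (intro mult_left_mono sh) (simp add: pos_divide_le_eq mult_ac)
        moreover have "\<bar>?d u\<bar> =
           shell (e m) u * (\<bar>f u - f (sgn u)\<bar> * \<bar>sgn u \<bullet> a\<bar> / e m)"
          using sh[of m u] e(1)[of m]
          unfolding right_diff_distrib[symmetric] diff_divide_distrib[symmetric] left_diff_distrib[symmetric]
          by (simp add: abs_mult)
        ultimately show ?thesis by (simp add: mult_ac)
      qed simp
    qed
    also have "\<dots> = L * norm a * (\<integral>u. shell (e m) (u::'a) * 1 \<partial>lborel)"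
      by simp
    also have "(\<integral>u. shell (e m) (u::'a) * 1 \<partial>lborel) = r m * (\<integral>u. indicator (cball (0::'a) 1) u * 1 \<partial>lborel)"
      unfolding r_def using e by (intro integral_shell_sgn[of "\<lambda>_. 1" "e m" 1]) auto
    also have "(\<integral>u. indicator (cball (0::'a) 1) u * 1 \<partial>lborel) = ?V"
      by simp
    finally show ?thesis .
  qed
  have "r \<longlonglongrightarrow> 1 - (1 - 0) ^ DIM('a)"
    unfolding r_def by (intro tendsto_intros e)
  then have "(\<lambda>m. L * norm a * (r m * ?V)) \<longlonglongrightarrow> L * norm a * ((1 - (1 - 0) ^ DIM('a)) * ?V)"
    by (intro tendsto_intros)
  then have "(\<lambda>m. L * norm a * (r m * ?V)) \<longlonglongrightarrow> 0" by simp
  then have "(\<lambda>m. E m - r m / e m * ?J) \<longlonglongrightarrow> 0"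
    by (rule Lim_null_comparison[rotated]) (use bound in auto)
  moreover have "(\<lambda>m. r m / e m * ?J) \<longlonglongrightarrow> DIM('a) * ?J"
    unfolding r_def using e by (intro tendsto_mult tendsto_const one_minus_power_quotient_tendsto) (auto simp: less_imp_neq[symmetric])
  ultimately have "(\<lambda>m. (E m - r m / e m * ?J) + r m / e m * ?J) \<longlonglongrightarrow> 0 + DIM('a) * ?J"
    by (rule tendsto_add)
  then show ?thesis by (simp add: E_def)
qed

text \<open>
  The factor \<open>sqrt DIM('a)\<close>, rather than
  \<open>DIM('a)\<close>, comes from the second moments of the uniform law on the sphere;
  the bound on a constant stepsize requires it.
\<close>

lemma unif_ball_mean_expansion:
  fixes f :: "'a::euclidean_space \<Rightarrow> real"
  assumes L: "L-lipschitz_on UNIV f"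
  shows "\<bar>(\<integral>u. f (u + a) \<partial>unif_ball) - (\<integral>u. f u \<partial>unif_ball) -
      DIM('a) * (\<integral>u. f (sgn u) * (sgn u \<bullet> a) \<partial>unif_ball)\<bar> \<le> sqrt DIM('a) * L * (norm a)\<^sup>2"
proof -
  let ?V = "measure lborel (cball (0::'a) 1)"
  have cont: "continuous_on UNIV f" using L by (rule lipschitz_on_continuous_on)
  then have [measurable]: "f \<in> borel_measurable borel" by (rule borel_measurable_continuous_onI)
  \<comment> \<open>The shift by 2 keeps \<open>e m\<close> strictly below 1 also for
    \<open>m = 0\<close>.\<close>
  define e where "e m = inverse (real (m + 2))" for m
  have e: "0 < e m" "e m < 1" for m
    unfolding e_def by (auto simp: field_simps)
  have e0: "e \<longlonglongrightarrow> 0"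
    unfolding e_def using LIMSEQ_ignore_initial_segment[OF LIMSEQ_inverse_real_of_nat, of 1] by simp
  have c2: "continuous_on UNIV (\<lambda>u. f (u + a))"
    by (intro continuous_on_compose2[OF cont] continuous_intros) auto
  let ?A = "\<integral>u. indicator (cball 0 1) u * f (u + a) \<partial>lborel"
  let ?B = "\<integral>u. indicator (cball 0 1) u * f u \<partial>lborel"
  let ?C = "\<integral>u. indicator (cball 0 1) u * (f (sgn u) * (sgn u \<bullet> a)) \<partial>lborel"
  have "(\<lambda>m. \<bar>(\<integral>u. f (u + a) * ball_cutoff (e m) u \<partial>lborel) - (\<integral>u. f u * ball_cutoff (e m) u \<partial>lborel) -
      (\<integral>u. f u * (shell (e m) u * (sgn u \<bullet> a) / e m) \<partial>lborel)\<bar>) \<longlonglongrightarrow> \<bar>?A - ?B - DIM('a) * ?C\<bar>"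
    by (intro tendsto_rabs tendsto_diff cutoff_integral_tendsto shell_integral_tendsto[OF L] cont c2 e e0)
  then have "\<bar>?A - ?B - DIM('a) * ?C\<bar> \<le> sqrt DIM('a) * L * (norm a)\<^sup>2 * ?V"
    by (rule LIMSEQ_le_const2) (use unif_ball_cutoff_expansion[OF L e] in auto)
  moreover have "(\<integral>u. f (u + a) \<partial>unif_ball) - (\<integral>u. f u \<partial>unif_ball) - DIM('a) * (\<integral>u. f (sgn u) * (sgn u \<bullet> a) \<partial>unif_ball)
     = (?A - ?B - DIM('a) * ?C) / ?V"
    by (subst (1 2 3) integral_unif_ball) (auto simp: divide_inverse algebra_simps)
  ultimately show ?thesis
    using ball_vol_pos[where 'a='a] by (simp add: pos_divide_le_eq)
qed

section \<open>The spherical mean and the quadratic expansion of the smoothing\<close>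

definition sphere_grad :: "real \<Rightarrow> ('a::euclidean_space \<Rightarrow> real) \<Rightarrow> 'a \<Rightarrow> 'a" where
  "sphere_grad r f x = (DIM('a) / r) *\<^sub>R (\<integral>u. f (x + r *\<^sub>R sgn u) *\<^sub>R sgn u \<partial>unif_ball)"

lemma sphere_grad_integrable:
  fixes f :: "'a::euclidean_space \<Rightarrow> real"
  assumes L: "L-lipschitz_on UNIV f"
  shows "integrable unif_ball (\<lambda>u. f (x + r *\<^sub>R sgn u) *\<^sub>R sgn u)"
proof (rule unif_ball_integrable_bounded)
  have L0: "L \<ge> 0" using L by (rule lipschitz_on_nonneg)
  have cont: "continuous_on UNIV f" using L by (rule lipschitz_on_continuous_on)
  then have [measurable]: "f \<in> borel_measurable borel" by (rule borel_measurable_continuous_onI)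
  show "(\<lambda>u. f (x + r *\<^sub>R sgn u) *\<^sub>R sgn u) \<in> borel_measurable borel" by measurable
  fix u :: 'a
  have "\<bar>f (x + r *\<^sub>R sgn u)\<bar> \<le> \<bar>f x\<bar> + L * (\<bar>r\<bar> * norm (sgn u))"
    using lipschitz_UNIV_bound[OF L, of "x + r *\<^sub>R sgn u" x] by simp
  also have "\<dots> \<le> \<bar>f x\<bar> + L * (\<bar>r\<bar> * 1)"
    by (intro add_left_mono mult_left_mono norm_sgn_le L0) auto
  finally have "\<bar>f (x + r *\<^sub>R sgn u)\<bar> * norm (sgn u) \<le> (\<bar>f x\<bar> + L * (\<bar>r\<bar> * 1)) * 1"
    using L0 by (intro mult_mono norm_sgn_le) auto
  then show "norm (f (x + r *\<^sub>R sgn u) *\<^sub>R sgn u) \<le> \<bar>f x\<bar> + L * \<bar>r\<bar>" by simp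
qed

text \<open>The unit ball case is applied to \<open>\<lambda>u. f (x + r *\<^sub>R u)\<close>, with
  Lipschitz constant \<open>L * r\<close>, and to the shift \<open>a /\<^sub>R r\<close>; the powers
  of \<open>r\<close> combine to \<open>1 / r\<close>.\<close>

lemma smoothing_expansion:
  fixes f :: "'a::euclidean_space \<Rightarrow> real"
  assumes L: "L-lipschitz_on UNIV f" and r: "r > 0"
  shows "\<bar>smoothing r f (x + a) - smoothing r f x - sphere_grad r f x \<bullet> a\<bar> \<le> sqrt DIM('a) * L / r * (norm a)\<^sup>2"
proof -
  have cont: "continuous_on UNIV f" using L by (rule lipschitz_on_continuous_on)
  then have [measurable]: "f \<in> borel_measurable borel" by (rule borel_measurable_continuous_onI)
  have "(L * r)-lipschitz_on UNIV (\<lambda>u. f (x + r *\<^sub>R u))"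
  proof (rule lipschitz_onI)
    fix u v
    show "dist (f (x + r *\<^sub>R u)) (f (x + r *\<^sub>R v)) \<le> L * r * dist u v"
      using lipschitz_on_normD[OF L, of "x + r *\<^sub>R u" "x + r *\<^sub>R v"] r
      by (simp add: dist_norm scaleR_diff_right[symmetric])
  qed (use r lipschitz_on_nonneg[OF L] in auto)
  note * = unif_ball_mean_expansion[OF this, of "a /\<^sub>R r"]
  have "smoothing r f (x + a) = (\<integral>u. f (x + r *\<^sub>R (u + a /\<^sub>R r)) \<partial>unif_ball)"
    using r by (subst smoothing_eq_unif_ball) (auto simp: scaleR_add_right add_ac)
  moreover have "smoothing r f x = (\<integral>u. f (x + r *\<^sub>R u) \<partial>unif_ball)"
    by (rule smoothing_eq_unif_ball) measurable
  moreover have "sphere_grad r f x \<bullet> a = DIM('a) * (\<integral>u. f (x + r *\<^sub>R sgn u) * (sgn u \<bullet> (a /\<^sub>R r)) \<partial>unif_ball)"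
  proof -
    have "sphere_grad r f x \<bullet> a = DIM('a) * ((\<integral>u. f (x + r *\<^sub>R sgn u) *\<^sub>R sgn u \<partial>unif_ball) \<bullet> (a /\<^sub>R r))"
      by (simp add: sphere_grad_def divide_inverse)
    also have "(\<integral>u. f (x + r *\<^sub>R sgn u) *\<^sub>R sgn u \<partial>unif_ball) \<bullet> (a /\<^sub>R r) =
        (\<integral>u. (f (x + r *\<^sub>R sgn u) *\<^sub>R sgn u) \<bullet> (a /\<^sub>R r) \<partial>unif_ball)"
      using sphere_grad_integrable[OF L] by (intro integral_inner_left[symmetric]) auto
    finally show ?thesis unfolding inner_scaleR_left .
  qed
  moreover have "sqrt DIM('a) * (L * r) * (norm (a /\<^sub>R r))\<^sup>2 = sqrt DIM('a) * L / r * (norm a)\<^sup>2"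
    using r by (simp add: power2_eq_square field_simps)
  ultimately show ?thesis using * by simp
qed

section \<open>Clarke gradients and gradients of smoothings\<close>

lemma lipschitz_borel_measurable:
  fixes f :: "'a::euclidean_space \<Rightarrow> real"
  shows "L-lipschitz_on UNIV f \<Longrightarrow> f \<in> borel_measurable borel"
  by (intro borel_measurable_continuous_onI lipschitz_on_continuous_on)

lemma lipschitz_unif_ball_integrable:
  fixes f :: "'a::euclidean_space \<Rightarrow> real"
  assumes L: "L-lipschitz_on UNIV f"
  shows "integrable unif_ball (\<lambda>u. f (x + r *\<^sub>R u))"
proof (rule unif_ball_integrable_bounded)
  have [measurable]: "f \<in> borel_measurable borel" using L by (rule lipschitz_borel_measurable)
  show "(\<lambda>u. f (x + r *\<^sub>R u)) \<in> borel_measurable borel" by measurable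
  fix u :: 'a assume u: "norm u \<le> 1"
  have "L * (\<bar>r\<bar> * norm u) \<le> L * (\<bar>r\<bar> * 1)"
    using lipschitz_on_nonneg[OF L] u by (intro mult_left_mono) auto
  then show "norm (f (x + r *\<^sub>R u)) \<le> \<bar>f x\<bar> + L * \<bar>r\<bar>"
    using lipschitz_UNIV_bound[OF L, of "x + r *\<^sub>R u" x] by simp
qed

lemma smoothing_dist_le:
  fixes f :: "'a::euclidean_space \<Rightarrow> real"
  assumes L: "L-lipschitz_on UNIV f" and r: "r \<ge> 0"
  shows "\<bar>smoothing r f x - f x\<bar> \<le> L * r"
proof -
  have [measurable]: "f \<in> borel_measurable borel" using L by (rule lipschitz_borel_measurable)
  note int = lipschitz_unif_ball_integrable[OF L]
  have b: "AE u in unif_ball. \<bar>f (x + r *\<^sub>R u) - f x\<bar> \<le> L * r"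
    using AE_unif_ball_norm
  proof eventually_elim
    case (elim u)
    have "L * (r * norm u) \<le> L * (r * 1)"
      using lipschitz_on_nonneg[OF L] elim r by (intro mult_left_mono) auto
    then show ?case
      using lipschitz_UNIV_bound[OF L, of "x + r *\<^sub>R u" x] r by simp
  qed
  have "smoothing r f x - f x = (\<integral>u. f (x + r *\<^sub>R u) - f x \<partial>unif_ball)"
    using int unif_ball.prob_space[where 'a='a] by (simp add: smoothing_eq_unif_ball)
  also have "\<bar>\<dots>\<bar> \<le> (\<integral>u. \<bar>f (x + r *\<^sub>R u) - f x\<bar> \<partial>unif_ball)"
    by (rule integral_abs_bound)
  also have "\<dots> \<le> L * r"
    using b int by (intro unif_ball.integral_le_const) auto
  finally show ?thesis .
qed

lemma smoothing_diff_le: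
  fixes f :: "'a::euclidean_space \<Rightarrow> real"
  assumes L: "L-lipschitz_on UNIV f" and "\<And>u. norm u \<le> 1 \<Longrightarrow> f (y + r *\<^sub>R u) - f (x + r *\<^sub>R u) \<le> c"
  shows "smoothing r f y - smoothing r f x \<le> c"
proof -
  have [measurable]: "f \<in> borel_measurable borel" using L by (rule lipschitz_borel_measurable)
  note int = lipschitz_unif_ball_integrable[OF L]
  have "smoothing r f y - smoothing r f x = (\<integral>u. f (y + r *\<^sub>R u) - f (x + r *\<^sub>R u) \<partial>unif_ball)"
    using int by (simp add: smoothing_eq_unif_ball)
  also have "\<dots> \<le> c"
    using AE_unif_ball_norm assms(2) int by (intro unif_ball.integral_le_const) auto
  finally show ?thesis .
qed

lemma quadratic_expansion_has_derivative:
  fixes F :: "'a::euclidean_space \<Rightarrow> real"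
  assumes "\<And>a. \<bar>F (x + a) - F x - g \<bullet> a\<bar> \<le> K * (norm a)\<^sup>2"
  shows "(F has_derivative (\<lambda>a. g \<bullet> a)) (at x)"
  unfolding has_derivative_at
proof
  show "bounded_linear ((\<bullet>) g)" by (rule bounded_linear_inner_right)
  have K: "((\<lambda>h::'a. K * norm h) \<longlongrightarrow> 0) (at 0)"
    by (rule tendsto_mult_right_zero[OF tendsto_norm_zero[OF tendsto_ident_at]])
  show "(\<lambda>h. norm (F (x + h) - F x - g \<bullet> h) / norm h) \<midarrow>0\<rightarrow> 0"
  proof (rule Lim_null_comparison[OF _ K], rule always_eventually, rule allI)
    fix h :: 'a
    show "norm (norm (F (x + h) - F x - g \<bullet> h) / norm h) \<le> K * norm h"
      using assms[of h] by (cases "h = 0") (simp_all add: pos_divide_le_eq power2_eq_square mult.assoc)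
  qed
qed

lemma smoothing_has_derivative:
  fixes f :: "'a::euclidean_space \<Rightarrow> real"
  assumes "L-lipschitz_on UNIV f" "r > 0"
  shows "(smoothing r f has_derivative (\<lambda>a. sphere_grad r f x \<bullet> a)) (at x)"
  using smoothing_expansion[OF assms] by (rule quadratic_expansion_has_derivative)

lemma smoothing_line_derivative:
  fixes f :: "'a::euclidean_space \<Rightarrow> real"
  assumes "L-lipschitz_on UNIV f" "r > 0"
  shows "((\<lambda>t. smoothing r f (x + t *\<^sub>R a)) has_field_derivative sphere_grad r f (x + t *\<^sub>R a) \<bullet> a) (at t)"
proof -
  have "((\<lambda>t. x + t *\<^sub>R a) has_derivative (\<lambda>h. h *\<^sub>R a)) (at t)"
    by (auto intro!: derivative_eq_intros)
  from has_derivative_compose[OF this smoothing_has_derivative[OF assms]]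
  show ?thesis
    unfolding has_field_derivative_def by (rule has_derivative_eq_rhs) (auto simp: fun_eq_iff)
qed

lemma smoothing_mvt:
  fixes f :: "'a::euclidean_space \<Rightarrow> real"
  assumes "L-lipschitz_on UNIV f" "r > 0" "t > 0"
  obtains s where "0 < s" "s < t"
    "smoothing r f (x + t *\<^sub>R a) - smoothing r f x = t * (sphere_grad r f (x + s *\<^sub>R a) \<bullet> a)"
proof -
  obtain s where "s > 0" "s < t"
    "smoothing r f (x + t *\<^sub>R a) - smoothing r f (x + 0 *\<^sub>R a) = (t - 0) * (sphere_grad r f (x + s *\<^sub>R a) \<bullet> a)"
    using MVT2[OF assms(3), of "\<lambda>t. smoothing r f (x + t *\<^sub>R a)" "\<lambda>s. sphere_grad r f (x + s *\<^sub>R a) \<bullet> a"]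
      smoothing_line_derivative[OF assms(1,2), of x a] by blast
  then show ?thesis by (intro that) auto
qed

lemma right_quotient_tendsto:
  fixes \<phi> :: "real \<Rightarrow> real"
  assumes "(\<phi> has_field_derivative D) (at 0)"
  shows "((\<lambda>t. (\<phi> t - \<phi> 0) / t) \<longlongrightarrow> D) (at_right 0)"
  using assms by (auto simp: DERIV_def intro: filterlim_mono at_le)

lemma sphere_grad_inner_le:
  fixes f :: "'a::euclidean_space \<Rightarrow> real"
  assumes "L-lipschitz_on UNIV f" "r > 0"
    and "eventually (\<lambda>t. smoothing r f (x + t *\<^sub>R a) - smoothing r f x \<le> c * t) (at_right 0)"
  shows "sphere_grad r f x \<bullet> a \<le> c"
proof (rule tendsto_upperbound)
  show "((\<lambda>t. (smoothing r f (x + t *\<^sub>R a) - smoothing r f x) / t) \<longlongrightarrow> sphere_grad r f x \<bullet> a) (at_right 0)"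
    using right_quotient_tendsto[OF smoothing_line_derivative[OF assms(1,2), of x a 0]] by simp
  show "eventually (\<lambda>t. (smoothing r f (x + t *\<^sub>R a) - smoothing r f x) / t \<le> c) (at_right 0)"
    using assms(3) eventually_at_right_less[of 0]
    by eventually_elim (simp add: pos_divide_le_eq)
qed simp

text \<open>The gradient itself is taken as test direction. Estimating the spherical integral
  directly would cost a factor \<open>DIM('a)\<close>.\<close>

lemma norm_sphere_grad_le:
  fixes f :: "'a::euclidean_space \<Rightarrow> real"
  assumes L: "L-lipschitz_on UNIV f" and r: "r > 0"
  shows "norm (sphere_grad r f x) \<le> L"
proof -
  let ?g = "sphere_grad r f x"
  have "?g \<bullet> ?g \<le> L * norm ?g"
  proof (rule sphere_grad_inner_le[OF L r])
    show "eventually (\<lambda>t. smoothing r f (x + t *\<^sub>R ?g) - smoothing r f x \<le> L * norm ?g * t) (at_right 0)"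
      using eventually_at_right_less[of 0]
    proof eventually_elim
      case (elim t)
      show ?case
      proof (rule smoothing_diff_le[OF L])
        fix u :: 'a
        show "f (x + t *\<^sub>R ?g + r *\<^sub>R u) - f (x + r *\<^sub>R u) \<le> L * norm ?g * t"
          using lipschitz_UNIV_bound[OF L, of "x + t *\<^sub>R ?g + r *\<^sub>R u" "x + r *\<^sub>R u"] elim by (simp add: mult_ac)
      qed
    qed
  qed
  then have "norm ?g * norm ?g \<le> L * norm ?g"
    by (simp add: norm_eq_sqrt_inner)
  then show ?thesis
    using lipschitz_on_nonneg[OF L] by (cases "norm ?g = 0") (auto simp: mult_le_cancel_right)
qed

text \<open>Centre and radius vary together: the centre gives Lipschitz continuity of the gradient,
  the radius the passage to the limit from smaller balls.\<close>

lemma sphere_mean_dist_le: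
  fixes f :: "'a::euclidean_space \<Rightarrow> real"
  assumes L: "L-lipschitz_on UNIV f"
  shows "norm ((\<integral>u. f (x + r *\<^sub>R sgn u) *\<^sub>R sgn u \<partial>unif_ball) - (\<integral>u. f (y + q *\<^sub>R sgn u) *\<^sub>R sgn u \<partial>unif_ball))
    \<le> L * (norm (x - y) + \<bar>r - q\<bar>)"
proof -
  have L0: "L \<ge> 0" using L by (rule lipschitz_on_nonneg)
  have [measurable]: "f \<in> borel_measurable borel" using L by (rule lipschitz_borel_measurable)
  note int = sphere_grad_integrable[OF L]
  let ?d = "\<lambda>u. f (x + r *\<^sub>R sgn u) *\<^sub>R sgn u - f (y + q *\<^sub>R sgn u) *\<^sub>R sgn u"
  have "norm (\<integral>u. ?d u \<partial>unif_ball) \<le> (\<integral>u. norm (?d u) \<partial>unif_ball)"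
    by (rule integral_norm_bound)
  also have "\<dots> \<le> L * (norm (x - y) + \<bar>r - q\<bar>)"
  proof (rule unif_ball.integral_le_const)
    show "AE u in unif_ball. norm (?d u) \<le> L * (norm (x - y) + \<bar>r - q\<bar>)"
    proof (rule AE_I2)
      fix u :: 'a
      have "norm (x + r *\<^sub>R sgn u - (y + q *\<^sub>R sgn u)) = norm ((x - y) + (r - q) *\<^sub>R sgn u)"
        by (simp add: algebra_simps)
      also have "\<dots> \<le> norm (x - y) + \<bar>r - q\<bar> * norm (sgn u)"
        by (metis norm_scaleR norm_triangle_ineq)
      also have "\<dots> \<le> norm (x - y) + \<bar>r - q\<bar> * 1"
        by (intro add_left_mono mult_left_mono norm_sgn_le) auto
      finally have "L * norm (x + r *\<^sub>R sgn u - (y + q *\<^sub>R sgn u)) \<le> L * (norm (x - y) + \<bar>r - q\<bar>)"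
        using L0 by (intro mult_left_mono) auto
      then have "\<bar>f (x + r *\<^sub>R sgn u) - f (y + q *\<^sub>R sgn u)\<bar> \<le> L * (norm (x - y) + \<bar>r - q\<bar>)"
        using lipschitz_UNIV_bound[OF L, of "x + r *\<^sub>R sgn u" "y + q *\<^sub>R sgn u"] by linarith
      then have "\<bar>f (x + r *\<^sub>R sgn u) - f (y + q *\<^sub>R sgn u)\<bar> * norm (sgn u) \<le> (L * (norm (x - y) + \<bar>r - q\<bar>)) * 1"
        using L0 by (intro mult_mono norm_sgn_le) auto
      then show "norm (?d u) \<le> L * (norm (x - y) + \<bar>r - q\<bar>)"
        unfolding scaleR_diff_left[symmetric] by simp
    qed
  qed (intro integrable_norm Bochner_Integration.integrable_diff int)
  finally show ?thesis by (simp add: int)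
qed

lemma sphere_grad_lipschitz:
  fixes f :: "'a::euclidean_space \<Rightarrow> real"
  assumes L: "L-lipschitz_on UNIV f" and r: "r > 0"
  shows "norm (sphere_grad r f x - sphere_grad r f y) \<le> DIM('a) / r * L * norm (x - y)"
proof -
  have "norm (sphere_grad r f x - sphere_grad r f y) = DIM('a) / r *
      norm ((\<integral>u. f (x + r *\<^sub>R sgn u) *\<^sub>R sgn u \<partial>unif_ball) - (\<integral>u. f (y + r *\<^sub>R sgn u) *\<^sub>R sgn u \<partial>unif_ball))"
    unfolding sphere_grad_def scaleR_diff_right[symmetric] using r by simp
  also have "\<dots> \<le> DIM('a) / r * (L * (norm (x - y) + \<bar>r - r\<bar>))"
    using r by (intro mult_left_mono sphere_mean_dist_le[OF L]) auto
  finally show ?thesis by simp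
qed

lemma sphere_grad_tendsto_radius:
  fixes f :: "'a::euclidean_space \<Rightarrow> real"
  assumes L: "L-lipschitz_on UNIV f" and q: "q \<longlonglongrightarrow> r" and r: "r > 0"
  shows "(\<lambda>m. sphere_grad (q m) f x) \<longlonglongrightarrow> sphere_grad r f x"
  unfolding sphere_grad_def
proof (intro tendsto_scaleR tendsto_divide tendsto_const q)
  let ?I = "\<lambda>r. \<integral>u. f (x + r *\<^sub>R sgn u) *\<^sub>R sgn u \<partial>unif_ball"
  have "(\<lambda>m. L * (norm (x - x) + \<bar>q m - r\<bar>)) \<longlonglongrightarrow> L * (norm (x - x) + \<bar>r - r\<bar>)"
    by (intro tendsto_intros q)
  then have "(\<lambda>m. L * (norm (x - x) + \<bar>q m - r\<bar>)) \<longlonglongrightarrow> 0" by simp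
  then have "(\<lambda>m. ?I (q m) - ?I r) \<longlonglongrightarrow> 0"
    by (rule Lim_null_comparison[rotated]) (use sphere_mean_dist_le[OF L, of x _ x r] in auto)
  then show "(\<lambda>m. ?I (q m)) \<longlonglongrightarrow> ?I r" by (rule LIM_zero_cancel)
qed (use r in simp)

section \<open>Clarke derivatives as limits of gradients of smoothings\<close>

lemma clarke_dd_lessD:
  assumes "clarke_dd f y v < ereal c"
  obtains \<delta> where "\<delta> > 0" "\<And>z t. dist z y < \<delta> \<Longrightarrow> 0 < t \<Longrightarrow> t < \<delta> \<Longrightarrow> f (z + t *\<^sub>R v) - f z < c * t"
proof -
  from Limsup_lessD[OF assms[unfolded clarke_dd_def]]
  obtain P Q where PQ: "eventually P (nhds y)" "eventually Q (at_right 0)"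
    "\<And>z t. P z \<Longrightarrow> Q t \<Longrightarrow> (f (z + t *\<^sub>R v) - f z) / t < c"
    unfolding eventually_prod_filter by auto
  obtain d1 where d1: "d1 > 0" "\<And>z. dist z y < d1 \<Longrightarrow> P z"
    using PQ(1) by (auto simp: eventually_nhds_metric)
  obtain d2 where d2: "d2 > 0" "\<And>t. 0 < t \<Longrightarrow> t < d2 \<Longrightarrow> Q t"
    using PQ(2) by (auto simp: eventually_at_right_field)
  show thesis
  proof (rule that[of "min d1 d2"])
    fix z t assume "dist z y < min d1 d2" "0 < t" "t < min d1 d2"
    then have "(f (z + t *\<^sub>R v) - f z) / t < c" using d1 d2 PQ(3) by auto
    then show "f (z + t *\<^sub>R v) - f z < c * t" using \<open>0 < t\<close> by (simp add: pos_divide_less_eq)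
  qed (use d1 d2 in auto)
qed

lemma clarke_dd_le:
  assumes d: "\<delta> > 0" and "\<And>z t. dist z y < \<delta> \<Longrightarrow> 0 < t \<Longrightarrow> t < \<delta> \<Longrightarrow> f (z + t *\<^sub>R v) - f z \<le> c * t"
  shows "clarke_dd f y v \<le> ereal c"
  unfolding clarke_dd_def
proof (rule Limsup_bounded, unfold eventually_prod_filter, intro exI conjI allI impI)
  show "eventually (\<lambda>z. dist z y < \<delta>) (nhds y)"
    using d by (auto simp: eventually_nhds_metric)
  show "eventually (\<lambda>t. 0 < t \<and> t < \<delta>) (at_right 0)"
    using d by (auto simp: eventually_at_right_field)
  fix z t assume "dist z y < \<delta>" "0 < t \<and> t < \<delta>"
  then show "(case (z, t) of (z, t) \<Rightarrow> ereal ((f (z + t *\<^sub>R v) - f z) / t)) \<le> ereal c"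
    using assms(2)[of z t] by (simp add: pos_divide_le_eq)
qed

text \<open>If \<open>\<zeta> \<bullet> v\<close> exceeded some \<open>c\<close> above the Clarke
  derivative, all difference quotients in direction \<open>v\<close> near \<open>l\<close> would
  stay below \<open>c\<close>. Averaging over small balls keeps this bound, hence so do the
  gradients of the smoothings and their limit.\<close>

lemma clarke_grad_limit:
  fixes f :: "'a::euclidean_space \<Rightarrow> real"
  assumes L: "L-lipschitz_on UNIV f"
    and q: "\<And>k. q k > 0" "q \<longlonglongrightarrow> 0" and y: "y \<longlonglongrightarrow> l"
    and \<zeta>: "(\<lambda>k. sphere_grad (q k) f (y k)) \<longlonglongrightarrow> \<zeta>"
  shows "\<zeta> \<in> clarke_grad f l"
  unfolding clarke_grad_def
proof (intro CollectI allI, rule ccontr)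
  fix v assume "\<not> ereal (\<zeta> \<bullet> v) \<le> clarke_dd f l v"
  then obtain c where c: "clarke_dd f l v < ereal c" "c < \<zeta> \<bullet> v"
    using ereal_dense2[of "clarke_dd f l v" "\<zeta> \<bullet> v"] by (auto simp: not_le)
  obtain \<delta> where \<delta>: "\<delta> > 0" "\<And>z t. dist z l < \<delta> \<Longrightarrow> 0 < t \<Longrightarrow> t < \<delta> \<Longrightarrow> f (z + t *\<^sub>R v) - f z < c * t"
    using clarke_dd_lessD[OF c(1)] by metis
  have "eventually (\<lambda>k. dist (y k) l < \<delta> / 2) sequentially"
    using y \<delta> by (intro tendstoD) auto
  moreover have "eventually (\<lambda>k. q k < \<delta> / 2) sequentially"
    using q \<delta> by (intro order_tendstoD(2)[OF q(2)]) auto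
  ultimately have "eventually (\<lambda>k. sphere_grad (q k) f (y k) \<bullet> v \<le> c) sequentially"
  proof eventually_elim
    case (elim k)
    show ?case
    proof (rule sphere_grad_inner_le[OF L q(1)])
      have "eventually (\<lambda>t. 0 < t \<and> t < \<delta>) (at_right 0)"
        using \<delta>(1) by (auto simp: eventually_at_right_field)
      then show "eventually (\<lambda>t. smoothing (q k) f (y k + t *\<^sub>R v) - smoothing (q k) f (y k) \<le> c * t) (at_right 0)"
      proof eventually_elim
        case (elim t)
        show ?case
        proof (rule smoothing_diff_le[OF L])
          fix u :: 'a assume u: "norm u \<le> 1"
          have "dist (y k + q k *\<^sub>R u) l \<le> dist (y k) l + q k * norm u"
            using q(1)[of k] norm_triangle_ineq[of "y k - l" "q k *\<^sub>R u"] by (simp add: dist_norm algebra_simps)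
          also have "\<dots> \<le> dist (y k) l + q k * 1"
            using q(1)[of k] u by (intro add_left_mono mult_left_mono) auto
          also have "\<dots> < \<delta>"
            using \<open>dist (y k) l < \<delta> / 2\<close> \<open>q k < \<delta> / 2\<close> by simp
          finally have "f (y k + q k *\<^sub>R u + t *\<^sub>R v) - f (y k + q k *\<^sub>R u) < c * t"
            using elim by (intro \<delta>(2)) auto
          then show "f (y k + t *\<^sub>R v + q k *\<^sub>R u) - f (y k + q k *\<^sub>R u) \<le> c * t"
            by (simp add: add_ac)
        qed
      qed
    qed
  qed
  moreover have "(\<lambda>k. sphere_grad (q k) f (y k) \<bullet> v) \<longlonglongrightarrow> \<zeta> \<bullet> v"
    using \<zeta> by (intro tendsto_intros)
  ultimately have "\<zeta> \<bullet> v \<le> c" by (intro tendsto_upperbound[where F=sequentially]) auto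
  then show False using c by simp
qed

lemma dist_segment_le:
  fixes z :: "'a::euclidean_space"
  assumes "z \<in> cball x r" "z + t *\<^sub>R a \<in> cball x r" "0 \<le> s" "s \<le> t"
  shows "z + s *\<^sub>R a \<in> cball x r"
proof (cases "t = 0")
  case False
  then have t: "t > 0" using assms by auto
  have "z + s *\<^sub>R a = (1 - s / t) *\<^sub>R z + (s / t) *\<^sub>R (z + t *\<^sub>R a)"
    using t by (simp add: algebra_simps)
  moreover have "(1 - s / t) *\<^sub>R z + (s / t) *\<^sub>R (z + t *\<^sub>R a) \<in> cball x r"
    using assms t by (intro convexD[OF convex_cball]) (auto simp: field_simps)
  ultimately show ?thesis by simp
qed (use assms in auto)

text \<open>
  A bound on the Clarke subgradients in a direction integrates to a bound on increments: a violated
  increment is inherited by the smoothings, and the mean value theorem provides gradients of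
  the smoothings that accumulate at a Clarke subgradient violating the bound.
\<close>

lemma clarke_grad_increment_le:
  fixes f :: "'a::euclidean_space \<Rightarrow> real"
  assumes L: "L-lipschitz_on UNIV f"
    and b: "\<And>y \<zeta>. y \<in> ball x r \<Longrightarrow> \<zeta> \<in> clarke_grad f y \<Longrightarrow> \<zeta> \<bullet> a \<le> c"
    and z: "z \<in> ball x r" "z + t *\<^sub>R a \<in> ball x r" "t \<ge> 0"
  shows "f (z + t *\<^sub>R a) - f z \<le> c * t"
proof (cases "t = 0")
  case False
  then have t: "t > 0" using z by simp
  define q where "q k = inverse (real (Suc k))" for k
  have q: "q k > 0" for k unfolding q_def by simp
  have q0: "q \<longlonglongrightarrow> 0" unfolding q_def by (rule LIMSEQ_inverse_real_of_nat)
  have "\<exists>s. 0 < s \<and> s < t \<and> smoothing (q k) f (z + t *\<^sub>R a) - smoothing (q k) f z = t * (sphere_grad (q k) f (z + s *\<^sub>R a) \<bullet> a)" for k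
    by (rule smoothing_mvt[OF L q t]) blast
  then obtain s where s: "\<And>k. 0 < s k" "\<And>k. s k < t"
    "\<And>k. smoothing (q k) f (z + t *\<^sub>R a) - smoothing (q k) f z = t * (sphere_grad (q k) f (z + s k *\<^sub>R a) \<bullet> a)"
    by metis
  \<comment> \<open>Pairing the parameter with the gradient lets one convergent subsequence serve
    both; the gradients stay in \<open>cball 0 L\<close>.\<close>
  define w where "w k = (s k, sphere_grad (q k) f (z + s k *\<^sub>R a))" for k
  have "compact ({0..t} \<times> cball (0::'a) L)"
    by (intro compact_Times) auto
  moreover have "\<forall>k. w k \<in> {0..t} \<times> cball (0::'a) L"
    using s norm_sphere_grad_le[OF L q] by (auto simp: w_def less_imp_le)
  ultimately obtain l \<rho> where l: "l \<in> {0..t} \<times> cball (0::'a) L" "strict_mono (\<rho> :: nat \<Rightarrow> nat)" "(w \<circ> \<rho>) \<longlonglongrightarrow> l"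
    unfolding compact_def by metis
  obtain \<tau> \<zeta> where l_eq: "l = (\<tau>, \<zeta>)" by (cases l)
  have lim1: "(\<lambda>k. s (\<rho> k)) \<longlonglongrightarrow> \<tau>"
    using tendsto_fst[OF l(3)] by (simp add: l_eq w_def o_def)
  have lim2: "(\<lambda>k. sphere_grad (q (\<rho> k)) f (z + s (\<rho> k) *\<^sub>R a)) \<longlonglongrightarrow> \<zeta>"
    using tendsto_snd[OF l(3)] by (simp add: l_eq w_def o_def)
  have "\<zeta> \<in> clarke_grad f (z + \<tau> *\<^sub>R a)"
  proof (rule clarke_grad_limit[OF L _ _ _ lim2])
    show "(\<lambda>k. q (\<rho> k)) \<longlonglongrightarrow> 0" using LIMSEQ_subseq_LIMSEQ[OF q0 l(2)] by (simp add: o_def)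
    show "(\<lambda>k. z + s (\<rho> k) *\<^sub>R a) \<longlonglongrightarrow> z + \<tau> *\<^sub>R a" by (intro tendsto_intros lim1)
  qed (rule q)
  moreover have "z + \<tau> *\<^sub>R a \<in> ball x r"
  proof -
    have "z + \<tau> *\<^sub>R a = (1 - \<tau> / t) *\<^sub>R z + (\<tau> / t) *\<^sub>R (z + t *\<^sub>R a)"
      using t by (simp add: algebra_simps)
    also have "\<dots> \<in> ball x r"
      using z t l(1) by (intro convexD[OF convex_ball]) (auto simp: l_eq field_simps)
    finally show ?thesis .
  qed
  ultimately have "\<zeta> \<bullet> a \<le> c" by (rule b[rotated])
  have sm: "(\<lambda>k. smoothing (q k) f y) \<longlonglongrightarrow> f y" for y
  proof -
    have "(\<lambda>k. L * q k) \<longlonglongrightarrow> L * 0" by (intro tendsto_intros q0)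
    then have "(\<lambda>k. L * q k) \<longlonglongrightarrow> 0" by simp
    then have "(\<lambda>k. smoothing (q k) f y - f y) \<longlonglongrightarrow> 0"
      by (rule Lim_null_comparison[rotated]) (use smoothing_dist_le[OF L less_imp_le[OF q]] in auto)
    then show ?thesis by (rule LIM_zero_cancel)
  qed
  have "(\<lambda>k. smoothing (q k) f (z + t *\<^sub>R a) - smoothing (q k) f z) \<longlonglongrightarrow> f (z + t *\<^sub>R a) - f z"
    by (intro tendsto_diff sm)
  from LIMSEQ_subseq_LIMSEQ[OF this l(2)]
  have "(\<lambda>k. t * (sphere_grad (q (\<rho> k)) f (z + s (\<rho> k) *\<^sub>R a) \<bullet> a)) \<longlonglongrightarrow> f (z + t *\<^sub>R a) - f z"
    by (simp add: s o_def)
  moreover have "(\<lambda>k. t * (sphere_grad (q (\<rho> k)) f (z + s (\<rho> k) *\<^sub>R a) \<bullet> a)) \<longlonglongrightarrow> t * (\<zeta> \<bullet> a)"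
    by (intro tendsto_intros lim2)
  ultimately have "f (z + t *\<^sub>R a) - f z = t * (\<zeta> \<bullet> a)" by (rule LIMSEQ_unique)
  also have "\<dots> \<le> t * c" using \<open>\<zeta> \<bullet> a \<le> c\<close> t by (intro mult_left_mono) auto
  finally show ?thesis by (simp add: mult.commute)
qed simp

section \<open>Comparison of mean increments on nested balls\<close>

lemma eventually_small_step:
  fixes a :: "'a::real_normed_vector"
  assumes "e > 0"
  shows "eventually (\<lambda>t. 0 < t \<and> norm (t *\<^sub>R a) < e) (at_right 0)"
proof -
  have "((\<lambda>t. norm (t *\<^sub>R a)) \<longlongrightarrow> norm (0 *\<^sub>R a)) (at_right 0)"
    by (intro tendsto_intros)
  then have "eventually (\<lambda>t. norm (t *\<^sub>R a) < e) (at_right 0)"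
    using assms by (intro order_tendstoD(2)) auto
  then show ?thesis using eventually_at_right_less[of 0] by eventually_elim auto
qed

text \<open>The power of the radius undoes the normalisation of the mean, up to the volume of the
  unit ball. What remains is the integral of \<open>k - (f (y + b) - f y)\<close> over a ball; this
  integrand is nonnegative on the larger ball, so the integral grows with the ball.\<close>

lemma smoothing_defect_mono:
  fixes f :: "'a::euclidean_space \<Rightarrow> real"
  assumes L: "L-lipschitz_on UNIV f" and \<sigma>: "\<sigma> > 0" and \<rho>: "\<rho> > 0" and sub: "cball z \<sigma> \<subseteq> cball x \<rho>"
    and inc: "\<And>y. y \<in> cball x \<rho> \<Longrightarrow> f (y + b) - f y \<le> k"
  shows "\<sigma> ^ DIM('a) * (k - (smoothing \<sigma> f (z + b) - smoothing \<sigma> f z)) \<le>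
    \<rho> ^ DIM('a) * (k - (smoothing \<rho> f (x + b) - smoothing \<rho> f x))"
proof -
  have [measurable]: "f \<in> borel_measurable borel" using L by (rule lipschitz_borel_measurable)
  note int = lipschitz_unif_ball_integrable[OF L]
  define d where "d y = k - (f (y + b) - f y)" for y
  have [measurable]: "d \<in> borel_measurable borel" unfolding d_def by measurable
  let ?V = "measure lborel (cball (0::'a) 1)"
  have eq: "q ^ DIM('a) * (k - (smoothing q f (y + b) - smoothing q f y)) = (\<integral>z. indicator (cball y q) z * d z \<partial>lborel) / ?V"
    if q: "q > 0" for q y
  proof -
    have "k - (smoothing q f (y + b) - smoothing q f y) = (\<integral>u. d (y + q *\<^sub>R u) \<partial>unif_ball)"
      unfolding d_def using int[of "y + b" q] int[of y q] unif_ball.prob_space[where 'a='a]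
      by (simp add: smoothing_eq_unif_ball add_ac)
    also have "\<dots> = (\<integral>u. indicator (cball 0 1) u * d (y + q *\<^sub>R u) \<partial>lborel) / ?V"
      by (subst integral_unif_ball) (auto simp: divide_inverse mult.commute)
    finally show ?thesis
      using lborel_scale_ball[of d q y] q by simp
  qed
  have i: "integrable lborel (\<lambda>z. indicator (cball y q) z * d z)" for y q
  proof (rule integrable_indicator_cball_bounded[where C="\<bar>k\<bar> + L * norm b"])
    fix u show "\<bar>d u\<bar> \<le> \<bar>k\<bar> + L * norm b"
      unfolding d_def using lipschitz_UNIV_bound[OF L, of "u + b" u] by simp
  qed measurable
  have "(\<integral>y. indicator (cball z \<sigma>) y * d y \<partial>lborel) \<le> (\<integral>y. indicator (cball x \<rho>) y * d y \<partial>lborel)"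
  proof (rule integral_mono[OF i i])
    fix y
    show "indicator (cball z \<sigma>) y * d y \<le> indicator (cball x \<rho>) y * d y"
      using sub inc[of y] unfolding d_def by (cases "y \<in> cball x \<rho>") (auto split: split_indicator)
  qed
  then show ?thesis
    unfolding eq[OF \<sigma>] eq[OF \<rho>] by (intro divide_right_mono) auto
qed

lemma sphere_grad_defect_mono_interior:
  fixes f :: "'a::euclidean_space \<Rightarrow> real"
  assumes L: "L-lipschitz_on UNIV f" and \<sigma>: "\<sigma> > 0" and \<rho>: "\<rho> > 0" "\<rho> < r" and sub: "cball z \<sigma> \<subseteq> cball x \<rho>"
    and inc: "\<And>z t. z \<in> ball x r \<Longrightarrow> z + t *\<^sub>R a \<in> ball x r \<Longrightarrow> t \<ge> 0 \<Longrightarrow> f (z + t *\<^sub>R a) - f z \<le> c * t"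
  shows "\<sigma> ^ DIM('a) * (c - sphere_grad \<sigma> f z \<bullet> a) \<le> \<rho> ^ DIM('a) * (c - sphere_grad \<rho> f x \<bullet> a)"
proof (rule tendsto_le)
  show "((\<lambda>t. \<sigma> ^ DIM('a) * (c - (smoothing \<sigma> f (z + t *\<^sub>R a) - smoothing \<sigma> f z) / t)) \<longlongrightarrow>
      \<sigma> ^ DIM('a) * (c - sphere_grad \<sigma> f z \<bullet> a)) (at_right 0)"
    using right_quotient_tendsto[OF smoothing_line_derivative[OF L \<sigma>, of z a 0]]
    by (intro tendsto_mult tendsto_diff tendsto_const) simp
  show "((\<lambda>t. \<rho> ^ DIM('a) * (c - (smoothing \<rho> f (x + t *\<^sub>R a) - smoothing \<rho> f x) / t)) \<longlongrightarrow>
      \<rho> ^ DIM('a) * (c - sphere_grad \<rho> f x \<bullet> a)) (at_right 0)"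
    using right_quotient_tendsto[OF smoothing_line_derivative[OF L \<rho>(1), of x a 0]]
    by (intro tendsto_mult tendsto_diff tendsto_const) simp
  have "eventually (\<lambda>t. 0 < t \<and> norm (t *\<^sub>R a) < r - \<rho>) (at_right 0)"
    using \<rho> by (intro eventually_small_step) simp
  then show "eventually (\<lambda>t. \<sigma> ^ DIM('a) * (c - (smoothing \<sigma> f (z + t *\<^sub>R a) - smoothing \<sigma> f z) / t) \<le>
      \<rho> ^ DIM('a) * (c - (smoothing \<rho> f (x + t *\<^sub>R a) - smoothing \<rho> f x) / t)) (at_right 0)"
  proof eventually_elim
    case (elim t)
    then have ta: "norm (t *\<^sub>R a) < r - \<rho>" by blast
    have "\<sigma> ^ DIM('a) * (c * t - (smoothing \<sigma> f (z + t *\<^sub>R a) - smoothing \<sigma> f z)) \<le>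
      \<rho> ^ DIM('a) * (c * t - (smoothing \<rho> f (x + t *\<^sub>R a) - smoothing \<rho> f x))"
    proof (rule smoothing_defect_mono[OF L \<sigma> \<rho>(1) sub])
      fix y assume y: "y \<in> cball x \<rho>"
      then have "dist x (y + t *\<^sub>R a) < r"
        using ta norm_triangle_ineq4[of "x - y" "t *\<^sub>R a"] by (simp add: dist_norm algebra_simps)
      then show "f (y + t *\<^sub>R a) - f y \<le> c * t"
        using y \<rho> elim by (intro inc) auto
    qed
    then have "\<sigma> ^ DIM('a) * (c * t - (smoothing \<sigma> f (z + t *\<^sub>R a) - smoothing \<sigma> f z)) / t \<le>
      \<rho> ^ DIM('a) * (c * t - (smoothing \<rho> f (x + t *\<^sub>R a) - smoothing \<rho> f x)) / t"
      using elim by (intro divide_right_mono) auto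
    then show ?case
      using elim by (simp add: diff_divide_distrib right_diff_distrib)
  qed
qed simp

text \<open>The increment bound holds only inside the open ball of radius \<open>r\<close>, so it is
  first used at a radius below \<open>r\<close>, where small steps have room. Continuity in the
  radius then reaches \<open>r\<close> itself.\<close>

lemma sphere_grad_defect_mono:
  fixes f :: "'a::euclidean_space \<Rightarrow> real"
  assumes L: "L-lipschitz_on UNIV f" and \<sigma>: "\<sigma> > 0" and z: "dist x z + \<sigma> < r"
    and inc: "\<And>z t. z \<in> ball x r \<Longrightarrow> z + t *\<^sub>R a \<in> ball x r \<Longrightarrow> t \<ge> 0 \<Longrightarrow> f (z + t *\<^sub>R a) - f z \<le> c * t"
  shows "\<sigma> ^ DIM('a) * (c - sphere_grad \<sigma> f z \<bullet> a) \<le> r ^ DIM('a) * (c - sphere_grad r f x \<bullet> a)"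
proof -
  have r: "r > 0" using z \<sigma> zero_le_dist[of x z] by linarith
  define m where "m = dist x z + \<sigma>"
  \<comment> \<open>These radii start midway between \<open>m\<close> and \<open>r\<close> and
    increase to \<open>r\<close>; being at least \<open>m\<close>, each of them gives a ball
    containing \<open>cball z \<sigma>\<close>.\<close>
  define \<rho> where "\<rho> k = r - (r - m) * inverse (real (Suc (Suc k)))" for k
  have m: "0 < m" "m < r" unfolding m_def using z \<sigma> by (auto simp: add_nonneg_pos)
  have le: "inverse (real (Suc (Suc k))) \<le> 1" "inverse (real (Suc (Suc k))) > 0" for k
    by (auto simp: field_simps)
  have \<rho>: "m \<le> \<rho> k" "\<rho> k < r" for k
  proof -
    have "(r - m) * inverse (real (Suc (Suc k))) \<le> (r - m) * 1"
      using m by (intro mult_left_mono le) simp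
    moreover have "(r - m) * inverse (real (Suc (Suc k))) > 0"
      using m by (intro mult_pos_pos le) simp
    ultimately show "m \<le> \<rho> k" "\<rho> k < r" by (simp_all add: \<rho>_def)
  qed
  have "\<rho> \<longlonglongrightarrow> r - (r - m) * 0"
    unfolding \<rho>_def using LIMSEQ_Suc[OF LIMSEQ_inverse_real_of_nat] by (intro tendsto_intros)
  then have lim: "\<rho> \<longlonglongrightarrow> r" by simp
  have "\<sigma> ^ DIM('a) * (c - sphere_grad \<sigma> f z \<bullet> a) \<le> \<rho> k ^ DIM('a) * (c - sphere_grad (\<rho> k) f x \<bullet> a)" for k
  proof (rule sphere_grad_defect_mono_interior[OF L \<sigma> _ \<rho>(2) _ inc])
    show "\<rho> k > 0" using \<rho>(1)[of k] m by linarith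
    show "cball z \<sigma> \<subseteq> cball x (\<rho> k)"
      using \<rho>(1)[of k] unfolding m_def by (auto simp: cball_subset_cball_iff dist_commute)
  qed
  moreover have "(\<lambda>k. \<rho> k ^ DIM('a) * (c - sphere_grad (\<rho> k) f x \<bullet> a)) \<longlonglongrightarrow> r ^ DIM('a) * (c - sphere_grad r f x \<bullet> a)"
    by (intro tendsto_intros lim sphere_grad_tendsto_radius[OF L _ r])
  ultimately show ?thesis
    by (intro tendsto_lowerbound[where F=sequentially]) auto
qed

text \<open>At radius \<open>r / 2\<close> short steps remain inside the ball, so the averaged bound
  applies there and the defect is nonnegative. Monotonicity carries its sign to radius
  \<open>r\<close>.\<close>

lemma sphere_grad_inner_le_increment:
  fixes f :: "'a::euclidean_space \<Rightarrow> real"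
  assumes L: "L-lipschitz_on UNIV f" and r: "r > 0"
    and inc: "\<And>z t. z \<in> ball x r \<Longrightarrow> z + t *\<^sub>R a \<in> ball x r \<Longrightarrow> t \<ge> 0 \<Longrightarrow> f (z + t *\<^sub>R a) - f z \<le> c * t"
  shows "sphere_grad r f x \<bullet> a \<le> c"
proof -
  let ?\<sigma> = "r / 2"
  have "sphere_grad ?\<sigma> f x \<bullet> a \<le> c"
  proof (rule sphere_grad_inner_le[OF L])
    have "eventually (\<lambda>t. 0 < t \<and> norm (t *\<^sub>R a) < ?\<sigma>) (at_right 0)"
      using r by (intro eventually_small_step) simp
    then show "eventually (\<lambda>t. smoothing ?\<sigma> f (x + t *\<^sub>R a) - smoothing ?\<sigma> f x \<le> c * t) (at_right 0)"
    proof eventually_elim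
      case (elim t)
      then have ta: "norm (t *\<^sub>R a) < ?\<sigma>" by blast
      show ?case
      proof (rule smoothing_diff_le[OF L])
        fix u :: 'a assume u: "norm u \<le> 1"
        then have u': "norm (?\<sigma> *\<^sub>R u) \<le> ?\<sigma>" using r by simp
        have "f (x + ?\<sigma> *\<^sub>R u + t *\<^sub>R a) - f (x + ?\<sigma> *\<^sub>R u) \<le> c * t"
        proof (rule inc)
          show "x + ?\<sigma> *\<^sub>R u \<in> ball x r" using u' r by (simp add: dist_norm)
          show "x + ?\<sigma> *\<^sub>R u + t *\<^sub>R a \<in> ball x r"
            using u' ta norm_triangle_ineq[of "?\<sigma> *\<^sub>R u" "t *\<^sub>R a"] norm_minus_cancel[of "?\<sigma> *\<^sub>R u + t *\<^sub>R a"]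
            by (simp add: dist_norm add.assoc algebra_simps)
        qed (use elim in auto)
        then show "f (x + t *\<^sub>R a + ?\<sigma> *\<^sub>R u) - f (x + ?\<sigma> *\<^sub>R u) \<le> c * t" by (simp add: add_ac)
      qed
    qed
  qed (use r in simp)
  then have "0 \<le> ?\<sigma> ^ DIM('a) * (c - sphere_grad ?\<sigma> f x \<bullet> a)"
    using r by simp
  also have "\<dots> \<le> r ^ DIM('a) * (c - sphere_grad r f x \<bullet> a)"
    using r by (intro sphere_grad_defect_mono[OF L _ _ inc]) auto
  finally show ?thesis
    using zero_less_power[OF r, of "DIM('a)"] by (auto simp: zero_le_mult_iff)
qed

text \<open>Equality means a zero defect at radius \<open>r\<close>, hence a nonpositive one on
  every smaller ball strictly inside. By the mean value theorem the smoothings with small radius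
  increase at rate at least \<open>c\<close>, and letting the radius tend to 0 gives the same for
  \<open>f\<close>.\<close>

lemma sphere_grad_inner_eq_increment:
  fixes f :: "'a::euclidean_space \<Rightarrow> real"
  assumes L: "L-lipschitz_on UNIV f" and r: "r > 0"
    and inc: "\<And>z t. z \<in> ball x r \<Longrightarrow> z + t *\<^sub>R a \<in> ball x r \<Longrightarrow> t \<ge> 0 \<Longrightarrow> f (z + t *\<^sub>R a) - f z \<le> c * t"
    and eq: "sphere_grad r f x \<bullet> a = c"
    and z: "z \<in> ball x r" "z + t *\<^sub>R a \<in> ball x r" "t \<ge> 0"
  shows "f (z + t *\<^sub>R a) - f z \<ge> c * t"
proof (cases "t = 0")
  case False
  then have t: "t > 0" using z by simp
  define m where "m = max (dist x z) (dist x (z + t *\<^sub>R a))"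
  have m: "m < r" unfolding m_def using z by simp
  have ge: "smoothing \<sigma> f (z + t *\<^sub>R a) - smoothing \<sigma> f z \<ge> c * t" if \<sigma>: "0 < \<sigma>" "\<sigma> < r - m" for \<sigma>
  proof -
    obtain s where s: "0 < s" "s < t"
      "smoothing \<sigma> f (z + t *\<^sub>R a) - smoothing \<sigma> f z = t * (sphere_grad \<sigma> f (z + s *\<^sub>R a) \<bullet> a)"
      using smoothing_mvt[OF L \<sigma>(1) t] by metis
    have "z + s *\<^sub>R a \<in> cball x m"
      by (rule dist_segment_le[where t=t]) (use s in \<open>auto simp: m_def\<close>)
    then have "\<sigma> ^ DIM('a) * (c - sphere_grad \<sigma> f (z + s *\<^sub>R a) \<bullet> a) \<le> r ^ DIM('a) * (c - sphere_grad r f x \<bullet> a)"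
      using \<sigma> by (intro sphere_grad_defect_mono[OF L _ _ inc]) auto
    then have "sphere_grad \<sigma> f (z + s *\<^sub>R a) \<bullet> a \<ge> c"
      using zero_less_power[OF \<sigma>(1), of "DIM('a)"] by (auto simp: eq mult_le_0_iff)
    then show ?thesis using s t by (simp add: mult.commute)
  qed
  show ?thesis
  proof (rule field_le_epsilon)
    fix e :: real assume e: "e > 0"
    have L0: "L \<ge> 0" using L by (rule lipschitz_on_nonneg)
    \<comment> \<open>The first bound keeps the small balls inside the large one. The second makes
      the two smoothing errors, each at most \<open>L * \<sigma>\<close>, add up to at most
      \<open>e\<close>; the summand 1 covers \<open>L = 0\<close>.\<close>
    define \<sigma> where "\<sigma> = min ((r - m) / 2) (e / (2 * (L + 1)))"
    have \<sigma>: "0 < \<sigma>" "\<sigma> < r - m" 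
    proof -
      have "e / (2 * (L + 1)) > 0" "(r - m) / 2 > 0" "(r - m) / 2 < r - m" using m e L0 by auto
      then show "0 < \<sigma>" "\<sigma> < r - m" unfolding \<sigma>_def by linarith+
    qed
    have "2 * (L * \<sigma>) \<le> 2 * ((L + 1) * (e / (2 * (L + 1))))"
      using L0 \<sigma> by (intro mult_left_mono mult_mono) (auto simp: \<sigma>_def)
    also have "\<dots> = e" using L0 by (simp add: field_simps)
    finally have "2 * (L * \<sigma>) \<le> e" .
    then show "c * t \<le> f (z + t *\<^sub>R a) - f z + e"
      using ge[OF \<sigma>] smoothing_dist_le[OF L, of \<sigma> z] smoothing_dist_le[OF L, of \<sigma> "z + t *\<^sub>R a"] \<sigma> by linarith
  qed
qed simp

text \<open>Read backwards, the lower bound on increments along \<open>a\<close> is an upper bound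
  \<open>- c\<close> for the Clarke derivative in direction \<open>- a\<close>.\<close>

lemma clarke_grad_affine_direction:
  fixes f :: "'a::euclidean_space \<Rightarrow> real"
  assumes \<zeta>: "\<zeta> \<in> clarke_grad f y" and y: "y \<in> ball x r"
    and inc: "\<And>z t. z \<in> ball x r \<Longrightarrow> z + t *\<^sub>R a \<in> ball x r \<Longrightarrow> t \<ge> 0 \<Longrightarrow> f (z + t *\<^sub>R a) - f z \<ge> c * t"
  shows "\<zeta> \<bullet> a \<ge> c"
proof -
  obtain \<tau> where \<tau>: "\<tau> > 0" "\<And>t. 0 < t \<Longrightarrow> t < \<tau> \<Longrightarrow> norm (t *\<^sub>R a) < (r - dist x y) / 2"
    using eventually_small_step[of "(r - dist x y) / 2" a] y by (auto simp: eventually_at_right_field)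
  have "clarke_dd f y (- a) \<le> ereal (- c)"
  proof (rule clarke_dd_le[of "min \<tau> ((r - dist x y) / 2)"])
    show "min \<tau> ((r - dist x y) / 2) > 0" using \<tau> y by simp
    fix z t assume zt: "dist z y < min \<tau> ((r - dist x y) / 2)" "0 < t" "t < min \<tau> ((r - dist x y) / 2)"
    then have *: "dist z y + norm (t *\<^sub>R a) < r - dist x y" using \<tau>(2)[of t] by simp
    have z1: "z \<in> ball x r"
      using * dist_triangle[of x z y] dist_commute[of z y] norm_ge_zero[of "t *\<^sub>R a"] unfolding mem_ball by linarith
    have "dist x (z - t *\<^sub>R a) \<le> dist x z + norm (t *\<^sub>R a)"
      using norm_triangle_ineq[of "x - z" "t *\<^sub>R a"] by (simp add: dist_norm algebra_simps)
    then have z2: "z - t *\<^sub>R a \<in> ball x r"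
      using * dist_triangle[of x z y] dist_commute[of z y] unfolding mem_ball by linarith
    have "f (z - t *\<^sub>R a + t *\<^sub>R a) - f (z - t *\<^sub>R a) \<ge> c * t"
      using z1 z2 zt by (intro inc) auto
    then show "f (z + t *\<^sub>R - a) - f z \<le> - c * t" by simp
  qed
  moreover have "ereal (\<zeta> \<bullet> - a) \<le> clarke_dd f y (- a)"
    using \<zeta> unfolding clarke_grad_def by blast
  ultimately have "ereal (\<zeta> \<bullet> - a) \<le> ereal (- c)" by (rule order_trans[rotated])
  then show ?thesis by simp
qed

text \<open>
  Only Clarke gradients at points of the open ball are used. This hull need not be closed, so besides
  separation from its closure the case of a supporting hyperplane has to be excluded: there
  equality forces \<open>f\<close> to be affine in the normal direction.
\<close>

theorem sphere_grad_in_clarke_hull: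
  fixes f :: "'a::euclidean_space \<Rightarrow> real"
  assumes L: "L-lipschitz_on UNIV f" and r: "r > 0"
  shows "sphere_grad r f x \<in> convex hull {\<zeta>. \<exists>y\<in>ball x r. \<zeta> \<in> clarke_grad f y}"
proof -
  define g where "g = sphere_grad r f x"
  define C where "C = convex hull {\<zeta>. \<exists>y\<in>ball x r. \<zeta> \<in> clarke_grad f y}"
  have mem: "\<zeta> \<in> C" if "y \<in> ball x r" "\<zeta> \<in> clarke_grad f y" for y \<zeta>
    unfolding C_def using that by (intro hull_inc) auto
  have conv: "convex C" unfolding C_def by (rule convex_convex_hull)
  have cl: "g \<in> closure C"
  proof (rule ccontr)
    assume "g \<notin> closure C"
    then obtain a b where ab: "a \<bullet> g < b" "\<forall>\<zeta>\<in>closure C. a \<bullet> \<zeta> > b"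
      using separating_hyperplane_closed_point[OF convex_closure[OF conv] closed_closure] by blast
    have "\<zeta> \<bullet> (- a) \<le> - b" if "y \<in> ball x r" "\<zeta> \<in> clarke_grad f y" for y \<zeta>
    proof -
      have "\<zeta> \<in> closure C" using mem[OF that] closure_subset by blast
      then have "a \<bullet> \<zeta> > b" using ab(2) by blast
      then show ?thesis by (simp add: inner_commute)
    qed
    then have "g \<bullet> (- a) \<le> - b"
      unfolding g_def
      by (intro sphere_grad_inner_le_increment[OF L r] clarke_grad_increment_le[OF L]) auto
    then show False using ab(1) by (simp add: inner_commute)
  qed
  have "g \<in> C"
  proof (rule ccontr)
    assume "g \<notin> C"
    \<comment> \<open>A convex set and its closure have the same relative interior, so
      \<open>g\<close> is a relative boundary point of the closure and a nontrivial supporting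
      hyperplane exists.\<close>
    then have "g \<notin> rel_interior (closure C)"
      using rel_interior_subset convex_rel_interior_closure[OF conv] by blast
    then obtain a where a: "\<And>y. y \<in> closure C \<Longrightarrow> a \<bullet> g \<le> a \<bullet> y"
        "\<And>y. y \<in> rel_interior (closure C) \<Longrightarrow> a \<bullet> g < a \<bullet> y"
      using supporting_hyperplane_rel_boundary[OF convex_closure[OF conv] cl] by blast
    define c where "c = g \<bullet> (- a)"
    have le: "\<zeta> \<bullet> (- a) \<le> c" if "y \<in> ball x r" "\<zeta> \<in> clarke_grad f y" for y \<zeta>
    proof -
      have "\<zeta> \<in> closure C" using mem[OF that] closure_subset by blast
      then have "a \<bullet> g \<le> a \<bullet> \<zeta>" by (rule a(1))
      then show ?thesis by (simp add: c_def inner_commute)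
    qed
    have inc: "f (z + t *\<^sub>R - a) - f z \<le> c * t" if "z \<in> ball x r" "z + t *\<^sub>R - a \<in> ball x r" "t \<ge> 0" for z t
      using that le by (intro clarke_grad_increment_le[OF L, of x r]) auto
    have inc': "f (z + t *\<^sub>R - a) - f z \<ge> c * t" if "z \<in> ball x r" "z + t *\<^sub>R - a \<in> ball x r" "t \<ge> 0" for z t
      using that inc by (intro sphere_grad_inner_eq_increment[OF L r, where x=x]) (auto simp: c_def g_def)
    have ge: "\<zeta> \<bullet> (- a) \<ge> c" if "y \<in> ball x r" "\<zeta> \<in> clarke_grad f y" for y \<zeta>
      using that inc' by (intro clarke_grad_affine_direction[of \<zeta> f y x r]) auto
    \<comment> \<open>The reversed inequality confines the closure to the half-space
      \<open>a \<bullet> \<zeta> \<le> a \<bullet> g\<close>, whereas points of the relative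
      interior lie strictly on the other side.\<close>
    have "{\<zeta>. \<exists>y\<in>ball x r. \<zeta> \<in> clarke_grad f y} \<subseteq> {\<zeta>. a \<bullet> \<zeta> \<le> - c}"
      using ge by (force simp: inner_commute)
    then have "C \<subseteq> {\<zeta>. a \<bullet> \<zeta> \<le> - c}"
      unfolding C_def by (rule hull_minimal) (rule convex_halfspace_le)
    then have sub: "closure C \<subseteq> {\<zeta>. a \<bullet> \<zeta> \<le> - c}"
      by (rule closure_minimal) (rule closed_halfspace_le)
    have "closure C \<noteq> {}" using cl by auto
    then have "rel_interior (closure C) \<noteq> {}"
      using rel_interior_eq_empty[OF convex_closure[OF conv]] by simp
    then obtain y where y: "y \<in> rel_interior (closure C)" by blast
    then have "a \<bullet> g < a \<bullet> y" "a \<bullet> y \<le> - c"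
      using a(2) sub rel_interior_subset by blast+
    then show False by (simp add: c_def inner_commute)
  qed
  then show ?thesis unfolding g_def C_def .
qed

text \<open>Locality is what transfers Clarke gradients from the modified objective back to
  \<open>f\<close>.\<close>

lemma clarke_grad_cong_open:
  assumes "open S" "y \<in> S" "\<And>z. z \<in> S \<Longrightarrow> f z = h z"
  shows "clarke_grad f y = clarke_grad h y"
proof -
  have "clarke_dd f y v = clarke_dd h y v" for v
    unfolding clarke_dd_def
  proof (rule Limsup_eq)
    obtain e where e: "e > 0" "ball y e \<subseteq> S"
      using assms(1,2) openE by blast
    show "eventually (\<lambda>p. (case p of (y, t) \<Rightarrow> ereal ((f (y + t *\<^sub>R v) - f y) / t)) =
       (case p of (y, t) \<Rightarrow> ereal ((h (y + t *\<^sub>R v) - h y) / t))) (nhds y \<times>\<^sub>F at_right 0)"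
      unfolding eventually_prod_filter
    proof (intro exI conjI allI impI)
      show "eventually (\<lambda>z. dist z y < e / 2) (nhds y)"
        using e(1) unfolding eventually_nhds_metric by (intro exI[of _ "e / 2"]) simp
      show "eventually (\<lambda>t. 0 < t \<and> norm (t *\<^sub>R v) < e / 2) (at_right 0)"
        using e(1) by (intro eventually_small_step) simp
      fix z t assume zt: "dist z y < e / 2" "0 < t \<and> norm (t *\<^sub>R v) < e / 2"
      have "dist y z < e" using zt(1) e(1) by (simp add: dist_commute)
      moreover have "dist y (z + t *\<^sub>R v) < e"
      proof -
        have "dist y (z + t *\<^sub>R v) \<le> dist z y + norm (t *\<^sub>R v)"
          using norm_triangle_ineq4[of "y - z" "t *\<^sub>R v"]
          by (simp add: dist_norm norm_minus_commute diff_diff_eq)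
        then show ?thesis using zt by linarith
      qed
      ultimately have "z \<in> S" "z + t *\<^sub>R v \<in> S" using e(2) by auto
      then show "(case (z, t) of (y, t) \<Rightarrow> ereal ((f (y + t *\<^sub>R v) - f y) / t)) =
          (case (z, t) of (y, t) \<Rightarrow> ereal ((h (y + t *\<^sub>R v) - h y) / t))"
        by (simp add: assms(3))
    qed
  qed
  then show ?thesis unfolding clarke_grad_def by simp
qed

section \<open>Projected steps along a path\<close>

text \<open>Telescoping starts at \<open>K\<close>, since with diminishing stepsizes the decrease
  has the right sign only from some index on.\<close>

lemma summable_descent:
  fixes A B C :: "nat \<Rightarrow> real"
  assumes step: "\<And>k. k \<ge> K \<Longrightarrow> A (Suc k) \<le> A k - B k + C k" and low: "\<And>k. m \<le> A k"
    and B: "\<And>k. k \<ge> K \<Longrightarrow> 0 \<le> B k" and C: "\<And>k. 0 \<le> C k" "summable C"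
  shows "summable B"
proof -
  have 1: "(\<Sum>i<n. B (i + K)) \<le> A K - A (n + K) + (\<Sum>i<n. C (i + K))" for n
  proof (induction n)
    case (Suc n)
    then show ?case using step[of "n + K"] by simp
  qed simp
  have 2: "(\<Sum>i<n. C (i + K)) \<le> suminf (\<lambda>i. C (i + K))" for n
    using C by (intro sum_le_suminf) (auto simp: summable_iff_shift)
  have "(\<Sum>i<n. B (i + K)) \<le> A K - m + suminf (\<lambda>i. C (i + K))" for n
    using 1[of n] 2[of n] low[of "n + K"] by linarith
  then have "summable (\<lambda>i. B (i + K))"
    using B by (intro summableI_nonneg_bounded) auto
  then show ?thesis by (simp add: summable_iff_shift)
qed

text \<open>With \<open>d\<close> of the order of a stepsize and \<open>a\<close> a residual, the
  right-hand side consists of terms like \<open>\<gamma> * r^2\<close> and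
  \<open>\<gamma>^2\<close>, both summable. For squares in place of cubes the leading term would be
  \<open>d * a\<close>, whose sum is not controlled.\<close>

lemma cube_diff_le:
  fixes a b d R :: real
  assumes "0 \<le> a" "0 \<le> b" "b \<le> R" "a \<le> R" "\<bar>b - a\<bar> \<le> d"
  shows "\<bar>b ^ 3 - a ^ 3\<bar> \<le> 5 * (d * a\<^sup>2) + 3 * R * d\<^sup>2"
proof -
  let ?h = "\<bar>b - a\<bar>"
  have "b ^ 3 - a ^ 3 = (b - a) * (a\<^sup>2 + a * b + b\<^sup>2)"
    by (simp add: power3_eq_cube power2_eq_square algebra_simps)
  then have "\<bar>b ^ 3 - a ^ 3\<bar> = ?h * (a\<^sup>2 + a * b + b\<^sup>2)"
    using assms by (simp add: abs_mult)
  also have "a\<^sup>2 + a * b + b\<^sup>2 \<le> 5 * a\<^sup>2 + 3 * ?h\<^sup>2"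
  proof -
    \<comment> \<open>Eight times the difference of the two sides of the claim is
      \<open>(7 * a - 4 * b)^2 + 7 * a^2\<close>.\<close>
    have "(7 * a - 4 * b)\<^sup>2 = 49 * a\<^sup>2 - 56 * (a * b) + 16 * b\<^sup>2" "?h\<^sup>2 = b\<^sup>2 - 2 * (a * b) + a\<^sup>2"
      by (simp_all add: power2_eq_square algebra_simps)
    then show ?thesis
      using zero_le_power2[of "7 * a - 4 * b"] zero_le_power2[of a] by linarith
  qed
  then have "?h * (a\<^sup>2 + a * b + b\<^sup>2) \<le> ?h * (5 * a\<^sup>2 + 3 * ?h\<^sup>2)"
    by (intro mult_left_mono) auto
  also have "\<dots> = 5 * (?h * a\<^sup>2) + 3 * (?h * ?h\<^sup>2)"
    by (simp add: algebra_simps)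
  also have "?h * a\<^sup>2 \<le> d * a\<^sup>2"
    using assms by (intro mult_right_mono) auto
  also have "?h * ?h\<^sup>2 \<le> R * d\<^sup>2"
    using assms by (intro mult_mono power_mono) auto
  finally show ?thesis by simp
qed

text \<open>
  The cubes of the residuals form a Cauchy sequence, since their increments are controlled by the
  summable terms \<open>\<gamma> k * (r k)\<^sup>2\<close>; non-summability of \<open>\<gamma>\<close> then identifies the limit.
\<close>

lemma slowly_varying_tendsto_0:
  fixes r \<gamma> e :: "nat \<Rightarrow> real"
  assumes r: "\<And>k. 0 \<le> r k" "\<And>k. r k \<le> R" and \<gamma>: "\<And>k. 0 < \<gamma> k"
    and s: "summable (\<lambda>k. (\<gamma> k)\<^sup>2)" "\<not> summable \<gamma>" "summable (\<lambda>k. \<gamma> k * (r k)\<^sup>2)"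
    and e: "\<And>k. 0 \<le> e k" "summable e" and A: "0 \<le> A"
    and var: "\<And>k. \<bar>r (Suc k) - r k\<bar> \<le> A * \<gamma> k + e k"
  shows "r \<longlonglongrightarrow> 0"
proof -
  have R: "R \<ge> 0" using r[of 0] by linarith
  have "summable (\<lambda>k. (e k)\<^sup>2)"
  proof (rule summable_comparison_test_ev)
    have "eventually (\<lambda>k. e k < 1) sequentially"
      using summable_LIMSEQ_zero[OF e(2)] by (intro order_tendstoD(2)) auto
    then show "eventually (\<lambda>k. norm ((e k)\<^sup>2) \<le> e k) sequentially"
      by eventually_elim (use e(1) in \<open>auto simp: power2_eq_square mult_left_le\<close>)
  qed (rule e)
  then have "summable (\<lambda>k. 5 * A * (\<gamma> k * (r k)\<^sup>2) + 5 * R\<^sup>2 * e k + (6 * R * A\<^sup>2 * (\<gamma> k)\<^sup>2 + 6 * R * (e k)\<^sup>2))"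
    by (intro summable_add summable_mult s e)
  then have "summable (\<lambda>k. r (Suc k) ^ 3 - r k ^ 3)"
  proof (rule summable_comparison_test[rotated], intro exI allI impI)
    fix k :: nat
    have "norm (r (Suc k) ^ 3 - r k ^ 3) \<le> 5 * ((A * \<gamma> k + e k) * (r k)\<^sup>2) + 3 * R * (A * \<gamma> k + e k)\<^sup>2"
      using cube_diff_le[OF r(1)[of k] r(1)[of "Suc k"] r(2) r(2) var] by simp
    also have "(A * \<gamma> k + e k) * (r k)\<^sup>2 \<le> A * (\<gamma> k * (r k)\<^sup>2) + R\<^sup>2 * e k"
    proof -
      have "(r k)\<^sup>2 \<le> R\<^sup>2" using r by (intro power_mono)
      then have "e k * (r k)\<^sup>2 \<le> e k * R\<^sup>2" using e(1) by (intro mult_left_mono)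
      then show ?thesis by (simp add: algebra_simps)
    qed
    also have "(A * \<gamma> k + e k)\<^sup>2 \<le> 2 * A\<^sup>2 * (\<gamma> k)\<^sup>2 + 2 * (e k)\<^sup>2"
      using zero_le_power2[of "A * \<gamma> k - e k"] by (simp add: power2_eq_square algebra_simps)
    also have "5 * (A * (\<gamma> k * (r k)\<^sup>2) + R\<^sup>2 * e k) + 3 * R * (2 * A\<^sup>2 * (\<gamma> k)\<^sup>2 + 2 * (e k)\<^sup>2) =
        5 * A * (\<gamma> k * (r k)\<^sup>2) + 5 * R\<^sup>2 * e k + (6 * R * A\<^sup>2 * (\<gamma> k)\<^sup>2 + 6 * R * (e k)\<^sup>2)"
      by (simp add: algebra_simps)
    finally show "norm (r (Suc k) ^ 3 - r k ^ 3) \<le>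
        5 * A * (\<gamma> k * (r k)\<^sup>2) + 5 * R\<^sup>2 * e k + (6 * R * A\<^sup>2 * (\<gamma> k)\<^sup>2 + 6 * R * (e k)\<^sup>2)"
      using R by (simp add: mult_left_mono)
  qed
  then have "convergent (\<lambda>n. \<Sum>k<n. r (Suc k) ^ 3 - r k ^ 3)"
    by (simp add: summable_iff_convergent)
  then have "convergent (\<lambda>n. r n ^ 3 - r 0 ^ 3)"
    by (simp add: sum_lessThan_telescope[of "\<lambda>k. r k ^ 3"])
  then obtain l0 where "(\<lambda>n. r n ^ 3 - r 0 ^ 3) \<longlonglongrightarrow> l0" by (auto simp: convergent_def)
  then have "(\<lambda>n. (r n ^ 3 - r 0 ^ 3) + r 0 ^ 3) \<longlonglongrightarrow> l0 + r 0 ^ 3"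
    by (intro tendsto_intros)
  then obtain l where l: "(\<lambda>n. r n ^ 3) \<longlonglongrightarrow> l" by auto
  have "l \<ge> 0"
    using r(1) by (intro tendsto_lowerbound[OF l]) auto
  have "l = 0"
  proof (rule ccontr)
    assume "l \<noteq> 0"
    then have lp: "l > 0" using \<open>l \<ge> 0\<close> by simp
    have Rp: "R > 0"
    proof (rule ccontr)
      assume "\<not> R > 0"
      then have "r n = 0" for n using r[of n] by linarith
      then show False using l \<open>l \<noteq> 0\<close> LIMSEQ_unique[OF l] by (simp add: LIMSEQ_const_iff)
    qed
    have "eventually (\<lambda>k. l / 2 < r k ^ 3) sequentially"
      using l lp by (intro order_tendstoD(1)) auto
    \<comment> \<open>The inequality \<open>r k ^ 3 \<le> R * (r k)^2\<close> turns the lower bound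
      \<open>l / 2\<close> on the cubes into one on the squares, so \<open>\<gamma>\<close> would be
      dominated by a summable sequence.\<close>
    then have "eventually (\<lambda>k. norm (\<gamma> k) \<le> 2 * R / l * (\<gamma> k * (r k)\<^sup>2)) sequentially"
    proof eventually_elim
      case (elim k)
      have "r k ^ 3 \<le> R * (r k)\<^sup>2"
        using mult_right_mono[OF r(2)[of k], of "r k * r k"] by (simp add: power3_eq_cube power2_eq_square mult.assoc)
      then have "1 \<le> 2 * R / l * (r k)\<^sup>2"
        using elim lp by (simp add: field_simps)
      then have "\<gamma> k * 1 \<le> \<gamma> k * (2 * R / l * (r k)\<^sup>2)"
        using \<gamma>[of k] by (intro mult_left_mono) auto
      then show ?case using \<gamma>[of k] by (simp add: mult_ac)
    qed
    moreover have "summable (\<lambda>k. 2 * R / l * (\<gamma> k * (r k)\<^sup>2))"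
      by (intro summable_mult s)
    ultimately have "summable \<gamma>" by (rule summable_comparison_test_ev)
    then show False using s by simp
  qed
  then have "(\<lambda>n. root 3 (r n ^ 3)) \<longlonglongrightarrow> root 3 0"
    using l by (intro tendsto_real_root) auto
  then show ?thesis using r(1) by (simp add: real_root_power_cancel)
qed

section \<open>Projection onto a closed convex set\<close>

locale closed_convex =
  fixes X :: "'a::euclidean_space set"
  assumes closed: "closed X" and convex: "convex X" and nonempty: "X \<noteq> {}"
begin

abbreviation "proj \<equiv> closest_point X"

lemma proj_in: "proj y \<in> X"
  using closed nonempty by (rule closest_point_in_set)

lemma proj_dot: "z \<in> X \<Longrightarrow> (y - proj y) \<bullet> (z - proj y) \<le> 0"
  by (rule closest_point_dot[OF convex closed])

lemma proj_lipschitz: "norm (proj y - proj z) \<le> norm (y - z)"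
  using closest_point_lipschitz[OF convex closed nonempty, of y z] by (simp add: dist_norm)

lemma proj_self: "y \<in> X \<Longrightarrow> proj y = y"
  by (rule closest_point_self)

lemma proj_unique:
  assumes "p \<in> X" "\<And>z. z \<in> X \<Longrightarrow> (y - p) \<bullet> (z - p) \<le> 0"
  shows "p = proj y"
proof -
  have "(y - p) \<bullet> (proj y - p) \<le> 0" "(y - proj y) \<bullet> (p - proj y) \<le> 0"
    using assms proj_in proj_dot by auto
  then have "(proj y - p) \<bullet> (proj y - p) \<le> 0"
    by (simp add: inner_simps inner_commute)
  then show ?thesis by (metis eq_iff_diff_eq_0 inner_gt_zero_iff not_less)
qed

lemma proj_step_inner_le:
  assumes "x \<in> X" "\<gamma> > 0"
  shows "g \<bullet> (proj (x - \<gamma> *\<^sub>R g) - x) \<le> - (norm (proj (x - \<gamma> *\<^sub>R g) - x))\<^sup>2 / \<gamma>"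
proof -
  let ?p = "proj (x - \<gamma> *\<^sub>R g)"
  have "(x - \<gamma> *\<^sub>R g - ?p) \<bullet> (x - ?p) \<le> 0"
    using assms by (intro proj_dot)
  then have "(norm (?p - x))\<^sup>2 + \<gamma> * (g \<bullet> (?p - x)) \<le> 0"
    by (simp add: power2_norm_eq_inner inner_simps inner_commute algebra_simps)
  then have "\<gamma> * (g \<bullet> (?p - x)) \<le> - (norm (?p - x))\<^sup>2" by simp
  then show ?thesis using assms(2) by (simp add: field_simps)
qed

lemma proj_step_perturb:
  assumes "\<gamma> > 0"
  shows "norm (proj (x - \<gamma> *\<^sub>R (g + w)) - proj (x - \<gamma> *\<^sub>R g)) \<le> \<gamma> * norm w"
  using proj_lipschitz[of "x - \<gamma> *\<^sub>R (g + w)" "x - \<gamma> *\<^sub>R g"] assms by (simp add: scaleR_add_right)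

text \<open>The noise \<open>w\<close> is paired with the step of the exact direction
  \<open>g\<close>, which in the scheme depends on earlier batches only; this makes the pairing
  vanish in expectation. The actual step differs from it by at most
  \<open>\<gamma> * norm w\<close>, whence the last term.\<close>

lemma proj_step_descent:
  fixes F :: "'a \<Rightarrow> real"
  assumes x: "x \<in> X" and \<gamma>: "\<gamma> > 0"
    and F: "\<And>a. \<bar>F (x + a) - F x - g \<bullet> a\<bar> \<le> \<Lambda> * (norm a)\<^sup>2"
  shows "F (proj (x - \<gamma> *\<^sub>R (g + w))) \<le> F x - (1 / \<gamma> - \<Lambda>) * (norm (proj (x - \<gamma> *\<^sub>R (g + w)) - x))\<^sup>2
    - w \<bullet> (proj (x - \<gamma> *\<^sub>R g) - x) + \<gamma> * (norm w)\<^sup>2"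
proof -
  define \<Delta> where "\<Delta> = proj (x - \<gamma> *\<^sub>R (g + w)) - x"
  define \<Delta>' where "\<Delta>' = proj (x - \<gamma> *\<^sub>R g) - x"
  have "F (x + \<Delta>) \<le> F x + g \<bullet> \<Delta> + \<Lambda> * (norm \<Delta>)\<^sup>2"
    using F[of \<Delta>] by linarith
  moreover have "(g + w) \<bullet> \<Delta> \<le> - (norm \<Delta>)\<^sup>2 / \<gamma>"
    unfolding \<Delta>_def using proj_step_inner_le[OF x \<gamma>] .
  moreover have "- (w \<bullet> (\<Delta> - \<Delta>')) \<le> \<gamma> * (norm w)\<^sup>2"
  proof -
    have "- (w \<bullet> (\<Delta> - \<Delta>')) \<le> norm w * norm (\<Delta> - \<Delta>')"
      using Cauchy_Schwarz_ineq2[of w "\<Delta> - \<Delta>'"] by linarith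
    also have "\<dots> \<le> norm w * (\<gamma> * norm w)"
      unfolding \<Delta>_def \<Delta>'_def using proj_step_perturb[OF \<gamma>] by (intro mult_left_mono) auto
    finally show ?thesis by (simp add: power2_eq_square mult_ac)
  qed
  ultimately have "F (x + \<Delta>) \<le> F x - (norm \<Delta>)\<^sup>2 / \<gamma> + \<Lambda> * (norm \<Delta>)\<^sup>2 - w \<bullet> \<Delta>' + \<gamma> * (norm w)\<^sup>2"
    by (simp add: inner_simps)
  then show ?thesis
    unfolding \<Delta>_def \<Delta>'_def by (simp add: left_diff_distrib)
qed

text \<open>The norm of the residual with parameter \<open>1 / \<gamma>\<close>, for an arbitrary
  vector field \<open>g\<close>, so that the analysis of a path can use the spherical mean without
  mentioning \<open>grad\<close>.\<close>

definition step_residual :: "real \<Rightarrow> ('a \<Rightarrow> 'a) \<Rightarrow> 'a \<Rightarrow> real" where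
  "step_residual \<gamma> g x = norm (x - proj (x - \<gamma> *\<^sub>R g x)) / \<gamma>"

text \<open>Each projection is tested at the other projected point. Adding the two inequalities and
  applying Cauchy-Schwarz gives \<open>(\<gamma>1 * norm u - \<gamma>2 * norm w) * (norm u - norm w)
  \<le> 0\<close>, which excludes \<open>norm u < norm w\<close>. The lemma compares residuals taken
  with the current stepsizes to those with \<open>\<gamma> 0\<close>.\<close>

lemma step_residual_antimono:
  assumes "0 < \<gamma>1" "\<gamma>1 \<le> \<gamma>2"
  shows "step_residual \<gamma>2 g x \<le> step_residual \<gamma>1 g x"
proof -
  have \<gamma>2: "\<gamma>2 > 0" using assms by simp
  define u where "u = (x - proj (x - \<gamma>1 *\<^sub>R g x)) /\<^sub>R \<gamma>1"
  define w where "w = (x - proj (x - \<gamma>2 *\<^sub>R g x)) /\<^sub>R \<gamma>2"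
  have p1: "proj (x - \<gamma>1 *\<^sub>R g x) = x - \<gamma>1 *\<^sub>R u" and p2: "proj (x - \<gamma>2 *\<^sub>R g x) = x - \<gamma>2 *\<^sub>R w"
    unfolding u_def w_def using assms \<gamma>2 by simp_all
  have "(\<gamma>1 *\<^sub>R (u - g x)) \<bullet> (\<gamma>1 *\<^sub>R u - \<gamma>2 *\<^sub>R w) \<le> 0"
    using proj_dot[OF proj_in[of "x - \<gamma>2 *\<^sub>R g x"], of "x - \<gamma>1 *\<^sub>R g x"] unfolding p1 p2
    by (simp add: algebra_simps)
  then have 1: "(u - g x) \<bullet> (\<gamma>1 *\<^sub>R u - \<gamma>2 *\<^sub>R w) \<le> 0"
    using assms by (simp add: mult_le_0_iff)
  have "(\<gamma>2 *\<^sub>R (w - g x)) \<bullet> (\<gamma>2 *\<^sub>R w - \<gamma>1 *\<^sub>R u) \<le> 0"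
    using proj_dot[OF proj_in[of "x - \<gamma>1 *\<^sub>R g x"], of "x - \<gamma>2 *\<^sub>R g x"] unfolding p1 p2
    by (simp add: algebra_simps)
  then have 2: "(w - g x) \<bullet> (\<gamma>2 *\<^sub>R w - \<gamma>1 *\<^sub>R u) \<le> 0"
    using \<gamma>2 by (simp add: mult_le_0_iff)
  have "(u - w) \<bullet> (\<gamma>1 *\<^sub>R u - \<gamma>2 *\<^sub>R w) \<le> 0"
    using 1 2 by (simp add: inner_simps inner_commute algebra_simps)
  then have "\<gamma>1 * (norm u)\<^sup>2 + \<gamma>2 * (norm w)\<^sup>2 \<le> (\<gamma>1 + \<gamma>2) * (u \<bullet> w)"
    by (simp add: power2_norm_eq_inner inner_simps inner_commute algebra_simps)
  also have "\<dots> \<le> (\<gamma>1 + \<gamma>2) * (norm u * norm w)"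
    using assms \<gamma>2 norm_cauchy_schwarz by (intro mult_left_mono) auto
  finally have "(\<gamma>1 * norm u - \<gamma>2 * norm w) * (norm u - norm w) \<le> 0"
    by (simp add: power2_eq_square algebra_simps)
  moreover have "0 < (\<gamma>1 * norm u - \<gamma>2 * norm w) * (norm u - norm w)" if "norm u < norm w"
  proof (rule mult_neg_neg)
    have "\<gamma>1 * norm u < \<gamma>1 * norm w" using that assms by simp
    also have "\<dots> \<le> \<gamma>2 * norm w" using assms by (intro mult_right_mono) auto
    finally show "\<gamma>1 * norm u - \<gamma>2 * norm w < 0" by simp
  qed (use that in simp)
  ultimately have "norm w \<le> norm u" by (meson not_le)
  then show ?thesis
    unfolding step_residual_def u_def w_def using assms \<gamma>2 by (simp add: divide_inverse mult.commute)
qed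

lemma step_residual_le_norm:
  assumes "x \<in> X" "\<gamma> > 0"
  shows "step_residual \<gamma> g x \<le> norm (g x)"
proof -
  have "norm (proj x - proj (x - \<gamma> *\<^sub>R g x)) \<le> \<gamma> * norm (g x)"
    using proj_lipschitz[of x "x - \<gamma> *\<^sub>R g x"] assms by simp
  then show ?thesis
    unfolding step_residual_def using assms by (simp add: proj_self pos_divide_le_eq mult.commute)
qed

lemma step_residual_lipschitz:
  assumes \<gamma>: "\<gamma> > 0" and g: "norm (g x - g y) \<le> K * norm (x - y)"
  shows "\<bar>step_residual \<gamma> g x - step_residual \<gamma> g y\<bar> \<le> (2 / \<gamma> + K) * norm (x - y)"
proof -
  let ?d = "\<lambda>x. x - proj (x - \<gamma> *\<^sub>R g x)"
  have "norm (?d x - ?d y) \<le> norm (x - y) + norm (proj (x - \<gamma> *\<^sub>R g x) - proj (y - \<gamma> *\<^sub>R g y))"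
    using norm_triangle_ineq4[of "x - y" "proj (x - \<gamma> *\<^sub>R g x) - proj (y - \<gamma> *\<^sub>R g y)"]
    by (simp add: algebra_simps)
  also have "\<dots> \<le> norm (x - y) + norm ((x - y) - \<gamma> *\<^sub>R (g x - g y))"
    using proj_lipschitz[of "x - \<gamma> *\<^sub>R g x" "y - \<gamma> *\<^sub>R g y"] by (simp add: algebra_simps)
  also have "\<dots> \<le> norm (x - y) + (norm (x - y) + \<gamma> * norm (g x - g y))"
    using norm_triangle_ineq4[of "x - y" "\<gamma> *\<^sub>R (g x - g y)"] \<gamma> by simp
  also have "\<dots> \<le> norm (x - y) + (norm (x - y) + \<gamma> * (K * norm (x - y)))"
    using \<gamma> g by (intro add_left_mono mult_left_mono) auto
  finally have "\<bar>norm (?d x) - norm (?d y)\<bar> \<le> 2 * norm (x - y) + \<gamma> * (K * norm (x - y))"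
    using norm_triangle_ineq3[of "?d x" "?d y"] by linarith
  then have "\<bar>norm (?d x) - norm (?d y)\<bar> / \<gamma> \<le> (2 * norm (x - y) + \<gamma> * (K * norm (x - y))) / \<gamma>"
    using \<gamma> by (intro divide_right_mono) auto
  also have "\<dots> = (2 / \<gamma> + K) * norm (x - y)"
    using \<gamma> by (simp add: field_simps)
  finally show ?thesis
    unfolding step_residual_def using \<gamma> by (simp add: diff_divide_distrib[symmetric])
qed

lemma step_residual_0_normal_cone:
  assumes "x \<in> X" "\<gamma> > 0" "step_residual \<gamma> g x = 0"
  shows "- g x \<in> normal_cone X x"
proof -
  have p: "proj (x - \<gamma> *\<^sub>R g x) = x"
    using assms by (simp add: step_residual_def)
  have "- g x \<bullet> (y - x) \<le> 0" if "y \<in> X" for y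
    using proj_dot[OF that, of "x - \<gamma> *\<^sub>R g x"] assms(2) unfolding p by (simp add: zero_le_mult_iff)
  then show ?thesis using assms by (auto simp: normal_cone_def)
qed

section \<open>Residuals along a single path\<close>

lemma path_residual_le:
  assumes "\<gamma> > 0" "x' = proj (x - \<gamma> *\<^sub>R (g x + w))"
  shows "step_residual \<gamma> g x \<le> norm (x' - x) / \<gamma> + norm w"
proof -
  have "norm (x - proj (x - \<gamma> *\<^sub>R g x)) \<le> norm (x' - x) + norm (x' - proj (x - \<gamma> *\<^sub>R g x))"
    using norm_triangle_ineq4[of "x' - proj (x - \<gamma> *\<^sub>R g x)" "x' - x"] by simp
  also have "\<dots> \<le> norm (x' - x) + \<gamma> * norm w"
    using proj_step_perturb[OF assms(1), of x "g x" w] assms(2) by simp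
  finally have "norm (x - proj (x - \<gamma> *\<^sub>R g x)) / \<gamma> \<le> (norm (x' - x) + \<gamma> * norm w) / \<gamma>"
    using assms by (intro divide_right_mono) auto
  then show ?thesis
    unfolding step_residual_def using assms by (simp add: add_divide_distrib)
qed

lemma path_residual_const:
  assumes \<gamma>: "\<gamma> > 0" and step: "\<And>k. x (Suc k) = proj (x k - \<gamma> *\<^sub>R (g (x k) + w k))"
    and s: "summable (\<lambda>k. (norm (x (Suc k) - x k))\<^sup>2)" "summable (\<lambda>k. (norm (w k))\<^sup>2)"
  shows "(\<lambda>k. step_residual \<gamma> g (x k)) \<longlonglongrightarrow> 0"
proof -
  have sq: "f \<longlonglongrightarrow> 0" if "summable (\<lambda>k. (f k)\<^sup>2)" for f :: "nat \<Rightarrow> real"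
    using summable_LIMSEQ_zero[OF that] by simp
  have "(\<lambda>k. norm (x (Suc k) - x k) / \<gamma> + norm (w k)) \<longlonglongrightarrow> 0 / \<gamma> + 0"
    using \<gamma> by (intro tendsto_add tendsto_divide tendsto_const sq s) auto
  then have lim: "(\<lambda>k. norm (x (Suc k) - x k) / \<gamma> + norm (w k)) \<longlonglongrightarrow> 0" by simp
  show ?thesis
  proof (rule Lim_null_comparison[OF _ lim], rule always_eventually, rule allI)
    fix k
    show "norm (step_residual \<gamma> g (x k)) \<le> norm (x (Suc k) - x k) / \<gamma> + norm (w k)"
      using path_residual_le[where g=g, OF \<gamma> step[of k]] \<gamma> by (simp add: step_residual_def)
  qed
qed

text \<open>The residual is kept at the fixed parameter \<open>\<gamma> 0\<close>, because one
  Lipschitz function of the iterate inherits the slow variation of the path.\<close>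

lemma path_residual_diminishing:
  assumes x: "\<And>k. x k \<in> X" and \<gamma>: "\<And>k. \<gamma> k > 0" and step: "\<And>k. x (Suc k) = proj (x k - \<gamma> k *\<^sub>R (g (x k) + w k))"
    and g: "\<And>x y. norm (g x - g y) \<le> K * norm (x - y)" "\<And>x. norm (g x) \<le> L" and K: "K \<ge> 0"
    and lim: "\<gamma> \<longlonglongrightarrow> 0" and s: "summable (\<lambda>k. (\<gamma> k)\<^sup>2)" "\<not> summable \<gamma>"
    and sx: "summable (\<lambda>k. (norm (x (Suc k) - x k))\<^sup>2 / \<gamma> k)" and sw: "summable (\<lambda>k. \<gamma> k * (norm (w k))\<^sup>2)"
  shows "(\<lambda>k. step_residual (\<gamma> 0) g (x k)) \<longlonglongrightarrow> 0"
proof -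
  define r where "r k = step_residual (\<gamma> 0) g (x k)" for k
  define C where "C = 2 / \<gamma> 0 + K"
  have C: "C \<ge> 0" unfolding C_def using K \<gamma>[of 0] by simp
  have L: "L \<ge> 0" using g(2)[of 0] norm_ge_zero order_trans by blast
  have r0: "r k \<ge> 0" for k unfolding r_def step_residual_def using \<gamma>[of 0] by simp
  have rL: "r k \<le> L" for k
    unfolding r_def using step_residual_le_norm[OF x[of k] \<gamma>[of 0], of g] g(2)[of "x k"] by linarith
  have "summable (\<lambda>k. \<gamma> k * (r k)\<^sup>2)"
  proof (rule summable_comparison_test_ev)
    \<comment> \<open>The stepsizes need not be monotone, so comparison with
      \<open>\<gamma> 0\<close> is available only eventually, from convergence to 0.\<close>
    have "eventually (\<lambda>k. \<gamma> k < \<gamma> 0) sequentially"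
      using lim \<gamma>[of 0] by (intro order_tendstoD(2)) auto
    then show "eventually (\<lambda>k. norm (\<gamma> k * (r k)\<^sup>2) \<le> 2 * ((norm (x (Suc k) - x k))\<^sup>2 / \<gamma> k) + 2 * (\<gamma> k * (norm (w k))\<^sup>2)) sequentially"
    proof eventually_elim
      case (elim k)
      define p where "p = norm (x (Suc k) - x k) / \<gamma> k"
      have "r k \<le> step_residual (\<gamma> k) g (x k)"
        unfolding r_def using elim \<gamma> by (intro step_residual_antimono) auto
      also have "\<dots> \<le> p + norm (w k)"
        unfolding p_def by (rule path_residual_le[where g=g, OF \<gamma> step])
      finally have "(r k)\<^sup>2 \<le> (p + norm (w k))\<^sup>2" using r0 by (intro power_mono)
      also have "\<dots> \<le> 2 * p\<^sup>2 + 2 * (norm (w k))\<^sup>2"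
        using zero_le_power2[of "p - norm (w k)"] by (simp add: power2_eq_square algebra_simps)
      finally have "\<gamma> k * (r k)\<^sup>2 \<le> \<gamma> k * (2 * p\<^sup>2 + 2 * (norm (w k))\<^sup>2)"
        using \<gamma>[of k] by (intro mult_left_mono) auto
      moreover have "\<gamma> k * p\<^sup>2 = (norm (x (Suc k) - x k))\<^sup>2 / \<gamma> k"
        unfolding p_def using \<gamma>[of k] by (simp add: power2_eq_square)
      ultimately show ?case using \<gamma>[of k] by (simp add: distrib_left)
    qed
  qed (intro summable_add summable_mult sx sw)
  moreover have "\<bar>r (Suc k) - r k\<bar> \<le> C * (L + 1) * \<gamma> k + C * (\<gamma> k * (norm (w k))\<^sup>2)" for k
  proof -
    have "norm (x (Suc k) - x k) = norm (proj (x k - \<gamma> k *\<^sub>R (g (x k) + w k)) - proj (x k))"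
      by (simp add: step proj_self[OF x])
    also have "\<dots> \<le> \<gamma> k * norm (g (x k) + w k)"
      using proj_lipschitz[of "x k - \<gamma> k *\<^sub>R (g (x k) + w k)" "x k"] \<gamma>[of k] by simp
    \<comment> \<open>Only squared noise is summable with weights \<open>\<gamma> k\<close>.
      Bounding \<open>norm (w k)\<close> by \<open>1 + (norm (w k))^2\<close> moves the linear part
      into the constant multiplying \<open>\<gamma> k\<close>.\<close>
    also have "norm (g (x k) + w k) \<le> L + 1 + (norm (w k))\<^sup>2"
    proof -
      have "2 * norm (w k) \<le> 1 + (norm (w k))\<^sup>2"
        using zero_le_power2[of "norm (w k) - 1"] by (simp add: power2_eq_square algebra_simps)
      then have "norm (w k) \<le> 1 + (norm (w k))\<^sup>2"
        using norm_ge_zero[of "w k"] by linarith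
      then show ?thesis using norm_triangle_ineq[of "g (x k)" "w k"] g(2)[of "x k"] by linarith
    qed
    finally have "norm (x (Suc k) - x k) \<le> \<gamma> k * (L + 1 + (norm (w k))\<^sup>2)"
      using \<gamma>[of k] by (simp add: mult_left_mono)
    then have "C * norm (x (Suc k) - x k) \<le> C * (\<gamma> k * (L + 1 + (norm (w k))\<^sup>2))"
      using C by (rule mult_left_mono)
    moreover have "\<bar>r (Suc k) - r k\<bar> \<le> C * norm (x (Suc k) - x k)"
      unfolding r_def C_def by (rule step_residual_lipschitz[where g=g, OF \<gamma> g(1)])
    ultimately show ?thesis by (simp add: algebra_simps)
  qed
  ultimately have "r \<longlonglongrightarrow> 0"
    using \<gamma> C L less_imp_le[OF \<gamma>]
    by (intro slowly_varying_tendsto_0[where A="C * (L + 1)" and e="\<lambda>k. C * (\<gamma> k * (norm (w k))\<^sup>2)" and R=L and \<gamma>=\<gamma>])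
       (auto intro!: r0 rL s summable_mult sw)
  then show ?thesis unfolding r_def .
qed

lemma residual_limit_point_normal_cone:
  assumes x: "\<And>k. x k \<in> X" and \<gamma>: "\<gamma> > 0" and g: "\<And>x y. norm (g x - g y) \<le> K * norm (x - y)"
    and lim: "(\<lambda>k. step_residual \<gamma> g (x k)) \<longlonglongrightarrow> 0" and l: "l \<in> seq_limit_points x"
  shows "l \<in> X \<and> - g l \<in> normal_cone X l"
proof -
  obtain \<rho> where \<rho>: "strict_mono (\<rho> :: nat \<Rightarrow> nat)" "(x \<circ> \<rho>) \<longlonglongrightarrow> l"
    using l unfolding seq_limit_points_def by blast
  have lX: "l \<in> X"
    using closed_sequentially[OF closed _ \<rho>(2)] x by simp
  have "(\<lambda>k. (2 / \<gamma> + K) * norm (x (\<rho> k) - l)) \<longlonglongrightarrow> (2 / \<gamma> + K) * norm (l - l)"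
    using \<rho>(2) by (intro tendsto_intros) (simp add: o_def)
  then have "(\<lambda>k. (2 / \<gamma> + K) * norm (x (\<rho> k) - l)) \<longlonglongrightarrow> 0" by simp
  then have "(\<lambda>k. step_residual \<gamma> g (x (\<rho> k)) - step_residual \<gamma> g l) \<longlonglongrightarrow> 0"
    by (rule Lim_null_comparison[rotated]) (use step_residual_lipschitz[where g=g, OF \<gamma> g] in auto)
  then have "(\<lambda>k. step_residual \<gamma> g (x (\<rho> k))) \<longlonglongrightarrow> step_residual \<gamma> g l"
    by (rule LIM_zero_cancel)
  moreover have "(\<lambda>k. step_residual \<gamma> g (x (\<rho> k))) \<longlonglongrightarrow> 0"
    using LIMSEQ_subseq_LIMSEQ[OF lim \<rho>(1)] by (simp add: o_def)
  ultimately have "step_residual \<gamma> g l = 0" by (rule LIMSEQ_unique)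
  then show ?thesis
    using step_residual_0_normal_cone[OF lX \<gamma>, of g] lX by simp
qed

text \<open>A vector orthogonal to all differences of points of \<open>X\<close> contributes nothing
  to the variational inequality that characterises the projection.\<close>

lemma proj_orthogonal_shift:
  assumes "x \<in> X" "\<And>z. z \<in> X \<Longrightarrow> d \<bullet> (z - x) = 0"
  shows "proj (y + d) = proj y"
proof (rule proj_unique[symmetric, OF proj_in])
  fix z assume z: "z \<in> X"
  have "d \<bullet> (z - proj y) = d \<bullet> (z - x) - d \<bullet> (proj y - x)" by (simp add: inner_simps)
  also have "\<dots> = 0" using assms z proj_in by simp
  finally show "(y + d - proj y) \<bullet> (z - proj y) \<le> 0"
    using proj_dot[OF z, of y] by (simp add: inner_simps)
qed

end

section \<open>The stochastic scheme\<close>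

text \<open>Expectation and sum of nonnegative terms commute, so the random sum has finite
  expectation and is finite almost everywhere.\<close>

lemma AE_summable_of_summable_integral:
  fixes B :: "nat \<Rightarrow> 'a \<Rightarrow> real"
  assumes int: "\<And>k. integrable M (B k)" and nn: "\<And>k \<omega>. 0 \<le> B k \<omega>"
    and s: "summable (\<lambda>k. \<integral>\<omega>. B k \<omega> \<partial>M)"
  shows "AE \<omega> in M. summable (\<lambda>k. B k \<omega>)"
proof -
  have [measurable]: "B k \<in> borel_measurable M" for k using int by auto
  have "(\<integral>\<^sup>+\<omega>. (\<Sum>k. ennreal (B k \<omega>)) \<partial>M) = (\<Sum>k. \<integral>\<^sup>+\<omega>. ennreal (B k \<omega>) \<partial>M)"
    by (intro nn_integral_suminf) measurable
  also have "\<dots> = (\<Sum>k. ennreal (\<integral>\<omega>. B k \<omega> \<partial>M))"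
    by (simp add: nn_integral_eq_integral int nn)
  also have "\<dots> = ennreal (\<Sum>k. \<integral>\<omega>. B k \<omega> \<partial>M)"
    using s nn by (intro suminf_ennreal2) auto
  finally have "(\<integral>\<^sup>+\<omega>. (\<Sum>k. ennreal (B k \<omega>)) \<partial>M) \<noteq> \<infinity>" by simp
  then have "AE \<omega> in M. (\<Sum>k. ennreal (B k \<omega>)) \<noteq> \<infinity>"
    by (intro nn_integral_PInf_AE) measurable
  then show ?thesis
    by eventually_elim (intro summable_suminf_not_top, auto simp: nn)
qed

lemma sgn_sgn_vec: "sgn (sgn u) = sgn (u :: 'a::real_normed_vector)"
  by (cases "u = 0") (simp_all add: sgn_div_norm)

lemma Int_stable_vimage:
  fixes f :: "'a \<Rightarrow> 'b::topological_space"
  shows "Int_stable {f -` A \<inter> S |A. A \<in> sets borel}"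
proof (rule Int_stableI)
  fix a b assume "a \<in> {f -` A \<inter> S |A. A \<in> sets borel}" "b \<in> {f -` A \<inter> S |A. A \<in> sets borel}"
  then obtain A B where "a = f -` A \<inter> S" "b = f -` B \<inter> S" "A \<in> sets borel" "B \<in> sets borel" by auto
  then show "a \<inter> b \<in> {f -` A \<inter> S |A. A \<in> sets borel}"
    by (intro CollectI exI[of _ "A \<inter> B"]) auto
qed

section \<open>Pairing the two independent families of samples\<close>

context prob_space
begin

text \<open>Grouping the disjoint sum of indices into blocks \<open>{Inl j, Inr j}\<close> keeps the
  generated sigma-algebras independent, and each pair is measurable for its block. Independence
  within a block makes the law of the pair a product.\<close>

lemma
  fixes Z :: "'i \<Rightarrow> 'a \<Rightarrow> 'b::second_countable_topology" and V :: "'i \<Rightarrow> 'a \<Rightarrow> 'c::second_countable_topology"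
  assumes ind: "indep_samples Z V I"
  shows indep_samples_indep_vars: "indep_vars (\<lambda>_. borel) (\<lambda>i \<omega>. (Z i \<omega>, V i \<omega>)) I"
    and indep_samples_pair_law:
      "i \<in> I \<Longrightarrow> distr M borel (\<lambda>\<omega>. (Z i \<omega>, V i \<omega>)) = distr M borel (Z i) \<Otimes>\<^sub>M distr M borel (V i)"
proof -
  define E where "E = case_sum (\<lambda>i. {Z i -` A \<inter> space M |A. A \<in> sets borel}) (\<lambda>i. {V i -` A \<inter> space M |A. A \<in> sets borel})"
  have m: "Z i \<in> borel_measurable M" "V i \<in> borel_measurable M" if "i \<in> I" for i
    using ind that unfolding indep_samples_def by auto
  have E: "indep_sets E (I <+> I)"
    using ind unfolding indep_samples_def E_def by auto
  have sub: "E (Inl i) \<subseteq> Pow (space M)" "E (Inr i) \<subseteq> Pow (space M)" for i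
    unfolding E_def by auto
  have "indep_sets (\<lambda>j. sigma_sets (space M) (\<Union>i\<in>{Inl j, Inr j}. E i)) I"
  proof (rule indep_sets_collect_sigma)
    have "(\<Union>j\<in>I. {Inl j, Inr j}) = I <+> I" by auto
    then show "indep_sets E (\<Union>j\<in>I. {Inl j, Inr j})" using E by simp
    show "Int_stable (E i)" if "i \<in> {Inl j, Inr j}" for i j
      using that Int_stable_vimage[of "Z j" "space M"] Int_stable_vimage[of "V j" "space M"] unfolding E_def by auto
    show "disjoint_family_on (\<lambda>j. {Inl j, Inr j}) I"
      by (auto simp: disjoint_family_on_def)
  qed
  then have "indep_sets (\<lambda>i. {(\<lambda>\<omega>. (Z i \<omega>, V i \<omega>)) -` A \<inter> space M |A. A \<in> sets borel}) I"
  proof (rule indep_sets_mono_sets)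
    fix i assume "i \<in> I"
    define S where "S = sigma (space M) (\<Union>i\<in>{Inl i, Inr i}. E i)"
    have S: "space S = space M" "sets S = sigma_sets (space M) (\<Union>i\<in>{Inl i, Inr i}. E i)"
      unfolding S_def using sub[of i] by (auto simp: sets_measure_of space_measure_of)
    have "Z i \<in> measurable S borel"
      by (rule measurableI) (auto simp: S E_def intro!: sigma_sets.Basic)
    moreover have "V i \<in> measurable S borel"
      by (rule measurableI) (auto simp: S E_def intro!: sigma_sets.Basic)
    ultimately have "(\<lambda>\<omega>. (Z i \<omega>, V i \<omega>)) \<in> measurable S borel"
      by (rule borel_measurable_Pair)
    then show "{(\<lambda>\<omega>. (Z i \<omega>, V i \<omega>)) -` A \<inter> space M |A. A \<in> sets borel} \<subseteq> sigma_sets (space M) (\<Union>i\<in>{Inl i, Inr i}. E i)"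
      using measurable_sets[of "\<lambda>\<omega>. (Z i \<omega>, V i \<omega>)" S borel] S by auto
  qed
  then show "indep_vars (\<lambda>_. borel) (\<lambda>i \<omega>. (Z i \<omega>, V i \<omega>)) I"
    unfolding indep_vars_def2 using m by (auto intro: borel_measurable_Pair)
  assume i: "i \<in> I"
  note [measurable] = m[OF i]
  interpret PZ: prob_space "distr M borel (Z i)" by (rule prob_space_distr) measurable
  interpret PV: prob_space "distr M borel (V i)" by (rule prob_space_distr) measurable
  show "distr M borel (\<lambda>\<omega>. (Z i \<omega>, V i \<omega>)) = distr M borel (Z i) \<Otimes>\<^sub>M distr M borel (V i)"
  proof (rule pair_measure_eqI[symmetric])
    show "sets (distr M borel (Z i) \<Otimes>\<^sub>M distr M borel (V i)) = sets (distr M borel (\<lambda>\<omega>. (Z i \<omega>, V i \<omega>)))"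
      by (simp add: borel_prod[symmetric] cong: sets_pair_measure_cong)
    fix A B assume AB: "A \<in> sets (distr M borel (Z i))" "B \<in> sets (distr M borel (V i))"
    then have [measurable]: "A \<in> sets borel" "B \<in> sets borel" by auto
    define F where "F = case_sum (\<lambda>_::'i. Z i -` A \<inter> space M) (\<lambda>_::'i. V i -` B \<inter> space M)"
    have "prob (\<Inter>j\<in>{Inl i, Inr i}. F j) = (\<Prod>j\<in>{Inl i, Inr i}. prob (F j))"
      using i by (intro indep_setsD[OF E]) (auto simp: F_def E_def)
    then have "prob (Z i -` A \<inter> space M \<inter> (V i -` B \<inter> space M)) = prob (Z i -` A \<inter> space M) * prob (V i -` B \<inter> space M)"
      by (simp add: F_def)
    moreover have "Z i -` A \<inter> space M \<inter> (V i -` B \<inter> space M) = (\<lambda>\<omega>. (Z i \<omega>, V i \<omega>)) -` (A \<times> B) \<inter> space M" by auto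
    moreover have [measurable]: "A \<times> B \<in> sets borel" by (simp add: borel_prod[symmetric])
    moreover have "(\<lambda>\<omega>. (Z i \<omega>, V i \<omega>)) \<in> borel_measurable M" by (intro borel_measurable_Pair) measurable
    ultimately show "emeasure (distr M borel (Z i)) A * emeasure (distr M borel (V i)) B = emeasure (distr M borel (\<lambda>\<omega>. (Z i \<omega>, V i \<omega>))) (A \<times> B)"
      by (simp add: emeasure_distr emeasure_eq_measure ennreal_mult)
  qed (intro prob_space_imp_sigma_finite PZ.prob_space_axioms PV.prob_space_axioms)+
qed

end

text \<open>The scheme for an integrand whose Lipschitz bounds hold everywhere, driven by one family
  of independent pairs. The estimates thus need no exceptional sets; these are dealt with when the
  locale is interpreted.\<close>

locale zo_scheme = prob_space M + closed_convex X
  for M :: "'w measure" and X :: "'a::euclidean_space set" +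
  fixes h :: "'a \<Rightarrow> 'd::euclidean_space \<Rightarrow> real" and lip :: "'d \<Rightarrow> real" and P :: "'d measure"
    and \<eta> :: real and x0 :: 'a and \<gamma> :: "nat \<Rightarrow> real" and N :: "nat \<Rightarrow> nat"
    and W :: "nat \<times> nat \<Rightarrow> 'w \<Rightarrow> 'd \<times> 'a"
  assumes P: "prob_space P" "sets P = sets borel"
    and h_meas: "(\<lambda>p. h (fst p) (snd p)) \<in> borel_measurable borel"
    and h_lip: "\<And>y y' z. \<bar>h y z - h y' z\<bar> \<le> lip z * norm (y - y')"
    and lip: "lip \<in> borel_measurable borel" "\<And>z. lip z \<ge> 0" "integrable P (\<lambda>z. (lip z)\<^sup>2)"
    and h_int: "\<And>y. integrable P (h y)"
    and \<eta>: "\<eta> > 0" and x0: "x0 \<in> X" and \<gamma>: "\<And>k. \<gamma> k > 0" and N: "\<And>k. N k \<ge> 1"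
    and indep: "indep_vars (\<lambda>_. borel) W (SIGMA k:UNIV. {1..N k})"
    and law: "\<And>i. i \<in> (SIGMA k:UNIV. {1..N k}) \<Longrightarrow> distr M borel (W i) = P \<Otimes>\<^sub>M uniform_sphere \<eta>"
begin

definition obj :: "'a \<Rightarrow> real" where "obj y = (\<integral>z. h y z \<partial>P)"
definition Lc :: real where "Lc = sqrt (\<integral>z. (lip z)\<^sup>2 \<partial>P)"
text \<open>Writing \<open>\<eta> *\<^sub>R sgn (snd w)\<close> instead of \<open>snd w\<close>
  keeps both evaluation points within \<open>\<eta>\<close> of \<open>y\<close> for every argument.
  For directions of norm \<open>\<eta>\<close>, hence almost surely, this is the estimator of the
  scheme.\<close>

definition est :: "'a \<Rightarrow> 'd \<times> 'a \<Rightarrow> 'a" where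
  "est y w = (DIM('a) / (2 * \<eta>) * (h (y + \<eta> *\<^sub>R sgn (snd w)) (fst w) - h (y - \<eta> *\<^sub>R sgn (snd w)) (fst w))) *\<^sub>R sgn (snd w)"
abbreviation G :: "'a \<Rightarrow> 'a" where "G \<equiv> sphere_grad \<eta> obj"
abbreviation idx :: "(nat \<times> nat) set" where "idx \<equiv> SIGMA k:UNIV. {1..N k}"
abbreviation sample_law :: "('d \<times> 'a) measure" where "sample_law \<equiv> P \<Otimes>\<^sub>M uniform_sphere \<eta>"

text \<open>The iterates are deterministic functions of the array of samples, so dependence on
  earlier batches alone becomes a statement about functions, with no filtration involved.\<close>

fun iter :: "nat \<Rightarrow> (nat \<times> nat \<Rightarrow> 'd \<times> 'a) \<Rightarrow> 'a" where
  "iter 0 s = x0"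
| "iter (Suc k) s = proj (iter k s - \<gamma> k *\<^sub>R ((1 / real (N k)) *\<^sub>R (\<Sum>j=1..N k. est (iter k s) (s (k, j)))))"

definition xs :: "nat \<Rightarrow> 'w \<Rightarrow> 'a" where "xs k \<omega> = iter k (\<lambda>i. W i \<omega>)"

definition noise :: "nat \<Rightarrow> 'w \<Rightarrow> 'a" where
  "noise k \<omega> = (1 / real (N k)) *\<^sub>R (\<Sum>j=1..N k. est (xs k \<omega>) (W (k, j) \<omega>)) - G (xs k \<omega>)"

lemma xs_in: "xs k \<omega> \<in> X"
  unfolding xs_def by (cases k) (auto simp: x0 proj_in)

lemma xs_Suc: "xs (Suc k) \<omega> = proj (xs k \<omega> - \<gamma> k *\<^sub>R (G (xs k \<omega>) + noise k \<omega>))"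
  unfolding xs_def noise_def by simp

lemma sphere_prob: "prob_space (uniform_sphere \<eta> :: 'a measure)"
  unfolding uniform_sphere_def by (rule unif_ball.prob_space_distr) measurable

lemma P_measurable [measurable_cong]: "sets P = sets borel" by (rule P(2))

lemma sphere_sets [measurable_cong]: "sets (uniform_sphere \<eta> :: 'a measure) = sets borel"
  unfolding uniform_sphere_def by simp

lemma sample_law_sets [measurable_cong]: "sets sample_law = sets borel"
  unfolding borel_prod[symmetric] by (intro sets_pair_measure_cong P sphere_sets)

lemma Lc_nonneg: "Lc \<ge> 0" unfolding Lc_def by simp

lemma lip_integrable: "integrable P lip"
  and lip_mean_le: "(\<integral>z. lip z \<partial>P) \<le> Lc"
proof -
  interpret P: prob_space P by (rule P)
  have [measurable]: "lip \<in> borel_measurable P" using lip(1) by simp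
  show int: "integrable P lip"
    by (rule P.square_integrable_imp_integrable) (use lip in auto)
  have "0 \<le> (\<integral>z. (lip z)\<^sup>2 \<partial>P) - (\<integral>z. lip z \<partial>P)\<^sup>2"
    using P.variance_eq[OF int lip(3)] P.variance_positive by metis
  then show "(\<integral>z. lip z \<partial>P) \<le> Lc"
    unfolding Lc_def by (intro real_le_rsqrt) simp
qed

lemma obj_lipschitz: "Lc-lipschitz_on UNIV obj"
proof (rule lipschitz_onI[OF _ Lc_nonneg])
  fix y y' :: 'a
  have "\<bar>obj y - obj y'\<bar> = \<bar>\<integral>z. h y z - h y' z \<partial>P\<bar>"
    unfolding obj_def using h_int by simp
  also have "\<dots> \<le> (\<integral>z. lip z * norm (y - y') \<partial>P)"
    using h_int h_lip lip_integrable
    by (intro integral_abs_bound[THEN order_trans] integral_mono integrable_abs Bochner_Integration.integrable_diff integrable_mult_left) auto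
  also have "\<dots> = (\<integral>z. lip z \<partial>P) * norm (y - y')" by simp
  also have "\<dots> \<le> Lc * norm (y - y')"
    using lip_mean_le by (intro mult_right_mono) auto
  finally show "dist (obj y) (obj y') \<le> Lc * dist y y'" by (simp add: dist_norm)
qed

lemma est_measurable [measurable (raw)]:
  assumes [measurable]: "y \<in> borel_measurable K" "u \<in> borel_measurable K"
  shows "(\<lambda>s. est (y s) (u s)) \<in> borel_measurable K"
proof -
  have [measurable]: "(\<lambda>s. fst (u s)) \<in> borel_measurable K" "(\<lambda>s. snd (u s)) \<in> borel_measurable K"
    using assms(2) by (auto simp: borel_prod[symmetric])
  have h: "(\<lambda>s. h (a s) (b s)) \<in> borel_measurable K"
    if "a \<in> borel_measurable K" "b \<in> borel_measurable K" for a b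
    using measurable_compose[OF borel_measurable_Pair[OF that] h_meas] by simp
  have [measurable]: "(\<lambda>s. h (y s + \<eta> *\<^sub>R sgn (snd (u s))) (fst (u s))) \<in> borel_measurable K"
    "(\<lambda>s. h (y s - \<eta> *\<^sub>R sgn (snd (u s))) (fst (u s))) \<in> borel_measurable K"
    by (intro h; measurable)+
  show ?thesis unfolding est_def by measurable
qed

lemma norm_est_le: "norm (est y u) \<le> DIM('a) * lip (fst u)"
proof -
  let ?s = "sgn (snd u)"
  have "(y + \<eta> *\<^sub>R ?s) - (y - \<eta> *\<^sub>R ?s) = 2 *\<^sub>R (\<eta> *\<^sub>R ?s)"
    unfolding scaleR_2 by (metis add.commute add_diff_cancel diff_add_cancel diff_diff_eq2)
  then have "norm ((y + \<eta> *\<^sub>R ?s) - (y - \<eta> *\<^sub>R ?s)) = norm ((2 * \<eta>) *\<^sub>R ?s)"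
    by simp
  also have "\<dots> \<le> 2 * \<eta>" using \<eta> norm_sgn_le[of "snd u"] by simp
  finally have "lip (fst u) * norm ((y + \<eta> *\<^sub>R ?s) - (y - \<eta> *\<^sub>R ?s)) \<le> lip (fst u) * (2 * \<eta>)"
    using lip(2) by (intro mult_left_mono) auto
  then have "\<bar>h (y + \<eta> *\<^sub>R ?s) (fst u) - h (y - \<eta> *\<^sub>R ?s) (fst u)\<bar> \<le> lip (fst u) * (2 * \<eta>)"
    using h_lip[of "y + \<eta> *\<^sub>R ?s" "fst u" "y - \<eta> *\<^sub>R ?s"] by linarith
  then have "DIM('a) / (2 * \<eta>) * \<bar>h (y + \<eta> *\<^sub>R ?s) (fst u) - h (y - \<eta> *\<^sub>R ?s) (fst u)\<bar> * norm ?s \<le>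
      DIM('a) / (2 * \<eta>) * (lip (fst u) * (2 * \<eta>)) * 1"
    using \<eta> lip(2) by (intro mult_mono mult_left_mono norm_sgn_le) auto
  then show ?thesis
    unfolding est_def using \<eta> by (simp add: abs_mult)
qed

lemma norm_G_le: "norm (G y) \<le> Lc"
  using obj_lipschitz \<eta> by (rule norm_sphere_grad_le)

lemma G_lipschitz: "norm (G y - G y') \<le> DIM('a) / \<eta> * Lc * norm (y - y')"
  using obj_lipschitz \<eta> by (rule sphere_grad_lipschitz)

lemma G_measurable [measurable]: "G \<in> borel_measurable borel"
proof (intro borel_measurable_continuous_onI lipschitz_on_continuous_on lipschitz_onI)
  show "dist (G y) (G y') \<le> DIM('a) / \<eta> * Lc * dist y y'" for y y'
    using G_lipschitz by (simp add: dist_norm)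
qed (use \<eta> Lc_nonneg in simp)

lemma proj_measurable [measurable]: "proj \<in> borel_measurable borel"
  using continuous_on_closest_point[OF convex closed nonempty] by (rule borel_measurable_continuous_onI)

lemma fst_law: "distr sample_law P fst = P"
proof -
  interpret S: prob_space "uniform_sphere \<eta> :: 'a measure" by (rule sphere_prob)
  interpret P: prob_space P by (rule P)
  show ?thesis
  proof (rule measure_eqI)
    fix A assume "A \<in> sets (distr sample_law P fst)"
    then have A: "A \<in> sets P" by simp
    have "fst -` A \<inter> space sample_law = A \<times> space (uniform_sphere \<eta> :: 'a measure)"
      using sets.sets_into_space[OF A] by (auto simp: space_pair_measure)
    then show "emeasure (distr sample_law P fst) A = emeasure P A"
      using A by (simp add: emeasure_distr S.emeasure_pair_measure_Times S.emeasure_space_1)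
  qed simp
qed

lemma lip_fst_integrable: "integrable sample_law (\<lambda>u. (lip (fst u))\<^sup>2)" "integrable sample_law (\<lambda>u. lip (fst u))"
proof -
  have [measurable]: "lip \<in> borel_measurable P" using lip(1) by simp
  show "integrable sample_law (\<lambda>u. (lip (fst u))\<^sup>2)"
    using lip(3) integrable_distr_eq[of fst sample_law P "\<lambda>z. (lip z)\<^sup>2"] by (simp add: fst_law)
  show "integrable sample_law (\<lambda>u. lip (fst u))"
    using lip_integrable integrable_distr_eq[of fst sample_law P lip] by (simp add: fst_law)
qed

lemma prob_space_sample_law: "prob_space sample_law"
  by (intro prob_space_pair P sphere_prob)

lemma est_integrable: "integrable sample_law (est y)"
proof (rule Bochner_Integration.integrable_bound)
  show "integrable sample_law (\<lambda>u. DIM('a) * lip (fst u))" by (intro integrable_mult_right lip_fst_integrable)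
  show "AE u in sample_law. norm (est y u) \<le> norm (DIM('a) * lip (fst u))"
    using norm_est_le lip(2) by (intro AE_I2) (simp add: abs_mult)
  show "est y \<in> borel_measurable sample_law" by measurable
qed

text \<open>By Fubini the integration over \<open>z\<close> turns \<open>h\<close> into
  \<open>obj\<close>. The reflection \<open>u \<mapsto> - u\<close> makes the two halves of the
  symmetric difference contribute equally, which turns the factor \<open>1 / (2 * \<eta>)\<close>
  into \<open>1 / \<eta>\<close>.\<close>

lemma est_mean: "(\<integral>u. est y u \<partial>sample_law) = G y"
proof -
  interpret S: prob_space "uniform_sphere \<eta> :: 'a measure" by (rule sphere_prob)
  interpret P: prob_space P by (rule P)
  interpret PS: pair_sigma_finite P "uniform_sphere \<eta> :: 'a measure" ..
  have [measurable]: "obj \<in> borel_measurable borel" using obj_lipschitz by (rule lipschitz_borel_measurable)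
  let ?c = "DIM('a) / (2 * \<eta>)"
  have "(\<integral>u. est y u \<partial>sample_law) = (\<integral>v. (\<integral>z. est y (z, v) \<partial>P) \<partial>uniform_sphere \<eta>)"
    using PS.integral_snd[of "\<lambda>z v. est y (z, v)"] est_integrable[of y] by simp
  also have "\<dots> = (\<integral>v. (?c * (obj (y + \<eta> *\<^sub>R sgn v) - obj (y - \<eta> *\<^sub>R sgn v))) *\<^sub>R sgn v \<partial>uniform_sphere \<eta>)"
    unfolding est_def obj_def using h_int by simp
  also have "\<dots> = (\<integral>u. (?c * (obj (y + \<eta> *\<^sub>R sgn (\<eta> *\<^sub>R sgn u)) - obj (y - \<eta> *\<^sub>R sgn (\<eta> *\<^sub>R sgn u)))) *\<^sub>R sgn (\<eta> *\<^sub>R sgn u) \<partial>unif_ball)"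
    unfolding uniform_sphere_def by (subst integral_distr) auto
  also have "\<dots> = (\<integral>u. ?c *\<^sub>R (obj (y + \<eta> *\<^sub>R sgn u) *\<^sub>R sgn u + obj (y + \<eta> *\<^sub>R sgn (- u)) *\<^sub>R sgn (- u)) \<partial>unif_ball)"
    using \<eta> by (simp add: sgn_scaleR sgn_sgn_vec sgn_minus algebra_simps)
  also have "\<dots> = ?c *\<^sub>R ((\<integral>u. obj (y + \<eta> *\<^sub>R sgn u) *\<^sub>R sgn u \<partial>unif_ball) + (\<integral>u. obj (y + \<eta> *\<^sub>R sgn (- u)) *\<^sub>R sgn (- u) \<partial>unif_ball))"
  proof -
    have i: "integrable unif_ball (\<lambda>u. obj (y + \<eta> *\<^sub>R sgn u) *\<^sub>R sgn u)"
      using obj_lipschitz by (rule sphere_grad_integrable)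
    have "integrable unif_ball (\<lambda>u. obj (y + - \<eta> *\<^sub>R sgn u) *\<^sub>R sgn u)"
      using obj_lipschitz by (rule sphere_grad_integrable)
    then have "integrable unif_ball (\<lambda>u. - (obj (y + - \<eta> *\<^sub>R sgn u) *\<^sub>R sgn u))"
      by (rule integrable_minus)
    then have i2: "integrable unif_ball (\<lambda>u. obj (y + \<eta> *\<^sub>R sgn (- u)) *\<^sub>R sgn (- u))"
      by (simp add: sgn_minus)
    show ?thesis
      by (subst Bochner_Integration.integral_add[OF i i2, symmetric]) simp
  qed
  also have "(\<integral>u. obj (y + \<eta> *\<^sub>R sgn (- u)) *\<^sub>R sgn (- u) \<partial>unif_ball) = (\<integral>u. obj (y + \<eta> *\<^sub>R sgn u) *\<^sub>R sgn u \<partial>unif_ball)"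
    using distr_lborel_reflect[of "\<lambda>_::'a. -1"]
    by (intro integral_unif_ball_isometry[where T=uminus]) (auto simp: sum_negf euclidean_representation)
  also have "?c *\<^sub>R ((\<integral>u. obj (y + \<eta> *\<^sub>R sgn u) *\<^sub>R sgn u \<partial>unif_ball) + (\<integral>u. obj (y + \<eta> *\<^sub>R sgn u) *\<^sub>R sgn u \<partial>unif_ball)) = G y"
    unfolding sphere_grad_def by (simp add: scaleR_2[symmetric])
  finally show ?thesis .
qed

end

section \<open>Mean-square bound for the noise\<close>

context zo_scheme
begin

text \<open>The array \<open>S\<close> is arbitrary so that the same argument covers the iterates on
  \<open>M\<close> and the map \<open>iter k\<close> on the product space of all samples but
  one.\<close>

lemma iter_measurable:
  assumes "\<And>k' j. k' < k \<Longrightarrow> j \<in> {1..N k'} \<Longrightarrow> (\<lambda>\<omega>. S \<omega> (k', j)) \<in> borel_measurable K"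
  shows "(\<lambda>\<omega>. iter k (S \<omega>)) \<in> borel_measurable K"
  using assms
proof (induction k)
  case (Suc k)
  have [measurable]: "(\<lambda>\<omega>. iter k (S \<omega>)) \<in> borel_measurable K"
    using Suc.prems by (intro Suc.IH) auto
  have [measurable]: "(\<lambda>\<omega>. est (iter k (S \<omega>)) (S \<omega> (k, j))) \<in> borel_measurable K" if "j \<in> {1..N k}" for j
    using Suc.prems[of k j] that by (intro est_measurable) auto
  have [measurable]: "(\<lambda>\<omega>. \<Sum>j=1..N k. est (iter k (S \<omega>)) (S \<omega> (k, j))) \<in> borel_measurable K"
    by (intro borel_measurable_sum) measurable
  show ?case by simp
qed simp

lemma iter_cong:
  assumes "\<And>k' j. k' < k \<Longrightarrow> j \<in> {1..N k'} \<Longrightarrow> s (k', j) = s' (k', j)"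
  shows "iter k s = iter k s'"
  using assms
proof (induction k)
  case (Suc k)
  have "iter k s = iter k s'" using Suc.prems by (intro Suc.IH) auto
  moreover have "s (k, j) = s' (k, j)" if "j \<in> {1..N k}" for j using Suc.prems[of k j] that by simp
  ultimately show ?case by simp
qed simp

lemma W_measurable: "i \<in> idx \<Longrightarrow> W i \<in> borel_measurable M"
  using indep unfolding indep_vars_def by blast

lemma xs_measurable [measurable]: "xs k \<in> borel_measurable M"
  unfolding xs_def[abs_def] by (rule iter_measurable) (auto intro: W_measurable)

definition err :: "'a \<Rightarrow> 'd \<times> 'a \<Rightarrow> 'a" where "err y u = est y u - G y"
text \<open>An envelope of the error that does not involve the point \<open>y\<close>, so the
  variance is bounded along the whole path, wherever the iterates go.\<close>

definition err_bound :: "'d \<times> 'a \<Rightarrow> real" where "err_bound u = DIM('a) * lip (fst u) + Lc"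
definition err_var :: real where "err_var = (\<integral>u. (err_bound u)\<^sup>2 \<partial>sample_law)"

lemma err_measurable [measurable (raw)]:
  assumes [measurable]: "y \<in> borel_measurable K" "u \<in> borel_measurable K"
  shows "(\<lambda>s. err (y s) (u s)) \<in> borel_measurable K"
  unfolding err_def by measurable

lemma norm_err_le: "norm (err y u) \<le> err_bound u"
  unfolding err_def err_bound_def
  using norm_triangle_ineq4[of "est y u" "G y"] norm_est_le[of y u] norm_G_le[of y] by linarith

lemma err_bound_measurable [measurable]: "err_bound \<in> borel_measurable borel"
  unfolding err_bound_def[abs_def]
  using lip(1) measurable_compose[OF borel_measurable_continuous_onI[OF continuous_on_fst[OF continuous_on_id]] lip(1)]
  by measurable

lemma err_bound_sq_integrable: "integrable sample_law (\<lambda>u. (err_bound u)\<^sup>2)"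
proof -
  interpret S: prob_space sample_law by (rule prob_space_sample_law)
  have "integrable sample_law (\<lambda>u. (DIM('a))\<^sup>2 * (lip (fst u))\<^sup>2 + 2 * DIM('a) * Lc * lip (fst u) + Lc\<^sup>2)"
    by (intro Bochner_Integration.integrable_add integrable_mult_right lip_fst_integrable) auto
  then show ?thesis
    unfolding err_bound_def by (rule back_subst[of "integrable sample_law"]) (auto simp: fun_eq_iff power2_eq_square algebra_simps)
qed

lemma
  assumes "i \<in> idx"
  shows err_bound_W_integrable: "integrable M (\<lambda>\<omega>. (err_bound (W i \<omega>))\<^sup>2)"
    and err_bound_W_integral: "(\<integral>\<omega>. (err_bound (W i \<omega>))\<^sup>2 \<partial>M) = err_var"
proof -
  note [measurable] = W_measurable[OF assms]
  have "integrable (distr M borel (W i)) (\<lambda>u. (err_bound u)\<^sup>2)"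
    using err_bound_sq_integrable law[OF assms] by simp
  then show "integrable M (\<lambda>\<omega>. (err_bound (W i \<omega>))\<^sup>2)"
    by (subst (asm) integrable_distr_eq) measurable
  have "err_var = (\<integral>u. (err_bound u)\<^sup>2 \<partial>distr M borel (W i))"
    unfolding err_var_def law[OF assms] ..
  then show "(\<integral>\<omega>. (err_bound (W i \<omega>))\<^sup>2 \<partial>M) = err_var"
    by (simp add: integral_distr)
qed

lemma err_mean_inner: "(\<integral>u. err y u \<bullet> b \<partial>sample_law) = 0"
proof -
  interpret S: prob_space sample_law by (rule prob_space_sample_law)
  have "integrable sample_law (err y)" "(\<integral>u. err y u \<partial>sample_law) = 0"
    unfolding err_def using est_integrable[of y] est_mean[of y] S.prob_space by auto
  then show ?thesis by (simp add: integral_inner_left)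
qed

lemma inner_le_sum_squares:
  fixes a b :: 'a
  assumes "norm a \<le> c"
  shows "\<bar>a \<bullet> b\<bar> \<le> c\<^sup>2 + (norm b)\<^sup>2"
proof -
  have "\<bar>a \<bullet> b\<bar> \<le> norm a * norm b" by (rule Cauchy_Schwarz_ineq2)
  also have "\<dots> \<le> c * norm b" using assms by (intro mult_right_mono) auto
  also have "\<dots> \<le> c\<^sup>2 + (norm b)\<^sup>2"
    using zero_le_power2[of "c - norm b"] zero_le_power2[of c] zero_le_power2[of "norm b"]
    by (simp only: power2_diff)
  finally show ?thesis .
qed

text \<open>Takes the place of conditional expectations: sample \<open>i\<close> is independent of
  the block of all remaining samples, future ones included. By Fubini the error is averaged over
  sample \<open>i\<close> first, with point and test vector frozen, and that mean is 0.\<close>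

lemma
  assumes i: "i \<in> idx"
    and Y [measurable]: "Y \<in> borel_measurable (PiM (idx - {i}) (\<lambda>_. borel))"
    and B [measurable]: "B \<in> borel_measurable (PiM (idx - {i}) (\<lambda>_. borel))"
  defines "U \<omega> \<equiv> restrict (\<lambda>i. W i \<omega>) (idx - {i})"
  assumes sq: "integrable M (\<lambda>\<omega>. (norm (B (U \<omega>)))\<^sup>2)"
  shows err_inner_integrable: "integrable M (\<lambda>\<omega>. err (Y (U \<omega>)) (W i \<omega>) \<bullet> B (U \<omega>))"
    and err_inner_mean_0: "(\<integral>\<omega>. err (Y (U \<omega>)) (W i \<omega>) \<bullet> B (U \<omega>) \<partial>M) = 0"
proof -
  let ?K = "PiM (idx - {i}) (\<lambda>_. borel :: ('d \<times> 'a) measure)"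
  let ?K1 = "PiM {i} (\<lambda>_. borel :: ('d \<times> 'a) measure)"
  define R where "R \<omega> = restrict (\<lambda>i. W i \<omega>) {i}" for \<omega>
  have ind: "indep_var ?K1 R ?K U"
    unfolding U_def R_def using i by (intro indep_var_restrict[OF indep]) auto
  have [measurable]: "R \<in> measurable M ?K1" "U \<in> measurable M ?K"
    using ind by (auto dest: indep_var_rv1 indep_var_rv2)
  note [measurable] = W_measurable[OF i]
  interpret R: prob_space "distr M ?K1 R" by (rule prob_space_distr) measurable
  interpret U: prob_space "distr M ?K U" by (rule prob_space_distr) measurable
  interpret RU: pair_sigma_finite "distr M ?K1 R" "distr M ?K U" ..
  have eq: "distr M (?K1 \<Otimes>\<^sub>M ?K) (\<lambda>\<omega>. (R \<omega>, U \<omega>)) = distr M ?K1 R \<Otimes>\<^sub>M distr M ?K U"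
    using ind by (simp add: indep_var_distribution_eq)
  have [measurable]: "(\<lambda>s. s i) \<in> borel_measurable ?K1"
    by (rule measurable_component_singleton) simp
  have Ri: "R \<omega> i = W i \<omega>" for \<omega> by (simp add: R_def)
  define \<phi> where "\<phi> p = err (Y (snd p)) (fst p i) \<bullet> B (snd p)" for p
  have [measurable]: "\<phi> \<in> borel_measurable (?K1 \<Otimes>\<^sub>M ?K)"
    unfolding \<phi>_def[abs_def] by measurable
  show int: "integrable M (\<lambda>\<omega>. err (Y (U \<omega>)) (W i \<omega>) \<bullet> B (U \<omega>))"
  proof (rule Bochner_Integration.integrable_bound)
    show "integrable M (\<lambda>\<omega>. (err_bound (W i \<omega>))\<^sup>2 + (norm (B (U \<omega>)))\<^sup>2)"
      using sq err_bound_W_integrable[OF i] by (rule Bochner_Integration.integrable_add[rotated])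
    show "AE \<omega> in M. norm (err (Y (U \<omega>)) (W i \<omega>) \<bullet> B (U \<omega>)) \<le> norm ((err_bound (W i \<omega>))\<^sup>2 + (norm (B (U \<omega>)))\<^sup>2)"
      using inner_le_sum_squares[OF norm_err_le] by (intro AE_I2) auto
  qed measurable
  then have "integrable M (\<lambda>\<omega>. \<phi> (R \<omega>, U \<omega>))" by (simp add: \<phi>_def Ri)
  then have "integrable (distr M (?K1 \<Otimes>\<^sub>M ?K) (\<lambda>\<omega>. (R \<omega>, U \<omega>))) \<phi>"
    by (subst integrable_distr_eq) measurable
  then have int2: "integrable (distr M ?K1 R \<Otimes>\<^sub>M distr M ?K U) \<phi>" unfolding eq .
  have inner: "(\<integral>a. \<phi> (a, u) \<partial>distr M ?K1 R) = 0" for u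
  proof -
    have "(\<integral>a. \<phi> (a, u) \<partial>distr M ?K1 R) = (\<integral>\<omega>. err (Y u) (W i \<omega>) \<bullet> B u \<partial>M)"
      unfolding \<phi>_def fst_conv snd_conv by (subst integral_distr) (measurable, simp add: Ri)
    also have "\<dots> = (\<integral>w. err (Y u) w \<bullet> B u \<partial>distr M borel (W i))"
      by (subst integral_distr) measurable
    also have "\<dots> = 0" unfolding law[OF i] by (rule err_mean_inner)
    finally show ?thesis .
  qed
  have "(\<integral>\<omega>. err (Y (U \<omega>)) (W i \<omega>) \<bullet> B (U \<omega>) \<partial>M) = (\<integral>p. \<phi> p \<partial>distr M (?K1 \<Otimes>\<^sub>M ?K) (\<lambda>\<omega>. (R \<omega>, U \<omega>)))"
    by (subst integral_distr) (measurable, simp add: \<phi>_def Ri)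
  also have "\<dots> = (\<integral>u. (\<integral>a. \<phi> (a, u) \<partial>distr M ?K1 R) \<partial>distr M ?K U)"
    unfolding eq using RU.integral_snd[of "\<lambda>a u. \<phi> (a, u)"] int2 by simp
  also have "\<dots> = 0"
    by (simp add: inner)
  finally show "(\<integral>\<omega>. err (Y (U \<omega>)) (W i \<omega>) \<bullet> B (U \<omega>) \<partial>M) = 0" .
qed

text \<open>The form used below: \<open>b\<close> may be any square integrable vector computed from
  the other samples, in particular another error of the same batch or the exact step.\<close>

lemma
  assumes j: "j \<in> {1..N k}" and B: "B \<in> borel_measurable (PiM (idx - {(k, j)}) (\<lambda>_. borel))"
    and b: "\<And>\<omega>. B (restrict (\<lambda>i. W i \<omega>) (idx - {(k, j)})) = b \<omega>"
    and sq: "integrable M (\<lambda>\<omega>. (norm (b \<omega>))\<^sup>2)"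
  shows err_xs_inner_integrable: "integrable M (\<lambda>\<omega>. err (xs k \<omega>) (W (k, j) \<omega>) \<bullet> b \<omega>)"
    and err_xs_inner_mean_0: "(\<integral>\<omega>. err (xs k \<omega>) (W (k, j) \<omega>) \<bullet> b \<omega> \<partial>M) = 0"
proof -
  have i: "(k, j) \<in> idx" using j by simp
  have Y: "iter k \<in> borel_measurable (PiM (idx - {(k, j)}) (\<lambda>_. borel))"
    by (rule iter_measurable) (auto intro: measurable_component_singleton)
  have xs: "iter k (restrict (\<lambda>i. W i \<omega>) (idx - {(k, j)})) = xs k \<omega>" for \<omega>
    unfolding xs_def by (rule iter_cong) auto
  note * = err_inner_integrable[OF i Y B] err_inner_mean_0[OF i Y B]
  show "integrable M (\<lambda>\<omega>. err (xs k \<omega>) (W (k, j) \<omega>) \<bullet> b \<omega>)"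
    "(\<integral>\<omega>. err (xs k \<omega>) (W (k, j) \<omega>) \<bullet> b \<omega> \<partial>M) = 0"
    using *[unfolded b xs, OF sq] by auto
qed

definition xerr :: "nat \<Rightarrow> nat \<Rightarrow> 'w \<Rightarrow> 'a" where "xerr k j \<omega> = err (xs k \<omega>) (W (k, j) \<omega>)"

lemma xerr_measurable: "j \<in> {1..N k} \<Longrightarrow> xerr k j \<in> borel_measurable M"
  unfolding xerr_def[abs_def] using W_measurable[of "(k, j)"] by (intro err_measurable) auto

lemma noise_eq: "noise k \<omega> = (1 / real (N k)) *\<^sub>R (\<Sum>j=1..N k. xerr k j \<omega>)"
proof -
  have "(\<Sum>j=1..N k. xerr k j \<omega>) = (\<Sum>j=1..N k. est (xs k \<omega>) (W (k, j) \<omega>)) - real (N k) *\<^sub>R G (xs k \<omega>)"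
    unfolding xerr_def err_def by (simp add: sum_subtractf scaleR_conv_of_real sum_constant_scaleR)
  then show ?thesis
    using N[of k] by (simp add: noise_def scaleR_diff_right)
qed

lemma noise_measurable [measurable]: "noise k \<in> borel_measurable M"
  unfolding noise_eq[abs_def] using xerr_measurable
  by (intro borel_measurable_scaleR borel_measurable_sum) auto

lemma
  assumes j: "j \<in> {1..N k}"
  shows xerr_sq_integrable: "integrable M (\<lambda>\<omega>. (norm (xerr k j \<omega>))\<^sup>2)"
    and xerr_sq_integral_le: "(\<integral>\<omega>. (norm (xerr k j \<omega>))\<^sup>2 \<partial>M) \<le> err_var"
proof -
  have i: "(k, j) \<in> idx" using j by simp
  have le: "(norm (xerr k j \<omega>))\<^sup>2 \<le> (err_bound (W (k, j) \<omega>))\<^sup>2" for \<omega>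
    unfolding xerr_def by (intro power_mono norm_err_le) auto
  show int: "integrable M (\<lambda>\<omega>. (norm (xerr k j \<omega>))\<^sup>2)"
    using le xerr_measurable[OF j] by (intro Bochner_Integration.integrable_bound[OF err_bound_W_integrable[OF i]]) auto
  show "(\<integral>\<omega>. (norm (xerr k j \<omega>))\<^sup>2 \<partial>M) \<le> err_var"
    unfolding err_bound_W_integral[OF i, symmetric] by (intro integral_mono int err_bound_W_integrable[OF i] le)
qed

text \<open>The iterate \<open>xs k\<close> uses earlier batches only, so the error of another
  sample \<open>j'\<close> of batch \<open>k\<close> is a function of the samples other than
  \<open>(k, j)\<close>.\<close>

lemma
  assumes j: "j \<in> {1..N k}" and j': "j' \<in> {1..N k}"
  shows xerr_inner_integrable: "integrable M (\<lambda>\<omega>. xerr k j \<omega> \<bullet> xerr k j' \<omega>)"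
    and xerr_uncorrelated: "j \<noteq> j' \<Longrightarrow> (\<integral>\<omega>. xerr k j \<omega> \<bullet> xerr k j' \<omega> \<partial>M) = 0"
proof -
  show "integrable M (\<lambda>\<omega>. xerr k j \<omega> \<bullet> xerr k j' \<omega>)"
  proof (rule Bochner_Integration.integrable_bound)
    show "integrable M (\<lambda>\<omega>. (norm (xerr k j \<omega>))\<^sup>2 + (norm (xerr k j' \<omega>))\<^sup>2)"
      using xerr_sq_integrable[OF j] xerr_sq_integrable[OF j'] by (rule Bochner_Integration.integrable_add)
    show "(\<lambda>\<omega>. xerr k j \<omega> \<bullet> xerr k j' \<omega>) \<in> borel_measurable M"
      using xerr_measurable[OF j] xerr_measurable[OF j'] by measurable
    show "AE \<omega> in M. norm (xerr k j \<omega> \<bullet> xerr k j' \<omega>) \<le> norm ((norm (xerr k j \<omega>))\<^sup>2 + (norm (xerr k j' \<omega>))\<^sup>2)"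
      using inner_le_sum_squares[OF order_refl] by (intro AE_I2) auto
  qed
  assume ne: "j \<noteq> j'"
  let ?K = "PiM (idx - {(k, j)}) (\<lambda>_. borel :: ('d \<times> 'a) measure)"
  have it: "iter k \<in> borel_measurable ?K"
    by (rule iter_measurable) (auto intro: measurable_component_singleton)
  have "(\<lambda>s. s (k, j')) \<in> borel_measurable ?K"
    using ne j' by (intro measurable_component_singleton) auto
  with it have B: "(\<lambda>s. err (iter k s) (s (k, j'))) \<in> borel_measurable ?K"
    by (rule err_measurable)
  have b: "err (iter k (restrict (\<lambda>i. W i \<omega>) (idx - {(k, j)}))) (restrict (\<lambda>i. W i \<omega>) (idx - {(k, j)}) (k, j')) = xerr k j' \<omega>" for \<omega>
  proof -
    have "iter k (restrict (\<lambda>i. W i \<omega>) (idx - {(k, j)})) = xs k \<omega>"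
      unfolding xs_def by (rule iter_cong) auto
    then show ?thesis unfolding xerr_def using ne j' by simp
  qed
  show "(\<integral>\<omega>. xerr k j \<omega> \<bullet> xerr k j' \<omega> \<partial>M) = 0"
    using err_xs_inner_mean_0[OF j B b xerr_sq_integrable[OF j']] by (simp add: xerr_def)
qed

lemma noise_sq_expand: "(norm (noise k \<omega>))\<^sup>2 = (1 / real (N k))\<^sup>2 * (\<Sum>j=1..N k. \<Sum>j'=1..N k. xerr k j \<omega> \<bullet> xerr k j' \<omega>)"
proof -
  let ?S = "\<Sum>j=1..N k. xerr k j \<omega>"
  have "?S \<bullet> ?S = (\<Sum>j=1..N k. \<Sum>j'=1..N k. xerr k j \<omega> \<bullet> xerr k j' \<omega>)"
    by (subst inner_sum_left, subst inner_sum_right, rule refl)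
  then show ?thesis
    unfolding power2_norm_eq_inner noise_eq inner_scaleR_left inner_scaleR_right by (simp add: power2_eq_square)
qed

lemma noise_sq_integrable: "integrable M (\<lambda>\<omega>. (norm (noise k \<omega>))\<^sup>2)"
  unfolding noise_sq_expand
  by (intro integrable_mult_right Bochner_Integration.integrable_sum xerr_inner_integrable)

text \<open>Mixed terms vanish in mean, leaving \<open>N k\<close> diagonal terms against the factor
  \<open>1 / (N k)^2\<close>.\<close>

lemma noise_sq_integral_le: "(\<integral>\<omega>. (norm (noise k \<omega>))\<^sup>2 \<partial>M) \<le> err_var / real (N k)"
proof -
  have n: "real (N k) > 0" using N[of k] by simp
  have "(\<integral>\<omega>. (norm (noise k \<omega>))\<^sup>2 \<partial>M) = (1 / real (N k))\<^sup>2 * (\<Sum>j=1..N k. \<Sum>j'=1..N k. \<integral>\<omega>. xerr k j \<omega> \<bullet> xerr k j' \<omega> \<partial>M)"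
  proof -
    have "(\<integral>\<omega>. (\<Sum>j=1..N k. \<Sum>j'=1..N k. xerr k j \<omega> \<bullet> xerr k j' \<omega>) \<partial>M) =
        (\<Sum>j=1..N k. \<integral>\<omega>. (\<Sum>j'=1..N k. xerr k j \<omega> \<bullet> xerr k j' \<omega>) \<partial>M)"
      by (intro Bochner_Integration.integral_sum Bochner_Integration.integrable_sum xerr_inner_integrable)
    also have "\<dots> = (\<Sum>j=1..N k. \<Sum>j'=1..N k. \<integral>\<omega>. xerr k j \<omega> \<bullet> xerr k j' \<omega> \<partial>M)"
      by (intro sum.cong refl Bochner_Integration.integral_sum xerr_inner_integrable)
    finally show ?thesis
      unfolding noise_sq_expand integral_mult_right_zero by simp
  qed
  also have "(\<Sum>j=1..N k. \<Sum>j'=1..N k. \<integral>\<omega>. xerr k j \<omega> \<bullet> xerr k j' \<omega> \<partial>M) =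
      (\<Sum>j=1..N k. \<Sum>j'=1..N k. if j' = j then (\<integral>\<omega>. (norm (xerr k j \<omega>))\<^sup>2 \<partial>M) else 0)"
    by (intro sum.cong refl) (simp add: xerr_uncorrelated power2_norm_eq_inner)
  also have "\<dots> = (\<Sum>j=1..N k. \<integral>\<omega>. (norm (xerr k j \<omega>))\<^sup>2 \<partial>M)"
    by (intro sum.cong refl) simp
  also have "\<dots> \<le> (\<Sum>j=1..N k. err_var)"
    by (intro sum_mono xerr_sq_integral_le)
  finally have "(\<integral>\<omega>. (norm (noise k \<omega>))\<^sup>2 \<partial>M) \<le> (1 / real (N k))\<^sup>2 * (\<Sum>j=1..N k. err_var)"
    by (simp add: mult_left_mono)
  then show ?thesis using n by (simp add: power2_eq_square)
qed

section \<open>Descent in expectation\<close>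

definition exact_step :: "nat \<Rightarrow> 'w \<Rightarrow> 'a" where
  "exact_step k \<omega> = proj (xs k \<omega> - \<gamma> k *\<^sub>R G (xs k \<omega>)) - xs k \<omega>"

lemma norm_exact_step_le: "norm (exact_step k \<omega>) \<le> \<gamma> k * Lc"
proof -
  have "norm (proj (xs k \<omega> - \<gamma> k *\<^sub>R G (xs k \<omega>)) - proj (xs k \<omega>)) \<le> \<gamma> k * norm (G (xs k \<omega>))"
    using proj_lipschitz[of "xs k \<omega> - \<gamma> k *\<^sub>R G (xs k \<omega>)" "xs k \<omega>"] \<gamma>[of k] by simp
  also have "\<dots> \<le> \<gamma> k * Lc" using \<gamma>[of k] norm_G_le by (intro mult_left_mono) auto
  finally show ?thesis by (simp add: exact_step_def proj_self[OF xs_in])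
qed

text \<open>The exact step is determined by earlier batches and is bounded, so each single error has
  mean inner product 0 with it.\<close>

lemma
  shows noise_exact_step_integrable: "integrable M (\<lambda>\<omega>. noise k \<omega> \<bullet> exact_step k \<omega>)"
    and noise_exact_step_mean_0: "(\<integral>\<omega>. noise k \<omega> \<bullet> exact_step k \<omega> \<partial>M) = 0"
proof -
  have [measurable]: "exact_step k \<in> borel_measurable M"
    unfolding exact_step_def[abs_def] by measurable
  have sq: "integrable M (\<lambda>\<omega>. (norm (exact_step k \<omega>))\<^sup>2)"
    using norm_exact_step_le[of k] by (intro integrable_const_bound[where B="(\<gamma> k * Lc)\<^sup>2"]) (auto intro!: power_mono)
  have *: "integrable M (\<lambda>\<omega>. xerr k j \<omega> \<bullet> exact_step k \<omega>)" "(\<integral>\<omega>. xerr k j \<omega> \<bullet> exact_step k \<omega> \<partial>M) = 0"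
    if j: "j \<in> {1..N k}" for j
  proof -
    let ?K = "PiM (idx - {(k, j)}) (\<lambda>_. borel :: ('d \<times> 'a) measure)"
    have [measurable]: "iter k \<in> borel_measurable ?K"
      by (rule iter_measurable) (auto intro: measurable_component_singleton)
    have B: "(\<lambda>s. proj (iter k s - \<gamma> k *\<^sub>R G (iter k s)) - iter k s) \<in> borel_measurable ?K"
      by measurable
    have "iter k (restrict (\<lambda>i. W i \<omega>) (idx - {(k, j)})) = xs k \<omega>" for \<omega>
      unfolding xs_def by (rule iter_cong) auto
    then have b: "proj (iter k (restrict (\<lambda>i. W i \<omega>) (idx - {(k, j)})) - \<gamma> k *\<^sub>R G (iter k (restrict (\<lambda>i. W i \<omega>) (idx - {(k, j)})))) -
        iter k (restrict (\<lambda>i. W i \<omega>) (idx - {(k, j)})) = exact_step k \<omega>" for \<omega>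
      unfolding exact_step_def by simp
    show "integrable M (\<lambda>\<omega>. xerr k j \<omega> \<bullet> exact_step k \<omega>)" "(\<integral>\<omega>. xerr k j \<omega> \<bullet> exact_step k \<omega> \<partial>M) = 0"
      using err_xs_inner_integrable[OF j B b sq] err_xs_inner_mean_0[OF j B b sq] by (simp_all add: xerr_def)
  qed
  have eq: "noise k \<omega> \<bullet> exact_step k \<omega> = (1 / real (N k)) * (\<Sum>j=1..N k. xerr k j \<omega> \<bullet> exact_step k \<omega>)" for \<omega>
    unfolding noise_eq by (simp add: inner_sum_left)
  show "integrable M (\<lambda>\<omega>. noise k \<omega> \<bullet> exact_step k \<omega>)"
    unfolding eq using * by (intro integrable_mult_right Bochner_Integration.integrable_sum) auto
  show "(\<integral>\<omega>. noise k \<omega> \<bullet> exact_step k \<omega> \<partial>M) = 0"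
    unfolding eq using * by (simp add: Bochner_Integration.integral_sum)
qed

lemma step_sq_le: "(norm (xs (Suc k) \<omega> - xs k \<omega>))\<^sup>2 \<le> (\<gamma> k)\<^sup>2 * (2 * Lc\<^sup>2 + 2 * (norm (noise k \<omega>))\<^sup>2)"
proof -
  have "norm (xs (Suc k) \<omega> - xs k \<omega>) = norm (proj (xs k \<omega> - \<gamma> k *\<^sub>R (G (xs k \<omega>) + noise k \<omega>)) - proj (xs k \<omega>))"
    by (simp add: xs_Suc proj_self[OF xs_in])
  also have "\<dots> \<le> \<gamma> k * norm (G (xs k \<omega>) + noise k \<omega>)"
    using proj_lipschitz[of "xs k \<omega> - \<gamma> k *\<^sub>R (G (xs k \<omega>) + noise k \<omega>)" "xs k \<omega>"] \<gamma>[of k] by simp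
  also have "\<dots> \<le> \<gamma> k * (Lc + norm (noise k \<omega>))"
    using \<gamma>[of k] norm_triangle_ineq[of "G (xs k \<omega>)" "noise k \<omega>"] norm_G_le[of "xs k \<omega>"] by (intro mult_left_mono) linarith+
  finally have "(norm (xs (Suc k) \<omega> - xs k \<omega>))\<^sup>2 \<le> (\<gamma> k * (Lc + norm (noise k \<omega>)))\<^sup>2"
    by (intro power_mono) auto
  also have "\<dots> = (\<gamma> k)\<^sup>2 * (Lc + norm (noise k \<omega>))\<^sup>2" by (simp add: power_mult_distrib)
  also have "\<dots> \<le> (\<gamma> k)\<^sup>2 * (2 * Lc\<^sup>2 + 2 * (norm (noise k \<omega>))\<^sup>2)"
    using zero_le_power2[of "Lc - norm (noise k \<omega>)"] by (intro mult_left_mono) (auto simp: power2_eq_square algebra_simps)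
  finally show ?thesis .
qed

lemma step_sq_integrable: "integrable M (\<lambda>\<omega>. (norm (xs (Suc k) \<omega> - xs k \<omega>))\<^sup>2)"
proof (rule Bochner_Integration.integrable_bound)
  show "integrable M (\<lambda>\<omega>. (\<gamma> k)\<^sup>2 * (2 * Lc\<^sup>2 + 2 * (norm (noise k \<omega>))\<^sup>2))"
    using noise_sq_integrable by (intro integrable_mult_right Bochner_Integration.integrable_add) auto
  show "AE \<omega> in M. norm ((norm (xs (Suc k) \<omega> - xs k \<omega>))\<^sup>2) \<le> norm ((\<gamma> k)\<^sup>2 * (2 * Lc\<^sup>2 + 2 * (norm (noise k \<omega>))\<^sup>2))"
    using step_sq_le by (intro AE_I2) (simp only: real_norm_def abs_of_nonneg zero_le_power2, meson abs_ge_self order_trans)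
qed measurable

abbreviation smooth :: "'a \<Rightarrow> real" where "smooth \<equiv> smoothing \<eta> obj"
definition smooth_const :: real where "smooth_const = sqrt DIM('a) * Lc / \<eta>"

lemma smooth_expansion: "\<bar>smooth (y + a) - smooth y - G y \<bullet> a\<bar> \<le> smooth_const * (norm a)\<^sup>2"
  unfolding smooth_const_def using obj_lipschitz \<eta> by (rule smoothing_expansion)

lemma smooth_lipschitz: "\<bar>smooth y - smooth y'\<bar> \<le> Lc * norm (y - y')"
proof -
  have "smooth y - smooth y' \<le> Lc * norm (y - y')" for y y'
  proof (rule smoothing_diff_le[OF obj_lipschitz])
    fix u :: 'a
    show "obj (y + \<eta> *\<^sub>R u) - obj (y' + \<eta> *\<^sub>R u) \<le> Lc * norm (y - y')"
      using lipschitz_UNIV_bound[OF obj_lipschitz, of "y + \<eta> *\<^sub>R u" "y' + \<eta> *\<^sub>R u"] by simp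
  qed
  from this[of y y'] this[of y' y] show ?thesis by (simp add: norm_minus_commute)
qed

lemma smooth_measurable [measurable]: "smooth \<in> borel_measurable borel"
proof (intro lipschitz_borel_measurable lipschitz_onI)
  show "dist (smooth y) (smooth y') \<le> Lc * dist y y'" for y y'
    using smooth_lipschitz by (simp add: dist_norm)
qed (rule Lc_nonneg)

text \<open>The starting point is deterministic, and a Lipschitz increment is dominated by an
  integrable function through \<open>d \<le> 1 + d^2\<close>.\<close>

lemma smooth_xs_integrable: "integrable M (\<lambda>\<omega>. smooth (xs k \<omega>))"
proof (induction k)
  case 0
  then show ?case by (simp add: xs_def)
next
  case (Suc k)
  have "integrable M (\<lambda>\<omega>. smooth (xs (Suc k) \<omega>) - smooth (xs k \<omega>))"
  proof (rule Bochner_Integration.integrable_bound)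
    show "integrable M (\<lambda>\<omega>. Lc * (1 + (norm (xs (Suc k) \<omega> - xs k \<omega>))\<^sup>2))"
      using step_sq_integrable by (intro integrable_mult_right Bochner_Integration.integrable_add) auto
    show "AE \<omega> in M. norm (smooth (xs (Suc k) \<omega>) - smooth (xs k \<omega>)) \<le> norm (Lc * (1 + (norm (xs (Suc k) \<omega> - xs k \<omega>))\<^sup>2))"
    proof (rule AE_I2)
      fix \<omega>
      let ?d = "norm (xs (Suc k) \<omega> - xs k \<omega>)"
      have "2 * ?d \<le> 1 + ?d\<^sup>2"
        using zero_le_power2[of "?d - 1"] by (simp add: power2_eq_square algebra_simps)
      then have "?d \<le> 1 + ?d\<^sup>2" using norm_ge_zero[of "xs (Suc k) \<omega> - xs k \<omega>"] by linarith
      then have "Lc * ?d \<le> Lc * (1 + ?d\<^sup>2)" using Lc_nonneg by (rule mult_left_mono)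
      then show "norm (smooth (xs (Suc k) \<omega>) - smooth (xs k \<omega>)) \<le> norm (Lc * (1 + ?d\<^sup>2))"
        using smooth_lipschitz[of "xs (Suc k) \<omega>" "xs k \<omega>"] unfolding real_norm_def by linarith
    qed
  qed measurable
  from Bochner_Integration.integrable_add[OF this Suc.IH] show ?case by simp
qed

lemma expected_descent:
  "(\<integral>\<omega>. smooth (xs (Suc k) \<omega>) \<partial>M) \<le> (\<integral>\<omega>. smooth (xs k \<omega>) \<partial>M)
    - (1 / \<gamma> k - smooth_const) * (\<integral>\<omega>. (norm (xs (Suc k) \<omega> - xs k \<omega>))\<^sup>2 \<partial>M) + \<gamma> k * (\<integral>\<omega>. (norm (noise k \<omega>))\<^sup>2 \<partial>M)"
proof -
  have "(\<integral>\<omega>. smooth (xs (Suc k) \<omega>) \<partial>M) \<le> (\<integral>\<omega>. smooth (xs k \<omega>)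
    - (1 / \<gamma> k - smooth_const) * (norm (xs (Suc k) \<omega> - xs k \<omega>))\<^sup>2 - noise k \<omega> \<bullet> exact_step k \<omega> + \<gamma> k * (norm (noise k \<omega>))\<^sup>2 \<partial>M)"
  proof (rule integral_mono)
    show "smooth (xs (Suc k) \<omega>) \<le> smooth (xs k \<omega>) - (1 / \<gamma> k - smooth_const) * (norm (xs (Suc k) \<omega> - xs k \<omega>))\<^sup>2
        - noise k \<omega> \<bullet> exact_step k \<omega> + \<gamma> k * (norm (noise k \<omega>))\<^sup>2" for \<omega>
      unfolding xs_Suc exact_step_def by (rule proj_step_descent[OF xs_in \<gamma> smooth_expansion])
  qed (intro Bochner_Integration.integrable_add Bochner_Integration.integrable_diff integrable_mult_right
      smooth_xs_integrable step_sq_integrable noise_exact_step_integrable noise_sq_integrable)+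
  then show ?thesis
    by (simp add: smooth_xs_integrable step_sq_integrable noise_exact_step_integrable noise_sq_integrable noise_exact_step_mean_0)
qed

text \<open>The objective is bounded below on \<open>X\<close> only, while the smoothing averages
  values off \<open>X\<close>; Lipschitz continuity limits the loss to
  \<open>Lc * \<eta>\<close>.\<close>

lemma smooth_lower_bound:
  assumes "\<And>y. y \<in> X \<Longrightarrow> m \<le> obj y"
  shows "m - Lc * \<eta> \<le> (\<integral>\<omega>. smooth (xs k \<omega>) \<partial>M)"
proof -
  have "m - Lc * \<eta> \<le> smooth (xs k \<omega>)" for \<omega>
    using assms[OF xs_in[of k \<omega>]] smoothing_dist_le[OF obj_lipschitz less_imp_le[OF \<eta>], of "xs k \<omega>"] by linarith
  then show ?thesis
    using smooth_xs_integrable by (intro integral_ge_const) auto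
qed

text \<open>The parameter \<open>\<kappa>\<close> unifies the two stepsize rules:
  \<open>1 - c * smooth_const\<close> from the start for a constant step \<open>c\<close>, and
  \<open>1 / 2\<close> from a late index on for diminishing steps.\<close>

lemma summable_steps:
  assumes low: "\<And>y. y \<in> X \<Longrightarrow> m \<le> obj y" and sN: "summable (\<lambda>k. \<gamma> k / real (N k))"
    and \<kappa>: "\<kappa> > 0" "\<And>k. k \<ge> K \<Longrightarrow> \<kappa> / \<gamma> k \<le> 1 / \<gamma> k - smooth_const"
  shows "AE \<omega> in M. summable (\<lambda>k. (norm (xs (Suc k) \<omega> - xs k \<omega>))\<^sup>2 / \<gamma> k) \<and> summable (\<lambda>k. \<gamma> k * (norm (noise k \<omega>))\<^sup>2)"
proof -
  let ?D = "\<lambda>k. \<integral>\<omega>. (norm (xs (Suc k) \<omega> - xs k \<omega>))\<^sup>2 \<partial>M"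
  let ?V = "\<lambda>k. \<integral>\<omega>. (norm (noise k \<omega>))\<^sup>2 \<partial>M"
  have sV: "summable (\<lambda>k. \<gamma> k * ?V k)"
  proof (rule summable_comparison_test, intro exI allI impI)
    fix k :: nat
    have "\<gamma> k * ?V k \<le> \<gamma> k * (err_var / real (N k))"
      using \<gamma>[of k] noise_sq_integral_le by (intro mult_left_mono) auto
    then show "norm (\<gamma> k * ?V k) \<le> err_var * (\<gamma> k / real (N k))"
      using \<gamma>[of k] by (simp add: abs_mult mult_ac)
  qed (intro summable_mult sN)
  have sD: "summable (\<lambda>k. \<kappa> * (?D k / \<gamma> k))"
  proof (rule summable_descent[OF _ smooth_lower_bound[OF low] _ _ sV, where K=K])
    fix k assume k: "k \<ge> K"
    have "\<kappa> / \<gamma> k * ?D k \<le> (1 / \<gamma> k - smooth_const) * ?D k"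
      using \<kappa>(2)[OF k] by (intro mult_right_mono) auto
    then show "(\<integral>\<omega>. smooth (xs (Suc k) \<omega>) \<partial>M) \<le> (\<integral>\<omega>. smooth (xs k \<omega>) \<partial>M) - \<kappa> * (?D k / \<gamma> k) + \<gamma> k * ?V k"
      using expected_descent[of k] by simp
    show "0 \<le> \<kappa> * (?D k / \<gamma> k)" using \<kappa> \<gamma>[of k] by simp
  next
    show "0 \<le> \<gamma> k * ?V k" for k
      by (intro mult_nonneg_nonneg less_imp_le[OF \<gamma>] Bochner_Integration.integral_nonneg) simp
  qed
  then have "summable (\<lambda>k. ?D k / \<gamma> k)"
    using summable_mult_D[OF sD] \<kappa>(1) by simp
  then have "AE \<omega> in M. summable (\<lambda>k. (norm (xs (Suc k) \<omega> - xs k \<omega>))\<^sup>2 / \<gamma> k)"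
    using step_sq_integrable \<gamma> by (intro AE_summable_of_summable_integral) (auto simp: less_imp_le)
  moreover have "AE \<omega> in M. summable (\<lambda>k. \<gamma> k * (norm (noise k \<omega>))\<^sup>2)"
    using noise_sq_integrable sV \<gamma> by (intro AE_summable_of_summable_integral) (auto simp: less_imp_le)
  ultimately show ?thesis by eventually_elim simp
qed

lemma residual_tendsto_0_const:
  assumes low: "\<And>y. y \<in> X \<Longrightarrow> m \<le> obj y" and sN: "summable (\<lambda>k. \<gamma> k / real (N k))"
    and c: "\<And>k. \<gamma> k = c" "c * smooth_const < 1"
  shows "AE \<omega> in M. (\<lambda>k. step_residual c G (xs k \<omega>)) \<longlonglongrightarrow> 0"
proof -
  have cp: "c > 0" using \<gamma>[of 0] c(1) by simp
  have "(1 - c * smooth_const) / \<gamma> k \<le> 1 / \<gamma> k - smooth_const" for k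
    using cp by (simp add: c(1) diff_divide_distrib)
  then have "AE \<omega> in M. summable (\<lambda>k. (norm (xs (Suc k) \<omega> - xs k \<omega>))\<^sup>2 / \<gamma> k) \<and> summable (\<lambda>k. \<gamma> k * (norm (noise k \<omega>))\<^sup>2)"
    using c(2) by (intro summable_steps[OF low sN, where K=0 and \<kappa>="1 - c * smooth_const"]) auto
  then show ?thesis
  proof eventually_elim
    case (elim \<omega>)
    then have "summable (\<lambda>k. (norm (xs (Suc k) \<omega> - xs k \<omega>))\<^sup>2 / c)" "summable (\<lambda>k. c * (norm (noise k \<omega>))\<^sup>2)"
      unfolding c(1) by blast+
    note * = summable_mult[OF this(1), of c] summable_mult[OF this(2), of "inverse c"]
    have "summable (\<lambda>k. (norm (xs (Suc k) \<omega> - xs k \<omega>))\<^sup>2)" "summable (\<lambda>k. (norm (noise k \<omega>))\<^sup>2)"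
    proof -
      have eq: "c * (a / c) = a" "inverse c * (c * a) = a" for a :: real using cp by simp_all
      show "summable (\<lambda>k. (norm (xs (Suc k) \<omega> - xs k \<omega>))\<^sup>2)" "summable (\<lambda>k. (norm (noise k \<omega>))\<^sup>2)"
        using * unfolding eq by blast+
    qed
    then show ?case
      using xs_Suc[of _ \<omega>] by (intro path_residual_const[OF cp, where w="\<lambda>k. noise k \<omega>"]) (auto simp: c(1))
  qed
qed

lemma residual_tendsto_0_diminishing:
  assumes low: "\<And>y. y \<in> X \<Longrightarrow> m \<le> obj y" and sN: "summable (\<lambda>k. \<gamma> k / real (N k))"
    and lim: "\<gamma> \<longlonglongrightarrow> 0" and s: "summable (\<lambda>k. (\<gamma> k)\<^sup>2)" "\<not> summable \<gamma>"
  shows "AE \<omega> in M. (\<lambda>k. step_residual (\<gamma> 0) G (xs k \<omega>)) \<longlonglongrightarrow> 0"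
proof -
  have "(\<lambda>k. \<gamma> k * smooth_const) \<longlonglongrightarrow> 0 * smooth_const"
    by (intro tendsto_intros lim)
  then have "eventually (\<lambda>k. \<gamma> k * smooth_const < 1 / 2) sequentially"
    by (intro order_tendstoD(2)) auto
  then obtain K where K: "\<And>k. k \<ge> K \<Longrightarrow> \<gamma> k * smooth_const < 1 / 2"
    unfolding eventually_sequentially by blast
  have "(1 / 2) / \<gamma> k \<le> 1 / \<gamma> k - smooth_const" if "k \<ge> K" for k
  proof -
    have "(1 / 2) / \<gamma> k \<le> (1 - \<gamma> k * smooth_const) / \<gamma> k"
      using K[OF that] \<gamma>[of k] by (intro divide_right_mono) auto
    then show ?thesis using \<gamma>[of k] by (simp add: diff_divide_distrib)
  qed
  then have "AE \<omega> in M. summable (\<lambda>k. (norm (xs (Suc k) \<omega> - xs k \<omega>))\<^sup>2 / \<gamma> k) \<and> summable (\<lambda>k. \<gamma> k * (norm (noise k \<omega>))\<^sup>2)"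
    by (intro summable_steps[OF low sN, where K=K and \<kappa>="1 / 2"]) auto
  then show ?thesis
  proof eventually_elim
    case (elim \<omega>)
    have "DIM('a) / \<eta> * Lc \<ge> 0" using \<eta> Lc_nonneg by simp
    from path_residual_diminishing[where x="\<lambda>k. xs k \<omega>" and w="\<lambda>k. noise k \<omega>",
        OF xs_in \<gamma> xs_Suc G_lipschitz norm_G_le this lim s] elim
    show ?case by simp
  qed
qed

end

section \<open>Reduction to a globally Lipschitz integrand\<close>

text \<open>As a Minkowski sum with a compact convex ball, the enlargement inherits closedness and
  convexity.\<close>

lemma enlarge_eq_sum:
  assumes "r \<ge> 0"
  shows "enlarge X r = (\<Union>x\<in>X. \<Union>y\<in>cball 0 r. {x + y})"
proof (intro equalityI subsetI)
  fix z assume "z \<in> enlarge X r"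
  then obtain x u where "z = x + r *\<^sub>R u" "x \<in> X" "norm u \<le> 1" unfolding enlarge_def by blast
  then show "z \<in> (\<Union>x\<in>X. \<Union>y\<in>cball 0 r. {x + y})"
    using assms mult_left_mono[of "norm u" 1 r] by (intro UN_I[of x] UN_I[of "r *\<^sub>R u"]) auto
next
  fix z assume "z \<in> (\<Union>x\<in>X. \<Union>y\<in>cball 0 r. {x + y})"
  then obtain x y where z: "z = x + y" "x \<in> X" "norm y \<le> r" by auto
  show "z \<in> enlarge X r"
  proof (cases "r = 0")
    case True
    then show ?thesis using z unfolding enlarge_def by (auto intro!: exI[of _ 0])
  next
    case False
    then have "z = x + r *\<^sub>R (y /\<^sub>R r)" "norm (y /\<^sub>R r) \<le> 1"
      using z assms by (auto simp: field_simps)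
    then show ?thesis using z(2) unfolding enlarge_def by blast
  qed
qed

lemma mem_enlargeI:
  assumes "x \<in> X" "norm u \<le> r"
  shows "x + u \<in> enlarge X r"
proof -
  have "r \<ge> 0" using assms(2) norm_ge_zero order_trans by blast
  then show ?thesis
    unfolding enlarge_eq_sum[OF \<open>r \<ge> 0\<close>] using assms by (intro UN_I[of x] UN_I[of u]) auto
qed

lemma closed_enlarge:
  fixes X :: "'a::euclidean_space set"
  shows "closed X \<Longrightarrow> r \<ge> 0 \<Longrightarrow> closed (enlarge X r)"
  unfolding enlarge_eq_sum by (rule closed_compact_sums) auto

lemma convex_enlarge:
  fixes X :: "'a::euclidean_space set"
  shows "convex X \<Longrightarrow> r \<ge> 0 \<Longrightarrow> convex (enlarge X r)"
  unfolding enlarge_eq_sum by (rule convex_sums) auto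

text \<open>A Lipschitz function is a countable infimum of cones.\<close>

lemma lipschitz_measurable_pair:
  fixes h :: "'a::euclidean_space \<Rightarrow> 'd::euclidean_space \<Rightarrow> real"
  assumes h: "\<And>y. h y \<in> borel_measurable borel" and lip: "lip \<in> borel_measurable borel"
    and h_lip: "\<And>y y' z. \<bar>h y z - h y' z\<bar> \<le> lip z * norm (y - y')"
  shows "(\<lambda>p. h (fst p) (snd p)) \<in> borel_measurable borel"
proof -
  obtain D :: "'a set" where D: "countable D" "\<And>S. open S \<Longrightarrow> S \<noteq> {} \<Longrightarrow> \<exists>d\<in>D. d \<in> S"
    by (rule countable_dense_setE) blast
  have ne: "D \<noteq> {}" using D(2)[of UNIV] by auto
  have le: "h y z \<le> h q z + lip z * norm (y - q)" for y q z
    using h_lip[of y z q] by linarith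
  have eq: "h y z = (INF q\<in>D. h q z + lip z * norm (y - q))" for y z
  proof (rule antisym)
    show "h y z \<le> (INF q\<in>D. h q z + lip z * norm (y - q))"
      using ne le by (intro cINF_greatest)
    have bdd: "bdd_below ((\<lambda>q. h q z + lip z * norm (y - q)) ` D)"
      using le by (intro bdd_belowI2[where m="h y z"])
    show "(INF q\<in>D. h q z + lip z * norm (y - q)) \<le> h y z"
    proof (rule field_le_epsilon)
      fix e :: real assume e: "e > 0"
      have "\<exists>d\<in>D. d \<in> ball y (e / (2 * (\<bar>lip z\<bar> + 1)))"
      proof (rule D(2))
        \<comment> \<open>The summand 1 keeps this radius positive when \<open>lip z = 0\<close>,
          since division by 0 yields 0.\<close>
        have "e / (2 * (\<bar>lip z\<bar> + 1)) > 0" using e by (intro divide_pos_pos) auto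
        then show "ball y (e / (2 * (\<bar>lip z\<bar> + 1))) \<noteq> {}" unfolding ball_eq_empty by linarith
      qed simp
      then obtain d where d: "d \<in> D" "norm (y - d) < e / (2 * (\<bar>lip z\<bar> + 1))"
        by (auto simp: dist_norm)
      have "(\<bar>lip z\<bar> + 1) * norm (y - d) \<le> (\<bar>lip z\<bar> + 1) * (e / (2 * (\<bar>lip z\<bar> + 1)))"
        using d by (intro mult_left_mono) auto
      also have "\<dots> = e / 2" by (simp add: field_simps)
      finally have "\<bar>lip z\<bar> * norm (y - d) \<le> e / 2"
        unfolding distrib_right using norm_ge_zero[of "y - d"] by linarith
      moreover have "lip z * norm (y - d) \<le> \<bar>lip z\<bar> * norm (y - d)" by (intro mult_right_mono) auto
      ultimately have "lip z * norm (y - d) \<le> e / 2" by linarith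
      moreover have "(INF q\<in>D. h q z + lip z * norm (y - q)) \<le> h d z + lip z * norm (y - d)"
        using bdd d(1) by (rule cINF_lower)
      moreover have "h d z \<le> h y z + lip z * norm (y - d)"
        using le[of d z y] by (simp add: norm_minus_commute)
      ultimately show "(INF q\<in>D. h q z + lip z * norm (y - q)) \<le> h y z + e" by linarith
    qed
  qed
  have [measurable]: "(\<lambda>p. h q (snd p)) \<in> borel_measurable (borel :: ('a \<times> 'd) measure)"
    "(\<lambda>p. lip (snd p)) \<in> borel_measurable (borel :: ('a \<times> 'd) measure)" for q
    using h lip by (auto simp: borel_prod[symmetric] intro: measurable_compose[OF measurable_snd])
  have [measurable]: "fst \<in> borel_measurable (borel :: ('a \<times> 'd) measure)"
    by (simp add: borel_prod[symmetric])
  have "(\<lambda>p. INF q\<in>D. h q (snd p) + lip (snd p) * norm (fst p - q)) \<in> borel_measurable (borel :: ('a \<times> 'd) measure)"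
  proof (rule borel_measurable_cINF[OF D(1)])
    fix p :: "'a \<times> 'd"
    show "bdd_below ((\<lambda>q. h q (snd p) + lip (snd p) * norm (fst p - q)) ` D)"
      using le by (intro bdd_belowI2[where m="h (fst p) (snd p)"])
  qed measurable
  then show ?thesis by (simp flip: eq)
qed

section \<open>Transfer of residuals and stationarity to the given objective\<close>

lemma AE_uniform_sphere:
  assumes "r > 0"
  shows "AE v in (uniform_sphere r :: 'a::euclidean_space measure). norm v = r"
  unfolding uniform_sphere_def
proof (subst AE_distr_iff)
  show "AE u in (unif_ball :: 'a measure). norm (r *\<^sub>R sgn u) = r"
    using AE_unif_ball_norm by eventually_elim (use assms in \<open>simp add: norm_sgn\<close>)
qed measurable

text \<open>Since \<open>grad\<close> is a definite description, existence and uniqueness are both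
  required. The adjoint of the derivative at 1 is its Riesz representative.\<close>

lemma differentiable_GDERIV:
  fixes F :: "'a::euclidean_space \<Rightarrow> real"
  assumes "F differentiable (at x)"
  shows "GDERIV F x :> grad F x"
proof -
  obtain F' where F': "(F has_derivative F') (at x)"
    using assms unfolding differentiable_def by blast
  have "F' = (\<lambda>h. h \<bullet> adjoint F' 1)"
    using adjoint_works[OF has_derivative_linear[OF F'], of _ 1] by (simp add: fun_eq_iff)
  then have D: "GDERIV F x :> adjoint F' 1"
    using F' unfolding gderiv_def by simp
  have "D2 = adjoint F' 1" if "GDERIV F x :> D2" for D2
  proof -
    have "(\<lambda>h. h \<bullet> D2) = (\<lambda>h. h \<bullet> adjoint F' 1)"
      using that D unfolding gderiv_def by (rule has_derivative_unique)
    then have "\<forall>h. h \<bullet> D2 = h \<bullet> adjoint F' 1" by meson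
    then show ?thesis by (simp add: vector_eq_ldot)
  qed
  with D show ?thesis
    unfolding grad_def by (rule theI)
qed

context closed_convex
begin

text \<open>
  Derivatives of functions agreeing on the feasible set may differ off its affine hull, but
  this difference is invisible to the projection.
\<close>

lemma residual_eq_step_residual:
  fixes F H :: "'a \<Rightarrow> real"
  assumes x: "x \<in> X" and FH: "\<And>y. y \<in> X \<Longrightarrow> F y = H y"
    and F: "F differentiable (at x)" and H: "(H has_derivative (\<lambda>a. g x \<bullet> a)) (at x)" and \<gamma>: "\<gamma> > 0"
  shows "norm (residual X F (1 / \<gamma>) x) = step_residual \<gamma> g x"
proof -
  let ?D = "grad F x"
  have D: "(F has_derivative (\<lambda>a. ?D \<bullet> a)) (at x)"
    using differentiable_GDERIV[OF F] unfolding gderiv_def by (simp add: inner_commute)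
  have line: "((\<lambda>t. (K (x + t *\<^sub>R a) - K x) / t) \<longlongrightarrow> d \<bullet> a) (at_right 0)"
    if "(K has_derivative (\<lambda>a. d \<bullet> a)) (at x)" for K :: "'a \<Rightarrow> real" and d a
  proof -
    have "((\<lambda>t. x + t *\<^sub>R a) has_derivative (\<lambda>h. h *\<^sub>R a)) (at 0)"
      by (auto intro!: derivative_eq_intros)
    moreover have "(K has_derivative (\<lambda>a. d \<bullet> a)) (at (x + 0 *\<^sub>R a))" using that by simp
    ultimately have "((\<lambda>t. K (x + t *\<^sub>R a)) has_derivative (\<lambda>h. d \<bullet> (h *\<^sub>R a))) (at 0)"
      by (rule has_derivative_compose)
    then have "((\<lambda>t. K (x + t *\<^sub>R a)) has_field_derivative d \<bullet> a) (at 0)"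
      unfolding has_field_derivative_def by (rule has_derivative_eq_rhs) (auto simp: fun_eq_iff)
    from right_quotient_tendsto[OF this] show ?thesis by simp
  qed
  \<comment> \<open>For \<open>z\<close> in \<open>X\<close> the segment from \<open>x\<close> to
    \<open>z\<close> stays in \<open>X\<close>, so the one-sided quotients of \<open>F\<close> and
    \<open>H\<close> along it agree and the two gradients have the same inner product with
    \<open>z - x\<close>.\<close>
  have orth: "(g x - ?D) \<bullet> (z - x) = 0" if z: "z \<in> X" for z
  proof -
    have "eventually (\<lambda>t. 0 < t \<and> t < (1::real)) (at_right 0)"
      by (auto simp: eventually_at_right_field intro!: exI[of _ 1])
    then have "eventually (\<lambda>t. (F (x + t *\<^sub>R (z - x)) - F x) / t = (H (x + t *\<^sub>R (z - x)) - H x) / t) (at_right 0)"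
    proof eventually_elim
      case (elim t)
      have "(1 - t) *\<^sub>R x + t *\<^sub>R z \<in> X" using elim x z by (intro convexD[OF convex]) auto
      then have "x + t *\<^sub>R (z - x) \<in> X" by (simp add: algebra_simps)
      then show ?case using FH x by simp
    qed
    then have "((\<lambda>t. (F (x + t *\<^sub>R (z - x)) - F x) / t) \<longlongrightarrow> g x \<bullet> (z - x)) (at_right 0)"
      using line[OF H, of "z - x"] by (rule tendsto_cong[THEN iffD2])
    then have "?D \<bullet> (z - x) = g x \<bullet> (z - x)"
      using line[OF D] by (intro tendsto_unique[OF trivial_limit_at_right_real])
    then show ?thesis by (simp add: inner_diff_left)
  qed
  have "proj ((x - \<gamma> *\<^sub>R g x) + \<gamma> *\<^sub>R (g x - ?D)) = proj (x - \<gamma> *\<^sub>R g x)"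
    using orth by (intro proj_orthogonal_shift[OF x]) simp
  moreover have "(x - \<gamma> *\<^sub>R g x) + \<gamma> *\<^sub>R (g x - ?D) = x - \<gamma> *\<^sub>R ?D"
    by (simp add: algebra_simps)
  ultimately show ?thesis
    unfolding residual_def step_residual_def using \<gamma> by simp
qed

text \<open>Agreement of \<open>obj\<close> with \<open>f\<close> on the open ball around the limit
  point is enough, because the hull result refers to Clarke gradients at points of that ball, each
  with a neighbourhood inside it.\<close>

lemma limit_point_eta_clarke_stationary:
  fixes f obj :: "'a \<Rightarrow> real"
  assumes L: "L-lipschitz_on UNIV obj" and \<eta>: "\<eta> > 0"
    and eq: "\<And>y z. y \<in> X \<Longrightarrow> z \<in> ball y \<eta> \<Longrightarrow> obj z = f z"
    and x: "\<And>k. x k \<in> X" and \<gamma>: "\<gamma> > 0" and lim: "(\<lambda>k. step_residual \<gamma> (sphere_grad \<eta> obj) (x k)) \<longlonglongrightarrow> 0"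
  shows "seq_limit_points x \<subseteq> eta_clarke_stationary \<eta> X f"
proof
  fix l assume "l \<in> seq_limit_points x"
  from residual_limit_point_normal_cone[OF x \<gamma> sphere_grad_lipschitz[OF L \<eta>] lim this]
  have l: "l \<in> X" "- sphere_grad \<eta> obj l \<in> normal_cone X l" by auto
  have "clarke_grad obj y = clarke_grad f y" if "y \<in> ball l \<eta>" for y
    using that eq[OF l(1)] by (intro clarke_grad_cong_open[of "ball l \<eta>"]) auto
  then have "{\<zeta>. \<exists>y\<in>ball l \<eta>. \<zeta> \<in> clarke_grad obj y} \<subseteq> {\<zeta>. \<exists>y. \<zeta> \<in> clarke_grad f y \<and> norm (l - y) \<le> \<eta>}"
    by (fastforce simp: dist_norm)
  then have "sphere_grad \<eta> obj l \<in> eta_clarke_grad \<eta> f l"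
    unfolding eta_clarke_grad_def using sphere_grad_in_clarke_hull[OF L \<eta>] hull_mono by blast
  moreover have "0 = sphere_grad \<eta> obj l + - sphere_grad \<eta> obj l" by simp
  ultimately show "l \<in> eta_clarke_stationary \<eta> X f"
    unfolding eta_clarke_stationary_def using l by blast
qed

end

section \<open>Batch sizes and assembly\<close>

lemma summable_inverse_batch:
  assumes "\<delta> > 0" "\<And>k. N k = nat \<lceil>(real k + 1) powr (1 + \<delta>)\<rceil>"
  shows "summable (\<lambda>k. c / real (N k))"
proof -
  have "summable (\<lambda>k. real (Suc k) powr - (1 + \<delta>))"
    using summable_Suc_iff[of "\<lambda>k. real k powr - (1 + \<delta>)"] summable_real_powr_iff[of "- (1 + \<delta>)"] assms(1) by simp
  then have "summable (\<lambda>k. \<bar>c\<bar> * real (Suc k) powr - (1 + \<delta>))"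
    by (rule summable_mult)
  then show ?thesis
  proof (rule summable_comparison_test[rotated], intro exI allI impI)
    fix k :: nat
    have pos: "(real k + 1) powr (1 + \<delta>) > 0" by simp
    have le: "(real k + 1) powr (1 + \<delta>) \<le> real (N k)"
      unfolding assms(2) by linarith
    have "norm (c / real (N k)) = \<bar>c\<bar> / real (N k)" by simp
    also have "\<dots> \<le> \<bar>c\<bar> / (real k + 1) powr (1 + \<delta>)"
      using pos le less_le_trans[OF pos le] by (intro divide_left_mono mult_pos_pos) auto
    also have "\<dots> = \<bar>c\<bar> * real (Suc k) powr - (1 + \<delta>)"
      by (subst powr_minus) (simp add: divide_inverse add.commute)
    finally show "norm (c / real (N k)) \<le> \<bar>c\<bar> * real (Suc k) powr - (1 + \<delta>)" .
  qed
qed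

theorem proposition3p6:
  fixes M :: "'w measure"
    and \<xi> :: "'w \<Rightarrow> real^'d::finite"
    and ft :: "real^'n::finite \<Rightarrow> real^'d \<Rightarrow> real"
    and f :: "real^'n \<Rightarrow> real"
    and Lt :: "real^'d \<Rightarrow> real"
    and L0 \<eta> \<eta>0 :: real
    and X :: "(real^'n) set"
    and x0 :: "real^'n"
    and \<gamma> :: "nat \<Rightarrow> real"
    and N :: "nat \<Rightarrow> nat"
    and \<xi>s :: "nat \<Rightarrow> nat \<Rightarrow> 'w \<Rightarrow> real^'d"
    and v :: "nat \<Rightarrow> nat \<Rightarrow> 'w \<Rightarrow> real^'n"
    and x :: "nat \<Rightarrow> 'w \<Rightarrow> real^'n"
  assumes "prob_space M"
    and "\<xi> \<in> borel_measurable M"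
    and "\<And>y. f y = (\<integral>\<omega>. ft y (\<xi> \<omega>) \<partial>M)"
    (* (i) Lipschitz continuity *)
    and "\<eta>0 > 0"
    and "Lt \<in> borel_measurable borel"
    and "AE z in distr M borel \<xi>. (Lt z)-lipschitz_on (enlarge X \<eta>0) (\<lambda>y. ft y z)"
    and "integrable M (\<lambda>\<omega>. (Lt (\<xi> \<omega>))\<^sup>2)"
    and "L0 = sqrt (\<integral>\<omega>. (Lt (\<xi> \<omega>))\<^sup>2 \<partial>M)"
    (* (ii) the feasible set *)
    and "X \<noteq> {}" and "closed X" and "convex X"
    (* (iii) the expectation defining f exists on the enlarged feasible set *)
    and "\<And>y. y \<in> enlarge X \<eta>0 \<Longrightarrow> ft y \<in> borel_measurable borel"
    and "\<And>y. y \<in> enlarge X \<eta>0 \<Longrightarrow> integrable M (\<lambda>\<omega>. ft y (\<xi> \<omega>))"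
    and "0 < \<eta>" and "\<eta> \<le> \<eta>0"
    and "bdd_below (f ` X)"
    (* For \<eta> < \<eta>0 the smoothed function is differentiable on X. If \<eta> = \<eta>0 its values
       off X involve f outside the enlarged set, so that grad is meaningful only if assumed. *)
    and "\<eta> = \<eta>0 \<Longrightarrow> \<forall>y\<in>X. smoothing \<eta> f differentiable (at y)"
    (* the scheme *)
    and "x0 \<in> X"
    and "\<And>k. \<gamma> k > 0"
    and "\<And>k. N k \<ge> 1"
    and "prob_space.indep_samples M (\<lambda>(k, j). \<xi>s k j) (\<lambda>(k, j). v k j) (SIGMA k:UNIV. {1..N k})"
    and "\<And>k j. j \<in> {1..N k} \<Longrightarrow> distr M borel (\<xi>s k j) = distr M borel \<xi>"
    and "\<And>k j. j \<in> {1..N k} \<Longrightarrow> distr M borel (v k j) = uniform_sphere \<eta>"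
    and "\<And>\<omega>. \<omega> \<in> space M \<Longrightarrow> x 0 \<omega> = x0"
    and "\<And>k \<omega>. \<omega> \<in> space M \<Longrightarrow> x (Suc k) \<omega> =
           closest_point X (x k \<omega> -
             \<gamma> k *\<^sub>R zo_grad_batch ft \<eta> (N k) (x k \<omega>) (\<lambda>j. v k j \<omega>) (\<lambda>j. \<xi>s k j \<omega>))"
  shows
    (* In both parts the upper bound on the stepsize reads as infinity when L0 = 0. *)
    "(\<forall>c \<delta>. 0 < c \<and> (L0 \<noteq> 0 \<longrightarrow> c < \<eta> / (sqrt (real CARD('n)) * L0)) \<and> \<delta> > 0 \<and>
        (\<forall>k. \<gamma> k = c) \<and> (\<forall>k. N k = nat \<lceil>(real k + 1) powr (1 + \<delta>)\<rceil>) \<longrightarrow>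
        (AE \<omega> in M. (\<lambda>k. norm (residual X (smoothing \<eta> f) (1 / c) (x k \<omega>))) \<longlonglongrightarrow> 0) \<and>
        (AE \<omega> in M. seq_limit_points (\<lambda>k. x k \<omega>) \<subseteq> eta_clarke_stationary \<eta> X f)) \<and>
     (\<gamma> \<longlonglongrightarrow> 0 \<and> summable (\<lambda>k. (\<gamma> k)\<^sup>2) \<and> \<not> summable \<gamma> \<and>
        (L0 \<noteq> 0 \<longrightarrow> \<gamma> 0 < \<eta> / (2 * sqrt (real CARD('n)) * L0)) \<and>
        summable (\<lambda>k. \<gamma> k / real (N k)) \<longrightarrow>
        (AE \<omega> in M. (\<lambda>k. norm (residual X (smoothing \<eta> f) (1 / \<gamma> 0) (x k \<omega>))) \<longlonglongrightarrow> 0) \<and>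
        (AE \<omega> in M. seq_limit_points (\<lambda>k. x k \<omega>) \<subseteq> eta_clarke_stationary \<eta> X f))"
proof -
  interpret prob_space M by fact
  interpret closed_convex X by unfold_locales fact+
  define P where "P = distr M borel \<xi>"
  define E where "E = enlarge X \<eta>0"
  have mP: "\<phi> \<in> borel_measurable P" if "\<phi> \<in> borel_measurable borel" for \<phi> :: "real^'d \<Rightarrow> real"
    using that by (simp add: P_def)
  note [measurable] = \<open>\<xi> \<in> borel_measurable M\<close> \<open>Lt \<in> borel_measurable borel\<close>
  have P: "prob_space P" unfolding P_def by (rule prob_space_distr) measurable
  have setsP [measurable_cong]: "sets P = sets borel" unfolding P_def by simp
  have \<eta>: "\<eta> > 0" "\<eta> \<le> \<eta>0" "\<eta>0 > 0" by fact+
  have E: "closed E" "convex E" unfolding E_def using \<eta> closed convex by (auto intro: closed_enlarge convex_enlarge)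
  have E_mem: "y + u \<in> E" if "y \<in> X" "norm u \<le> \<eta>" for y u
    unfolding E_def using that \<eta> by (intro mem_enlargeI) auto
  have E_ne: "E \<noteq> {}" using E_mem[OF \<open>x0 \<in> X\<close>, of 0] \<eta> by auto
  have ft_meas: "ft y \<in> borel_measurable borel" and ft_int: "integrable M (\<lambda>\<omega>. ft y (\<xi> \<omega>))" if "y \<in> E" for y
    using assms(12)[of y] assms(13)[of y] that unfolding E_def by auto
  have "AE z in P. (Lt z)-lipschitz_on E (\<lambda>y. ft y z)"
    unfolding P_def E_def by fact
  \<comment> \<open>A measurable null set that contains all bad samples; measurability allows the
    integrand to be redefined on it.\<close>
  then obtain Z where Z: "{z \<in> space P. \<not> (Lt z)-lipschitz_on E (\<lambda>y. ft y z)} \<subseteq> Z" "emeasure P Z = 0" "Z \<in> sets P"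
    by (rule AE_E)
  have [measurable]: "Z \<in> sets borel" using Z(3) by (simp add: setsP)
  have AE_Z: "AE z in P. z \<notin> Z"
    using Z by (intro AE_not_in) (auto simp: null_sets_def)
  have lipZ: "(Lt z)-lipschitz_on E (\<lambda>y. ft y z)" if "z \<notin> Z" for z
    using Z(1) that by (auto simp: P_def)
  \<comment> \<open>Composition with the projection onto \<open>E\<close>, a map that does not
    increase distances, extends the integrand to the whole space with the same Lipschitz constant;
    on \<open>Z\<close> it is set to 0.\<close>
  define h where "h y z = (if z \<in> Z then 0 else ft (closest_point E y) z)" for y z
  define lip where "lip z = (if z \<in> Z then 0 else Lt z)" for z
  have cE: "closest_point E y \<in> E" for y using E(1) E_ne by (rule closest_point_in_set)
  have h_meas: "h y \<in> borel_measurable borel" for y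
    unfolding h_def using ft_meas[OF cE] by measurable
  have lip_meas: "lip \<in> borel_measurable borel"
    unfolding lip_def by measurable
  have lip_nonneg: "lip z \<ge> 0" for z
    unfolding lip_def using lipschitz_on_nonneg[OF lipZ] by auto
  have h_lip: "\<bar>h y z - h y' z\<bar> \<le> lip z * norm (y - y')" for y y' z
  proof (cases "z \<in> Z")
    case False
    have "\<bar>ft (closest_point E y) z - ft (closest_point E y') z\<bar> \<le> Lt z * norm (closest_point E y - closest_point E y')"
      using lipschitz_on_normD[OF lipZ[OF False] cE cE] by simp
    also have "\<dots> \<le> Lt z * norm (y - y')"
      using closest_point_lipschitz[OF E(2,1) E_ne, of y y'] lipschitz_on_nonneg[OF lipZ[OF False]]
      by (intro mult_left_mono) (auto simp: dist_norm)
    finally show ?thesis using False by (simp add: h_def lip_def)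
  qed (simp add: h_def lip_def)
  have lip_AE: "AE z in P. (lip z)\<^sup>2 = (Lt z)\<^sup>2"
    using AE_Z by eventually_elim (simp add: lip_def)
  have "integrable P (\<lambda>z. (Lt z)\<^sup>2)"
    unfolding P_def using \<open>integrable M (\<lambda>\<omega>. (Lt (\<xi> \<omega>))\<^sup>2)\<close> by (subst integrable_distr_eq) measurable
  then have lip_int: "integrable P (\<lambda>z. (lip z)\<^sup>2)"
    using lip_AE lip_meas by (subst integrable_cong_AE) (auto intro!: mP)
  have h_AE: "AE z in P. h y z = ft (closest_point E y) z" for y
    using AE_Z by eventually_elim (simp add: h_def)
  have h_int: "integrable P (h y)" for y
  proof -
    note [measurable] = ft_meas[OF cE[of y]] h_meas[of y]
    have "integrable P (ft (closest_point E y))"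
      unfolding P_def using ft_int[OF cE] by (subst integrable_distr_eq) measurable
    then show ?thesis using h_AE[of y] by (subst integrable_cong_AE) (auto intro!: mP)
  qed
  define W where "W i \<omega> = ((case i of (k, j) \<Rightarrow> \<xi>s k j) \<omega>, (case i of (k, j) \<Rightarrow> v k j) \<omega>)" for i \<omega>
  have ind: "indep_vars (\<lambda>_. borel) W (SIGMA k:UNIV. {1..N k})"
    unfolding W_def[abs_def] by (rule indep_samples_indep_vars) fact
  have law: "distr M borel (W i) = P \<Otimes>\<^sub>M uniform_sphere \<eta>" if i: "i \<in> (SIGMA k:UNIV. {1..N k})" for i
  proof -
    obtain k j where kj: "i = (k, j)" "j \<in> {1..N k}" using i by auto
    have "distr M borel (W i) = distr M borel (\<xi>s k j) \<Otimes>\<^sub>M distr M borel (v k j)"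
      using indep_samples_pair_law[OF assms(21) i] unfolding W_def[abs_def] kj by simp
    also have "\<dots> = P \<Otimes>\<^sub>M uniform_sphere \<eta>"
      using assms(22)[OF kj(2)] assms(23)[OF kj(2)] by (simp add: P_def)
    finally show ?thesis .
  qed
  interpret S: zo_scheme M X h lip P \<eta> x0 \<gamma> N W
  proof (intro zo_scheme.intro zo_scheme_axioms.intro)
    show "prob_space M" "closed_convex X" by unfold_locales
    show "prob_space P" "sets P = sets borel" "0 < \<eta>" "x0 \<in> X" by fact+
    show "(\<lambda>p. h (fst p) (snd p)) \<in> borel_measurable borel"
      using h_meas lip_meas h_lip by (rule lipschitz_measurable_pair)
    show "\<bar>h y z - h y' z\<bar> \<le> lip z * norm (y - y')" for y y' z by (rule h_lip)
    show "lip \<in> borel_measurable borel" "0 \<le> lip z" "integrable P (\<lambda>z. (lip z)\<^sup>2)" for z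
      by (fact lip_meas lip_nonneg lip_int)+
    show "integrable P (h y)" for y by (rule h_int)
    show "0 < \<gamma> k" "1 \<le> N k" for k by fact+
    show "indep_vars (\<lambda>_. borel) W (SIGMA k:UNIV. {1..N k})" by (rule ind)
    show "distr M borel (W i) = P \<Otimes>\<^sub>M uniform_sphere \<eta>" if "i \<in> (SIGMA k:UNIV. {1..N k})" for i
      using that by (rule law)
  qed
  have Lc: "S.Lc = L0"
  proof -
    have "(\<integral>z. (lip z)\<^sup>2 \<partial>P) = (\<integral>z. (Lt z)\<^sup>2 \<partial>P)"
      using lip_AE lip_meas by (intro integral_cong_AE) (auto intro!: mP)
    also have "\<dots> = (\<integral>\<omega>. (Lt (\<xi> \<omega>))\<^sup>2 \<partial>M)"
      unfolding P_def by (subst integral_distr) measurable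
    finally show ?thesis unfolding S.Lc_def using assms(8) by simp
  qed
  have obj: "S.obj y = f y" if y: "y \<in> E" for y
  proof -
    note [measurable] = ft_meas[OF y] h_meas[of y]
    have "S.obj y = (\<integral>z. ft y z \<partial>P)"
      unfolding S.obj_def using h_AE[of y] closest_point_self[OF y] by (intro integral_cong_AE) (auto intro!: mP)
    also have "\<dots> = f y"
      unfolding P_def assms(3) by (subst integral_distr) measurable
    finally show ?thesis .
  qed
  have XE: "y \<in> E" if "y \<in> X" for y using E_mem[OF that, of 0] \<eta> by simp
  obtain m where m: "\<And>y. y \<in> X \<Longrightarrow> m \<le> S.obj y"
    using \<open>bdd_below (f ` X)\<close> obj[OF XE] unfolding bdd_below_def by auto
  \<comment> \<open>Only the values on the ball enter the set integral, so agreement of the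
    objectives on \<open>E\<close> suffices.\<close>
  have smooth: "smoothing \<eta> f y = smoothing \<eta> S.obj y" if "\<And>u. norm u \<le> 1 \<Longrightarrow> y + \<eta> *\<^sub>R u \<in> E" for y
    unfolding smoothing_def using that
    by (intro arg_cong[where f="\<lambda>a. a / _"] set_lebesgue_integral_cong) (auto simp: obj)
  have smooth_X: "smoothing \<eta> f y = smoothing \<eta> S.obj y" if "y \<in> X" for y
    using \<eta> by (intro smooth E_mem that) simp
  have diff: "smoothing \<eta> f differentiable (at y)" if y: "y \<in> X" for y
  proof (cases "\<eta> = \<eta>0")
    case True
    then show ?thesis using assms(17) y by blast
  next
    case False
    \<comment> \<open>The margin \<open>\<eta>0 - \<eta>\<close> gives a neighbourhood of
      \<open>y\<close> whose averaging balls all lie in \<open>E\<close>, so there the smoothing of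
      \<open>f\<close> inherits differentiability.\<close>
    have sm: "smoothing \<eta> f z = smoothing \<eta> S.obj z" if z: "z \<in> ball y (\<eta>0 - \<eta>)" for z
    proof (rule smooth)
      fix u :: "real^'n" assume u: "norm u \<le> 1"
      have "norm ((z - y) + \<eta> *\<^sub>R u) \<le> norm (z - y) + \<eta> * norm u"
        using norm_triangle_ineq[of "z - y" "\<eta> *\<^sub>R u"] \<eta> by simp
      also have "\<dots> \<le> (\<eta>0 - \<eta>) + \<eta> * 1"
        using z u \<eta> by (intro add_mono mult_left_mono) (auto simp: dist_norm norm_minus_commute)
      finally have "y + ((z - y) + \<eta> *\<^sub>R u) \<in> E"
        unfolding E_def using y by (intro mem_enlargeI) auto
      then show "z + \<eta> *\<^sub>R u \<in> E" by simp
    qed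
    have "(smoothing \<eta> f has_derivative (\<lambda>a. S.G y \<bullet> a)) (at y)"
      using False \<eta>
      by (intro has_derivative_transfer_nhds[OF open_ball _ sm smoothing_has_derivative[OF S.obj_lipschitz]]) auto
    then show ?thesis unfolding differentiable_def by blast
  qed
  have res: "norm (residual X (smoothing \<eta> f) (1 / c) y) = step_residual c S.G y" if "y \<in> X" "c > 0" for y c
    using residual_eq_step_residual[where g=S.G, OF that(1) smooth_X diff[OF that(1)] smoothing_has_derivative[OF S.obj_lipschitz \<eta>(1)] that(2)] .
  \<comment> \<open>Countably many samples allow one exceptional event for all of them. Outside it
    every direction has norm \<open>\<eta>\<close> and every sample avoids \<open>Z\<close>, so the
    given iterates are those of the modified scheme.\<close>
  have "AE \<omega> in M. \<forall>i\<in>(SIGMA k:UNIV. {1..N k}). norm (snd (W i \<omega>)) = \<eta> \<and> fst (W i \<omega>) \<notin> Z"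
  proof (rule AE_ball_countable[THEN iffD2], safe)
    fix k j assume "j \<in> {1..N k}"
    then have i: "(k, j) \<in> (SIGMA k:UNIV. {1..N k})" by simp
    have [measurable]: "\<xi>s k j \<in> borel_measurable M" "v k j \<in> borel_measurable M"
      using bspec[OF conjunct1[OF assms(21)[unfolded indep_samples_def]] i] by simp_all
    have "AE u in distr M borel (v k j). norm u = \<eta>"
      unfolding assms(23)[OF \<open>j \<in> {1..N k}\<close>] by (rule AE_uniform_sphere[OF \<eta>(1)])
    then have "AE \<omega> in M. norm (v k j \<omega>) = \<eta>"
      by (subst (asm) AE_distr_iff) measurable
    moreover have "AE u in distr M borel (\<xi>s k j). u \<notin> Z"
      unfolding assms(22)[OF \<open>j \<in> {1..N k}\<close>] using AE_Z unfolding P_def .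
    then have "AE \<omega> in M. \<xi>s k j \<omega> \<notin> Z"
      by (subst (asm) AE_distr_iff) measurable
    ultimately show "AE \<omega> in M. norm (snd (W (k, j) \<omega>)) = \<eta> \<and> fst (W (k, j) \<omega>) \<notin> Z"
      by eventually_elim (simp add: W_def)
  qed auto
  then have path: "AE \<omega> in M. \<forall>k. x k \<omega> = S.xs k \<omega>"
    using AE_space
  proof eventually_elim
    case (elim \<omega>)
    show ?case
    proof
      fix k
      show "x k \<omega> = S.xs k \<omega>"
      proof (induction k)
        case 0
        then show ?case using assms(24)[OF elim(2)] by (simp add: S.xs_def)
      next
        case (Suc k)
        let ?y = "S.xs k \<omega>"
        have "zo_grad ft \<eta> ?y (v k j \<omega>) (\<xi>s k j \<omega>) = S.est ?y (W (k, j) \<omega>)" if j: "j \<in> {1..N k}" for j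
        proof -
          have v: "norm (v k j \<omega>) = \<eta>" and z: "\<xi>s k j \<omega> \<notin> Z"
            using elim(1) j by (auto simp: W_def dest!: bspec[of _ _ "(k, j)"])
          have s: "sgn (v k j \<omega>) = v k j \<omega> /\<^sub>R norm (v k j \<omega>)" "\<eta> *\<^sub>R sgn (v k j \<omega>) = v k j \<omega>"
            using v \<eta>(1) by (auto simp: sgn_div_norm)
          have W_apply: "fst (W (k, j) \<omega>) = \<xi>s k j \<omega>" "snd (W (k, j) \<omega>) = v k j \<omega>"
            by (simp_all add: W_def)
          have "?y + v k j \<omega> \<in> E" "?y - v k j \<omega> \<in> E"
            using E_mem[OF S.xs_in, of "v k j \<omega>"] E_mem[OF S.xs_in, of "- v k j \<omega>"] v by auto
          then have "h (?y + v k j \<omega>) (\<xi>s k j \<omega>) = ft (?y + v k j \<omega>) (\<xi>s k j \<omega>)"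
            "h (?y - v k j \<omega>) (\<xi>s k j \<omega>) = ft (?y - v k j \<omega>) (\<xi>s k j \<omega>)"
            using z by (simp_all add: h_def closest_point_self)
          then show ?thesis
            unfolding zo_grad_def S.est_def W_apply s(2) s(1)[symmetric] by simp
        qed
        then have "zo_grad_batch ft \<eta> (N k) ?y (\<lambda>j. v k j \<omega>) (\<lambda>j. \<xi>s k j \<omega>) =
            (1 / real (N k)) *\<^sub>R (\<Sum>j=1..N k. S.est ?y (W (k, j) \<omega>))"
          unfolding zo_grad_batch_def by (intro arg_cong[where f="scaleR _"] sum.cong refl)
        then show ?case
          using assms(25)[OF elim(2), of k] Suc by (simp add: S.xs_def)
      qed
    qed
  qed
  have conclusion: "(AE \<omega> in M. (\<lambda>k. norm (residual X (smoothing \<eta> f) (1 / c) (x k \<omega>))) \<longlonglongrightarrow> 0) \<and>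
      (AE \<omega> in M. seq_limit_points (\<lambda>k. x k \<omega>) \<subseteq> eta_clarke_stationary \<eta> X f)"
    if c: "c > 0" and lim: "AE \<omega> in M. (\<lambda>k. step_residual c S.G (S.xs k \<omega>)) \<longlonglongrightarrow> 0" for c
  proof
    show "AE \<omega> in M. (\<lambda>k. norm (residual X (smoothing \<eta> f) (1 / c) (x k \<omega>))) \<longlonglongrightarrow> 0"
      using path lim by eventually_elim (simp add: res[OF S.xs_in c])
    show "AE \<omega> in M. seq_limit_points (\<lambda>k. x k \<omega>) \<subseteq> eta_clarke_stationary \<eta> X f"
      using path lim
    proof eventually_elim
      case (elim \<omega>)
      have "seq_limit_points (\<lambda>k. S.xs k \<omega>) \<subseteq> eta_clarke_stationary \<eta> X f"
      proof (rule limit_point_eta_clarke_stationary[OF S.obj_lipschitz \<eta>(1) _ S.xs_in c elim(2)])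
        fix y z assume "y \<in> X" "z \<in> ball y \<eta>"
        then have "y + (z - y) \<in> E" by (intro E_mem) (auto simp: dist_norm norm_minus_commute)
        then show "S.obj z = f z" by (simp add: obj)
      qed
      then show ?case using elim(1) by simp
    qed
  qed
  show ?thesis
  proof (rule conjI; intro allI impI)
    fix c \<delta> :: real
    assume a: "0 < c \<and> (L0 \<noteq> 0 \<longrightarrow> c < \<eta> / (sqrt (real CARD('n)) * L0)) \<and> \<delta> > 0 \<and>
        (\<forall>k. \<gamma> k = c) \<and> (\<forall>k. N k = nat \<lceil>(real k + 1) powr (1 + \<delta>)\<rceil>)"
    \<comment> \<open>This restates the stepsize bound, as \<open>smooth_const\<close> is
      \<open>sqrt n * L0 / \<eta>\<close>; it is 0 when \<open>L0 = 0\<close>.\<close>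
    have "c * S.smooth_const < 1"
    proof (cases "L0 = 0")
      case False
      then have "L0 > 0" using S.Lc_nonneg Lc by simp
      then show ?thesis
        using a False \<eta>(1) by (simp add: S.smooth_const_def Lc pos_less_divide_eq field_simps)
    qed (simp add: S.smooth_const_def Lc)
    moreover have "summable (\<lambda>k. \<gamma> k / real (N k))"
      using a summable_inverse_batch[of \<delta> N c] by auto
    ultimately have "AE \<omega> in M. (\<lambda>k. step_residual c S.G (S.xs k \<omega>)) \<longlonglongrightarrow> 0"
      using a m by (intro S.residual_tendsto_0_const) auto
    with conclusion[of c] a
    show "(AE \<omega> in M. (\<lambda>k. norm (residual X (smoothing \<eta> f) (1 / c) (x k \<omega>))) \<longlonglongrightarrow> 0) \<and>
        (AE \<omega> in M. seq_limit_points (\<lambda>k. x k \<omega>) \<subseteq> eta_clarke_stationary \<eta> X f)"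
      by blast
  next
    assume a: "\<gamma> \<longlonglongrightarrow> 0 \<and> summable (\<lambda>k. (\<gamma> k)\<^sup>2) \<and> \<not> summable \<gamma> \<and>
        (L0 \<noteq> 0 \<longrightarrow> \<gamma> 0 < \<eta> / (2 * sqrt (real CARD('n)) * L0)) \<and> summable (\<lambda>k. \<gamma> k / real (N k))"
    then have "AE \<omega> in M. (\<lambda>k. step_residual (\<gamma> 0) S.G (S.xs k \<omega>)) \<longlonglongrightarrow> 0"
      using m by (intro S.residual_tendsto_0_diminishing) auto
    with conclusion[of "\<gamma> 0"] \<open>\<And>k. \<gamma> k > 0\<close>
    show "(AE \<omega> in M. (\<lambda>k. norm (residual X (smoothing \<eta> f) (1 / \<gamma> 0) (x k \<omega>))) \<longlonglongrightarrow> 0) \<and>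
        (AE \<omega> in M. seq_limit_points (\<lambda>k. x k \<omega>) \<subseteq> eta_clarke_stationary \<eta> X f)"
      by blast
  qed
qed

end
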